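(* Let $p$ be a prime, let $n$ be a positive integer, let $A\cong C_{p^n}\times C_p$, and let $G$ be a finite group. Suppose that $C(G)=C(A)$. Then $G\cong A$ if one of the following holds: (1) $G$ has a metacyclic maximal subgroup; (2) the derived subgroup $G'$ is generated by two elements; (3) the derived subgroup $G'$ is abelian.
   Context: All groups are finite. $C_m$ denotes the cyclic group of order $m$, and $G'$ the derived subgroup of $G$. A group is metacyclic if it has a cyclic normal subgroup with cyclic quotient. ${\rm Irr}(G)$ denotes the set of complex irreducible characters of $G$. For $\chi\in{\rm Irr}(G)$ the codegree of $\chi$ is ${\rm cod}\,\chi=\frac{|G:\ker\chi|}{\chi(1)}$, and ${\rm Cod}(G)=\{{\rm cod}\,\chi\mid\chi\in{\rm Irr}(G)\}$. The group pseudo-algebra of $G$ is $C(G)=\{(d,m_G(d))\mid d\in{\rm Cod}(G)\}$, where $m_G(d)$ is the number of irreducible characters of $G$ with codegree $d$. *)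

theory Defs
  imports
    Complex_Main
    "HOL-Computational_Algebra.Primes"
    "HOL-Algebra.Elementary_Groups"
    "Jordan_Normal_Form.VS_Connect"
begin

definition representation ::
    "('a, 'b) monoid_scheme \<Rightarrow> nat \<Rightarrow> ('a \<Rightarrow> complex mat) \<Rightarrow> bool" where
  "representation G n \<rho> \<longleftrightarrow> \<rho> \<in> hom G (units_of (ring_mat TYPE(complex) n ()))"

text \<open>The zero-dimensional representation is not irreducible, hence the condition on \<open>n\<close>.\<close>

definition irreducible_representation ::
    "('a, 'b) monoid_scheme \<Rightarrow> nat \<Rightarrow> ('a \<Rightarrow> complex mat) \<Rightarrow> bool" where
  "irreducible_representation G n \<rho> \<longleftrightarrow>
     representation G n \<rho> \<and> n > 0 \<and>
     (\<forall>W. VectorSpace.subspace class_ring W (module_vec TYPE(complex) n) \<and>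
          (\<forall>g\<in>carrier G. \<forall>w\<in>W. \<rho> g *\<^sub>v w \<in> W)
          \<longrightarrow> W = {0\<^sub>v n} \<or> W = carrier_vec n)"

text \<open>Characters are made \<open>undefined\<close> outside the carrier, so that two of them are equal as
  HOL functions exactly if they agree on the group; this matters when characters are counted.\<close>

definition character ::
    "('a, 'b) monoid_scheme \<Rightarrow> nat \<Rightarrow> ('a \<Rightarrow> complex mat) \<Rightarrow> 'a \<Rightarrow> complex" where
  "character G n \<rho> = (\<lambda>g\<in>carrier G. \<Sum>i<n. \<rho> g $$ (i, i))"

definition Irr :: "('a, 'b) monoid_scheme \<Rightarrow> ('a \<Rightarrow> complex) set" where
  "Irr G = {character G n \<rho> | n \<rho>. irreducible_representation G n \<rho>}"

definition character_kernel :: "('a, 'b) monoid_scheme \<Rightarrow> ('a \<Rightarrow> complex) \<Rightarrow> 'a set" where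
  "character_kernel G \<chi> = {g \<in> carrier G. \<chi> g = \<chi> \<one>\<^bsub>G\<^esub>}"

text \<open>The codegree of an irreducible character is a positive integer; it is taken here as a
  complex number so that the division is exact without presupposing this.\<close>

definition codegree :: "('a, 'b) monoid_scheme \<Rightarrow> ('a \<Rightarrow> complex) \<Rightarrow> complex" where
  "codegree G \<chi> = of_nat (card (rcosets\<^bsub>G\<^esub> (character_kernel G \<chi>))) / \<chi> \<one>\<^bsub>G\<^esub>"

definition Cod :: "('a, 'b) monoid_scheme \<Rightarrow> complex set" where
  "Cod G = codegree G ` Irr G"

definition codegree_multiplicity :: "('a, 'b) monoid_scheme \<Rightarrow> complex \<Rightarrow> nat" where
  "codegree_multiplicity G d = card {\<chi> \<in> Irr G. codegree G \<chi> = d}"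

definition group_pseudo_algebra :: "('a, 'b) monoid_scheme \<Rightarrow> (complex \<times> nat) set" where
  "group_pseudo_algebra G = {(d, codegree_multiplicity G d) | d. d \<in> Cod G}"

definition metacyclic :: "('a, 'b) monoid_scheme \<Rightarrow> bool" where
  "metacyclic G \<longleftrightarrow>
     (\<exists>N. N \<lhd> G \<and> cyclic_group (G\<lparr>carrier := N\<rparr>) \<and> cyclic_group (G Mod N))"

definition maximal_subgroup :: "'a set \<Rightarrow> ('a, 'b) monoid_scheme \<Rightarrow> bool" where
  "maximal_subgroup M G \<longleftrightarrow>
     subgroup M G \<and> M \<noteq> carrier G \<and>
     (\<forall>H. subgroup H G \<and> M \<subseteq> H \<longrightarrow> H = M \<or> H = carrier G)"

end

theory Submission
  imports
    Defs
    "Jordan_Normal_Form.Schur_Decomposition"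
    "Jordan_Normal_Form.Spectral_Radius"
    "HOL-Algebra.Multiplicative_Group"
    "HOL-Algebra.Group_Action"
    "HOL-Algebra.SndIsomorphismGrp"
begin

text \<open>
  Suppose that all codegrees are powers of \<open>p\<close>, and let \<open>q \<noteq> p\<close> be a prime. The characters of degree
  prime to \<open>q\<close> are those containing in their kernel a normal subgroup of index prime to \<open>q\<close>, and
  comparing the sums of the squares of the degrees modulo \<open>q\<close> shows that \<open>q\<close> does not divide \<open>|G|\<close>;
  so \<open>G\<close> is a \<open>p\<close>-group. Counting characters by codegree gives
  \<open>|G : G'| = p\<^bsup>a+1\<^esup>\<close> with \<open>a \<le> n\<close>, and the linear characters are exactly those of codegree at most
  \<open>p\<^bsup>a\<^esup>\<close>; hence every nonlinear \<open>\<chi>\<close> satisfies \<open>|G : ker \<chi>| \<ge> |G : G'| \<chi>(1)\<close>. If \<open>a < n\<close> and \<open>N\<close> is normal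
  of index \<open>p\<close> in \<open>G'\<close>, this forces every normal subgroup properly containing \<open>N\<close> to contain \<open>G'\<close>.
  Let \<open>a \<ge> 2\<close>, and let \<open>x\<close> generate \<open>G\<close> modulo the kernel of a linear character of order \<open>p\<^bsup>a\<^esup>\<close>.
  As \<open>p\<close>-th powers are central modulo \<open>N\<close>, it follows that \<open>G' \<subseteq> \<langle>x\<^bsup>q\<^esup>\<rangle> N\<close> with \<open>q = p\<^sup>2\<close>. If \<open>N\<close> were
  nontrivial and \<open>N/L\<close> a chief factor, then \<open>G'/L\<close> would be central and generated by one commutator
  of order \<open>p\<close>, although its order is \<open>p\<^sup>2\<close>. So \<open>|G'| = p\<close>, and \<open>|G|\<close> is at most the number of
  irreducible characters, which is absurd. For \<open>a = 1\<close> all \<open>p\<^sup>3 - p\<^sup>2\<close> characters of codegree \<open>p\<^sup>2\<close>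
  would share a kernel of index \<open>p\<^sup>3\<close>, which has too few characters. So \<open>a = n\<close>, every character
  is linear, and \<open>G\<close> is abelian with the order and the exponent of \<open>A\<close>.
\<close>

section \<open>Complex matrices and their traces\<close>

text \<open>What C(A) yields is that all codegrees are p^j with j <= n and that p^(j+1) characters
  have codegree at most p^j when 1 <= j <= n. A nonlinear chi has chi(1)^2 < |G : ker chi|, so its
  degree is less than its codegree; codegree at most p thus forces linearity, and G/G', with p^2 or
  more characters of order dividing p, is not cyclic. So no linear character has order |G : G'| =
  p^(a+1): the p^(a+1) linear characters lie among the p^(a+1) characters of codegree at most p^a
  and exhaust them. Hence the bound for nonlinear chi. It leaves no room above N, because |G : N| =
  p |G : G'| and chi(1) >= p. The case a = 1 stands apart because the argument with <x^p>N relies on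
  x^p lying outside G', whereas G/G' has exponent p if a = 1. The exponent p^2 for a >= 2 bounds the
  order of commutators modulo L: x^q then commutes with the second generator y of G modulo G', which
  makes G'/L central. The final absurdity sets |G| = p^(a+2) <= p^(n+1) against p^(n+1) irreducible
  characters, not all linear.\<close>

definition tr :: "complex mat \<Rightarrow> complex" where
  "tr A = (\<Sum>i<dim_row A. A $$ (i, i))"

lemma tr_mult_comm:
  assumes "A \<in> carrier_mat n m" "B \<in> carrier_mat m n"
  shows "tr (A * B) = tr (B * A)"
proof -
  have "tr (A * B) = (\<Sum>i<n. \<Sum>j<m. A $$ (i, j) * B $$ (j, i))"
    using assms by (auto simp: tr_def scalar_prod_def atLeast0LessThan intro!: sum.cong)
  also have "\<dots> = (\<Sum>j<m. \<Sum>i<n. A $$ (i, j) * B $$ (j, i))"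
    by (rule sum.swap)
  also have "\<dots> = tr (B * A)"
    using assms by (auto simp: tr_def scalar_prod_def atLeast0LessThan mult.commute intro!: sum.cong)
  finally show ?thesis .
qed

lemma tr_add: "A \<in> carrier_mat n n \<Longrightarrow> B \<in> carrier_mat n n \<Longrightarrow> tr (A + B) = tr A + tr B"
  by (auto simp: tr_def sum.distrib intro!: sum.cong)

lemma tr_one [simp]: "tr (1\<^sub>m n) = of_nat n"
  by (simp add: tr_def)

section \<open>Subspaces as ranges of injective matrices\<close>

lemma subspace_iff:
  "VectorSpace.subspace class_ring W (module_vec TYPE(complex) n) \<longleftrightarrow>
     W \<subseteq> carrier_vec n \<and> 0\<^sub>v n \<in> W \<and> (\<forall>v\<in>W. \<forall>w\<in>W. v + w \<in> W) \<and> (\<forall>a. \<forall>v\<in>W. a \<cdot>\<^sub>v v \<in> W)"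
  (is "?L = ?R")
proof
  assume ?L
  then have "submodule class_ring W (module_vec TYPE(complex) n)"
    by (simp add: VectorSpace.subspace_def)
  then show ?R
    unfolding submodule_def by (auto simp: module_vec_simps class_ring_simps)
next
  assume ?R
  then have "submodule class_ring W (module_vec TYPE(complex) n)"
    unfolding submodule_def using vec_module[of n] by (auto simp: module_vec_simps class_ring_simps)
  then show ?L
    using vec_vs[of n] by (simp add: VectorSpace.subspace_def)
qed

lemma det_nonzero_inverse:
  fixes A :: "complex mat"
  assumes "A \<in> carrier_mat n n" "\<And>v. v \<in> carrier_vec n \<Longrightarrow> A *\<^sub>v v = 0\<^sub>v n \<Longrightarrow> v = 0\<^sub>v n"
  shows "\<exists>B\<in>carrier_mat n n. B * A = 1\<^sub>m n"
proof -
  have "det A \<noteq> 0"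
    using det_0_iff_vec_prod_zero_field[OF assms(1)] assms(2) by auto
  from det_non_zero_imp_unit[OF assms(1) this, of "()"]
  show ?thesis
    by (auto simp: Units_def ring_mat_simps)
qed

definition inj_mat :: "complex mat \<Rightarrow> bool" where
  "inj_mat B \<longleftrightarrow> (\<forall>v\<in>carrier_vec (dim_col B). B *\<^sub>v v = 0\<^sub>v (dim_row B) \<longrightarrow> v = 0\<^sub>v (dim_col B))"

lemma mult_mat_vec_index:
  assumes "(A :: complex mat) \<in> carrier_mat n m" "w \<in> carrier_vec m" "i < n"
  shows "(A *\<^sub>v w) $ i = (\<Sum>j<m. A $$ (i, j) * w $ j)"
  using assms by (auto simp: scalar_prod_def atLeast0LessThan intro!: sum.cong)

text \<open>For the conjugate transpose A of B, A B v = 0 gives |B v|^2 = 0 and so v = 0. The Gram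
  matrix A B is therefore invertible, and its inverse times A inverts B on the left.\<close>

lemma inj_mat_left_inverse:
  assumes B: "B \<in> carrier_mat n k" and "inj_mat B"
  shows "\<exists>B'\<in>carrier_mat k n. B' * B = 1\<^sub>m k"
proof -
  define A where "A = mat k n (\<lambda>(j, i). cnj (B $$ (i, j)))"
  have A: "A \<in> carrier_mat k n" by (simp add: A_def)
  have "v = 0\<^sub>v k" if v: "v \<in> carrier_vec k" and 0: "(A * B) *\<^sub>v v = 0\<^sub>v k" for v
  proof -
    let ?w = "B *\<^sub>v v"
    have w: "?w \<in> carrier_vec n" using B v by simp
    have Aw: "A *\<^sub>v ?w = 0\<^sub>v k" using 0 A B v by (simp add: assoc_mult_mat_vec)
    define f where "f i = ?w $ i" for i
    have f: "f i = (\<Sum>j<k. B $$ (i, j) * v $ j)" if "i < n" for i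
      unfolding f_def by (rule mult_mat_vec_index[OF B v that])
    have 0: "(\<Sum>i<n. cnj (B $$ (i, j)) * f i) = 0" if j: "j < k" for j
    proof -
      have "(\<Sum>i<n. cnj (B $$ (i, j)) * f i) = (\<Sum>i<n. A $$ (j, i) * ?w $ i)"
        unfolding f_def using j by (intro sum.cong) (auto simp: A_def)
      also have "\<dots> = (A *\<^sub>v ?w) $ j"
        by (rule mult_mat_vec_index[OF A w j, symmetric])
      finally show ?thesis unfolding Aw using j by simp
    qed
    have "?w \<bullet>c ?w = (\<Sum>i<n. f i * cnj (f i))"
      using w B unfolding f_def scalar_prod_def by (auto simp: atLeast0LessThan simp del: index_mult_mat_vec)
    also have "\<dots> = (\<Sum>i<n. \<Sum>j<k. v $ j * (B $$ (i, j) * cnj (f i)))"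
    proof (intro sum.cong refl)
      fix i assume "i \<in> {..<n}"
      then have "f i * c = (\<Sum>j<k. v $ j * (B $$ (i, j) * c))" for c
        using f[of i] by (simp add: sum_distrib_left mult_ac)
      then show "f i * cnj (f i) = (\<Sum>j<k. v $ j * (B $$ (i, j) * cnj (f i)))" .
    qed
    also have "\<dots> = (\<Sum>j<k. \<Sum>i<n. v $ j * (B $$ (i, j) * cnj (f i)))"
      by (rule sum.swap)
    also have "\<dots> = (\<Sum>j<k. v $ j * cnj (\<Sum>i<n. cnj (B $$ (i, j)) * f i))"
      by (simp add: sum_distrib_left)
    also have "\<dots> = 0" by (simp add: 0)
    finally have "?w = 0\<^sub>v n" using conjugate_square_eq_0_vec[OF w] by simp
    then show ?thesis using assms v by (auto simp: inj_mat_def)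
  qed
  from det_nonzero_inverse[OF mult_carrier_mat[OF A B] this]
  obtain X where X: "X \<in> carrier_mat k k" "X * (A * B) = 1\<^sub>m k" by blast
  then show ?thesis
    using A B by (intro bexI[of _ "X * A"]) auto
qed

text \<open>Padded with zero rows to a square matrix, B would stay injective and hence be
  invertible, although its row n is zero.\<close>

lemma inj_mat_cols_le:
  assumes B: "B \<in> carrier_mat n k" and "inj_mat B"
  shows "k \<le> n"
proof (rule ccontr)
  assume "\<not> k \<le> n"
  then have nk: "n < k" by simp
  define M where "M = mat k k (\<lambda>(i, j). if i < n then B $$ (i, j) else 0)"
  have M: "M \<in> carrier_mat k k" by (simp add: M_def)
  have "v = 0\<^sub>v k" if v: "v \<in> carrier_vec k" and 0: "M *\<^sub>v v = 0\<^sub>v k" for v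
  proof -
    have "B *\<^sub>v v = 0\<^sub>v n"
    proof (rule eq_vecI)
      fix i assume i: "i < dim_vec (0\<^sub>v n)"
      have "(B *\<^sub>v v) $ i = (M *\<^sub>v v) $ i"
        using B v i nk by (auto simp: M_def scalar_prod_def intro!: sum.cong)
      then show "(B *\<^sub>v v) $ i = 0\<^sub>v n $ i" using 0 i nk by simp
    qed (use B in auto)
    then show ?thesis using assms v by (auto simp: inj_mat_def)
  qed
  from det_nonzero_inverse[OF M this]
  obtain X where X: "X \<in> carrier_mat k k" "X * M = 1\<^sub>m k" by blast
  have "M * X = 1\<^sub>m k" using mat_mult_left_right_inverse[OF X(1) M X(2)] .
  then have "(M * X) $$ (n, n) = 1" using nk by simp
  moreover have "(M * X) $$ (n, n) = 0"
    using nk X by (auto simp: M_def scalar_prod_def)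
  ultimately show False by simp
qed

text \<open>The columns of B are a basis of W. An injective matrix with range in W and as many
  columns as possible works: a vector of W outside the range could be appended as a further
  column.\<close>

lemma subspace_has_basis_mat:
  assumes W: "VectorSpace.subspace class_ring W (module_vec TYPE(complex) n)"
  shows "\<exists>k. \<exists>B\<in>carrier_mat n k. inj_mat B \<and> W = {B *\<^sub>v v | v. v \<in> carrier_vec k}"
proof -
  define P where "P k \<longleftrightarrow> (\<exists>B\<in>carrier_mat n k. inj_mat B \<and> {B *\<^sub>v v | v. v \<in> carrier_vec k} \<subseteq> W)" for k
  have W': "W \<subseteq> carrier_vec n" "0\<^sub>v n \<in> W" "\<And>v w. v \<in> W \<Longrightarrow> w \<in> W \<Longrightarrow> v + w \<in> W" "\<And>a v. v \<in> W \<Longrightarrow> a \<cdot>\<^sub>v v \<in> W"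
    using W by (auto simp: subspace_iff)
  have "P 0"
    unfolding P_def
  proof (intro bexI[of _ "0\<^sub>m n 0"] conjI)
    show "inj_mat (0\<^sub>m n 0)" by (auto simp: inj_mat_def)
    show "{0\<^sub>m n 0 *\<^sub>v v |v. v \<in> carrier_vec 0} \<subseteq> W"
    proof -
      have "0\<^sub>m n 0 *\<^sub>v v = 0\<^sub>v n" if "v \<in> carrier_vec 0" for v :: "complex vec"
        using that by (intro eq_vecI) (auto simp: scalar_prod_def)
      then show ?thesis using W'(2) by auto
    qed
  qed simp
  moreover have "\<forall>k. P k \<longrightarrow> k \<le> n"
    unfolding P_def using inj_mat_cols_le by blast
  ultimately have Pm: "P (GREATEST k. P k)" and max: "\<And>j. P j \<Longrightarrow> j \<le> (GREATEST k. P k)"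
    by (metis GreatestI_nat, metis Greatest_le_nat)
  define k where "k = (GREATEST k. P k)"
  obtain B where B: "B \<in> carrier_mat n k" "inj_mat B" and sub: "{B *\<^sub>v v | v. v \<in> carrier_vec k} \<subseteq> W"
    using Pm unfolding P_def k_def by blast
  have "w \<in> {B *\<^sub>v v | v. v \<in> carrier_vec k}" if w: "w \<in> W" for w
  proof (rule ccontr)
    assume nw: "w \<notin> {B *\<^sub>v v | v. v \<in> carrier_vec k}"
    have wn: "w \<in> carrier_vec n" using w W' by auto
    define C where "C = mat n (Suc k) (\<lambda>(i, j). if j < k then B $$ (i, j) else w $ i)"
    have C: "C \<in> carrier_mat n (Suc k)" by (simp add: C_def)
    have Cv: "C *\<^sub>v v = B *\<^sub>v vec k (\<lambda>j. v $ j) + (v $ k) \<cdot>\<^sub>v w" if v: "v \<in> carrier_vec (Suc k)" for v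
      using v B wn by (intro eq_vecI) (auto simp: C_def scalar_prod_def intro!: sum.cong)
    have "P (Suc k)"
      unfolding P_def
    proof (intro bexI[of _ C] conjI)
      show "{C *\<^sub>v v |v. v \<in> carrier_vec (Suc k)} \<subseteq> W"
      proof -
        have "B *\<^sub>v u \<in> W" if "u \<in> carrier_vec k" for u using sub that by auto
        then show ?thesis by (auto simp: Cv intro!: W'(3,4) w)
      qed
      show "inj_mat C"
        unfolding inj_mat_def
      proof (intro ballI impI)
        fix v assume "v \<in> carrier_vec (dim_col C)" and "C *\<^sub>v v = 0\<^sub>v (dim_row C)"
        then have v: "v \<in> carrier_vec (Suc k)" and 0: "C *\<^sub>v v = 0\<^sub>v n" using C by auto
        let ?u = "vec k (\<lambda>j. v $ j)"
        have eq: "B *\<^sub>v ?u + (v $ k) \<cdot>\<^sub>v w = 0\<^sub>v n" using 0 Cv[OF v] by simp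
        have Bu: "B *\<^sub>v ?u \<in> carrier_vec n" using B by simp
        have vk: "v $ k = 0"
        proof (rule ccontr)
          assume a: "v $ k \<noteq> 0"
          have "w = B *\<^sub>v ((- inverse (v $ k)) \<cdot>\<^sub>v ?u)"
          proof (rule eq_vecI)
            show "dim_vec w = dim_vec (B *\<^sub>v (- inverse (v $ k) \<cdot>\<^sub>v ?u))" using wn B by simp
            fix i assume "i < dim_vec (B *\<^sub>v (- inverse (v $ k) \<cdot>\<^sub>v ?u))"
            then have i: "i < n" using B by simp
            have "(B *\<^sub>v ?u + (v $ k) \<cdot>\<^sub>v w) $ i = 0" using eq i by simp
            then have e: "(B *\<^sub>v ?u) $ i + v $ k * w $ i = 0"
              using i B wn by simp
            have "(B *\<^sub>v (- inverse (v $ k) \<cdot>\<^sub>v ?u)) $ i = - inverse (v $ k) * (B *\<^sub>v ?u) $ i"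
              using B i mult_mat_vec[OF B(1), of ?u] by simp
            moreover from e have "(B *\<^sub>v ?u) $ i = - (v $ k * w $ i)" by (simp only: eq_neg_iff_add_eq_0)
            ultimately show "w $ i = (B *\<^sub>v (- inverse (v $ k) \<cdot>\<^sub>v ?u)) $ i"
              using a by simp
          qed
          then show False using nw by auto
        qed
        then have "(v $ k) \<cdot>\<^sub>v w = 0\<^sub>v n" using wn by auto
        then have "B *\<^sub>v ?u = 0\<^sub>v n" using eq Bu by simp
        then have u0: "?u = 0\<^sub>v k" using B by (auto simp: inj_mat_def)
        have "v $ j = 0" if "j < Suc k" for j
        proof (cases "j = k")
          case False
          then have "j < k" using that by simp
          then have "?u $ j = 0" using u0 by simp
          then show ?thesis using \<open>j < k\<close> by simp
        qed (use vk in simp)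
        then show "v = 0\<^sub>v (dim_col C)" using v C by (intro eq_vecI) auto
      qed
    qed (rule C)
    then have "Suc k \<le> k" using max unfolding k_def by blast
    then show False by simp
  qed
  then show ?thesis using B sub by blast
qed

lemma range_subspace:
  assumes M: "(M :: complex mat) \<in> carrier_mat n k"
  shows "VectorSpace.subspace class_ring {M *\<^sub>v v | v. v \<in> carrier_vec k} (module_vec TYPE(complex) n)"
  unfolding subspace_iff
proof (intro conjI ballI allI)
  show "{M *\<^sub>v v | v. v \<in> carrier_vec k} \<subseteq> carrier_vec n" using M by auto
  show "0\<^sub>v n \<in> {M *\<^sub>v v |v. v \<in> carrier_vec k}"
    using M by (auto intro!: exI[of _ "0\<^sub>v k"] eq_vecI)
next
  fix v w assume "v \<in> {M *\<^sub>v v |v. v \<in> carrier_vec k}" "w \<in> {M *\<^sub>v v |v. v \<in> carrier_vec k}"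
  then show "v + w \<in> {M *\<^sub>v v |v. v \<in> carrier_vec k}"
    using mult_add_distrib_mat_vec[OF M] by (auto) (metis add_carrier_vec)
next
  fix a v assume "v \<in> {M *\<^sub>v v |v. v \<in> carrier_vec k}"
  then show "a \<cdot>\<^sub>v v \<in> {M *\<^sub>v v |v. v \<in> carrier_vec k}"
    using mult_mat_vec[OF M] by auto (metis smult_carrier_vec)
qed

lemma mat_eq_by_vec:
  assumes "(A :: complex mat) \<in> carrier_mat n m" "B \<in> carrier_mat n m"
    and eq: "\<And>v. v \<in> carrier_vec m \<Longrightarrow> A *\<^sub>v v = B *\<^sub>v v"
  shows "A = B"
proof (rule eq_matI)
  fix i j assume "i < dim_row B" "j < dim_col B"
  then have ij: "i < n" "j < m" using assms by auto
  have "C $$ (i, j) = (C *\<^sub>v unit_vec m j) $ i" if "C \<in> carrier_mat n m" for C :: "complex mat"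
    using that ij by simp
  then show "A $$ (i, j) = B $$ (i, j)"
    using eq[of "unit_vec m j"] assms by simp
qed (use assms in auto)

text \<open>B and C' include W and a complement of it, B' and C are the matching projections. The
  relation \<open>C * B = 0\<^sub>m m k\<close> is what turns an invariant W into a block triangular
  form.\<close>

lemma subspace_splitting:
  assumes W: "VectorSpace.subspace class_ring W (module_vec TYPE(complex) n)"
  obtains k m B B' C C' where
    "B \<in> carrier_mat n k" "B' \<in> carrier_mat k n" "C \<in> carrier_mat m n" "C' \<in> carrier_mat n m"
    "B' * B = 1\<^sub>m k" "C * C' = 1\<^sub>m m" "C * B = 0\<^sub>m m k" "B * B' + C' * C = 1\<^sub>m n"
    "W = {B *\<^sub>v v | v. v \<in> carrier_vec k}"
proof -
  obtain k B where B: "B \<in> carrier_mat n k" "inj_mat B" and WB: "W = {B *\<^sub>v v | v. v \<in> carrier_vec k}"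
    using subspace_has_basis_mat[OF W] by blast
  obtain B' where B': "B' \<in> carrier_mat k n" "B' * B = 1\<^sub>m k"
    using inj_mat_left_inverse[OF B] by blast
  \<comment> \<open>The projection along W onto a complement: it kills the columns of B and is
    idempotent.\<close>
  define F where "F = 1\<^sub>m n - B * B'"
  have F: "F \<in> carrier_mat n n" unfolding F_def using B B' by (intro minus_carrier_mat) auto
  have FB: "F * B = 0\<^sub>m n k"
  proof -
    have "F * B = 1\<^sub>m n * B - B * B' * B" unfolding F_def using B B' by (intro minus_mult_distrib_mat) auto
    also have "B * B' * B = B" using B B' by (simp add: assoc_mult_mat[of B n k B' n B k])
    finally show ?thesis using B by simp
  qed
  have FF: "F * F = F"
  proof -
    have "F * F = F * (1\<^sub>m n - B * B')" by (simp add: F_def)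
    also have "\<dots> = F * 1\<^sub>m n - F * (B * B')"
      using F B B' by (intro mult_minus_distrib_mat) auto
    also have "F * (B * B') = 0\<^sub>m n n" 
      using F B B' FB assoc_mult_mat[of F n n B k B' n] by simp
    finally show ?thesis using F by (simp add: minus_mat_def) (auto intro!: eq_matI)
  qed
  obtain m C' where C': "C' \<in> carrier_mat n m" "inj_mat C'"
    and FC: "{F *\<^sub>v v | v. v \<in> carrier_vec n} = {C' *\<^sub>v v | v. v \<in> carrier_vec m}"
    using subspace_has_basis_mat[OF range_subspace[OF F]] by blast
  obtain X where X: "X \<in> carrier_mat m n" "X * C' = 1\<^sub>m m"
    using inj_mat_left_inverse[OF C'] by blast
  \<comment> \<open>X alone inverts C' on the left but may fail to kill B; composing with F repairs
    this, and F fixes C'.\<close>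
  define C where "C = X * F"
  have C: "C \<in> carrier_mat m n" using X F by (simp add: C_def)
  have FC': "F * C' = C'"
  proof (rule mat_eq_by_vec[of _ n m])
    fix v :: "complex vec" assume v: "v \<in> carrier_vec m"
    obtain u where u: "u \<in> carrier_vec n" "C' *\<^sub>v v = F *\<^sub>v u" using FC v by blast
    have "F *\<^sub>v (F *\<^sub>v u) = F *\<^sub>v u" using FF F u by (metis assoc_mult_mat_vec)
    then show "F * C' *\<^sub>v v = C' *\<^sub>v v" using F C' v u by simp
  qed (use F C' in auto)
  have C'C: "C' * C = F"
  proof (rule mat_eq_by_vec[of _ n n])
    fix v :: "complex vec" assume v: "v \<in> carrier_vec n"
    obtain u where u: "u \<in> carrier_vec m" "F *\<^sub>v v = C' *\<^sub>v u" using FC v by blast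
    have "(C' * C) *\<^sub>v v = C' *\<^sub>v (X *\<^sub>v (F *\<^sub>v v))" 
      using C'(1) X(1) F v C assoc_mult_mat_vec[OF C'(1) C v] assoc_mult_mat_vec[OF X(1) F v] by (simp add: C_def)
    also have "X *\<^sub>v (F *\<^sub>v v) = (X * C') *\<^sub>v u" 
      using u(2) assoc_mult_mat_vec[OF X(1) C'(1) u(1)] by simp
    finally show "C' * C *\<^sub>v v = F *\<^sub>v v" using u X by simp
  qed (use F C' C in auto)
  show ?thesis
  proof (rule that[OF B(1) B'(1) C C'(1) B'(2) _ _ _ WB])
    show "C * C' = 1\<^sub>m m" using X F C' FC' by (simp add: C_def assoc_mult_mat[of X m n F n C' m])
    show "C * B = 0\<^sub>m m k" using X F B FB by (simp add: C_def assoc_mult_mat[of X m n F n B k])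
    show "B * B' + C' * C = 1\<^sub>m n" unfolding C'C F_def using B B' by (intro eq_matI) auto
  qed
qed

section \<open>Triangular matrices and matrices of finite order\<close>

lemma upper_triangular_mult:
  fixes A B :: "complex mat"
  assumes A: "A \<in> carrier_mat n n" "upper_triangular A" and B: "B \<in> carrier_mat n n" "upper_triangular B"
  shows "upper_triangular (A * B)" "\<And>i. i < n \<Longrightarrow> (A * B) $$ (i, i) = A $$ (i, i) * B $$ (i, i)"
proof -
  have *: "(A * B) $$ (i, j) = (\<Sum>k<n. A $$ (i, k) * B $$ (k, j))" if "i < n" "j < n" for i j
    using that A B by (auto simp: scalar_prod_def atLeast0LessThan intro!: sum.cong)
  have 0: "A $$ (i, k) * B $$ (k, j) = 0" if "i < n" "k < n" "j < i \<or> (j = i \<and> k \<noteq> i)" for i j k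
  proof (cases "k < i")
    case True
    then have "A $$ (i, k) = 0" using A that upper_triangularD[of A k i] by auto
    then show ?thesis by simp
  next
    case False then have "j < k" using that by auto
    then have "B $$ (k, j) = 0" using B that upper_triangularD[of B j k] by auto
    then show ?thesis by simp
  qed
  show "upper_triangular (A * B)"
  proof (rule upper_triangularI)
    fix i j assume "j < i" "i < dim_row (A * B)"
    then show "(A * B) $$ (i, j) = 0" using *[of i j] 0[of i _ j] A by (simp del: index_mult_mat(1))
  qed
  fix i assume i: "i < n"
  have "(\<Sum>k<n. A $$ (i, k) * B $$ (k, i)) = (\<Sum>k<n. if k = i then A $$ (i, i) * B $$ (i, i) else 0)"
    using 0[OF i] by (intro sum.cong) auto
  then show "(A * B) $$ (i, i) = A $$ (i, i) * B $$ (i, i)"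
    using *[OF i i] i by (simp del: index_mult_mat(1))
qed

primrec geometric_mat :: "complex mat \<Rightarrow> nat \<Rightarrow> complex mat" where
  "geometric_mat A 0 = 0\<^sub>m (dim_row A) (dim_row A)"
| "geometric_mat A (Suc k) = 1\<^sub>m (dim_row A) + A * geometric_mat A k"

lemma geometric_mat_carrier: "A \<in> carrier_mat n n \<Longrightarrow> geometric_mat A k \<in> carrier_mat n n"
  by (induction k) auto

lemma mult_pow_mat:
  assumes "A \<in> carrier_mat n n"
  shows "A * A ^\<^sub>m k = A ^\<^sub>m Suc k"
proof (induction k)
  case (Suc k)
  have "A * A ^\<^sub>m Suc k = A * A ^\<^sub>m k * A"
    using assms assoc_mult_mat[of A n n "A ^\<^sub>m k" n A n] by simp
  then show ?case using Suc by simp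
qed (use assms in simp)

text \<open>Both sides are 1 + A + ... + A^k. This is (1 - A) (1 + ... + A^(k-1)) = 1 - A^k with the
  subtraction removed.\<close>

lemma geometric_mat_telescope:
  assumes A: "A \<in> carrier_mat n n"
  shows "1\<^sub>m n + A * geometric_mat A k = geometric_mat A k + A ^\<^sub>m k"
proof (induction k)
  case 0
  then show ?case using A by auto
next
  case (Suc k)
  have G: "geometric_mat A k \<in> carrier_mat n n" "A ^\<^sub>m k \<in> carrier_mat n n" 
    using A geometric_mat_carrier pow_carrier_mat by auto
  have "1\<^sub>m n + A * geometric_mat A (Suc k) = 1\<^sub>m n + A * (geometric_mat A k + A ^\<^sub>m k)"
    using A Suc by simp
  also have "\<dots> = 1\<^sub>m n + (A * geometric_mat A k + A * A ^\<^sub>m k)"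
    using A G by (simp add: mult_add_distrib_mat)
  also have "A * A ^\<^sub>m k = A ^\<^sub>m Suc k" using A by (rule mult_pow_mat)
  also have "1\<^sub>m n + (A * geometric_mat A k + A ^\<^sub>m Suc k) = geometric_mat A (Suc k) + A ^\<^sub>m Suc k"
    using A G mult_carrier_mat[OF G(2) A] assoc_add_mat[of "1\<^sub>m n" n n "A * geometric_mat A k" "A ^\<^sub>m Suc k"]
    by simp
  finally show ?case .
qed

text \<open>S = 1 + A + ... + A^(m-1) is triangular with m on the diagonal, hence invertible, and
  A^m = 1 gives A S = S.\<close>

lemma upper_triangular_finite_order:
  fixes A :: "complex mat"
  assumes A: "A \<in> carrier_mat n n" "upper_triangular A" and diag: "\<And>i. i < n \<Longrightarrow> A $$ (i, i) = 1"
    and m: "m > 0" "A ^\<^sub>m m = 1\<^sub>m n"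
  shows "A = 1\<^sub>m n"
proof -
  let ?S = "geometric_mat A m"
  have S: "?S \<in> carrier_mat n n" using A(1) by (rule geometric_mat_carrier)
  have ut: "upper_triangular (geometric_mat A k) \<and> (\<forall>i<n. geometric_mat A k $$ (i, i) = of_nat k)" for k
  proof (induction k)
    case 0
    then show ?case using A(1) by simp
  next
    case (Suc k)
    have G: "geometric_mat A k \<in> carrier_mat n n" using A(1) by (rule geometric_mat_carrier)
    note t = upper_triangular_mult[OF A G]
    have "upper_triangular (A * geometric_mat A k)" using t(1) Suc by simp
    then have "upper_triangular (1\<^sub>m n + A * geometric_mat A k)"
      unfolding upper_triangular_def using A(1) G by (simp del: index_mult_mat(1))
    moreover have "geometric_mat A (Suc k) $$ (i, i) = of_nat (Suc k)" if i: "i < n" for i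
      using t(2)[OF conjunct1[OF Suc] i] conjunct2[OF Suc] A(1) G diag[OF i] i by (simp del: index_mult_mat(1))
    ultimately show ?case using A(1) by simp
  qed
  have "det ?S = prod_list (diag_mat ?S)" by (rule det_upper_triangular[OF conjunct1[OF ut] S])
  also have "diag_mat ?S = map (\<lambda>i. of_nat m) [0..<n]"
    using conjunct2[OF ut[of m]] S by (simp add: diag_mat_def)
  finally have "det ?S \<noteq> 0" using m(1) by (auto simp: prod_list_zero_iff)
  from det_non_zero_imp_unit[OF S this, of "()"]
  obtain X where X: "X \<in> carrier_mat n n" "?S * X = 1\<^sub>m n"
    by (auto simp: Units_def ring_mat_simps)
  have *: "1\<^sub>m n + A * ?S = ?S + 1\<^sub>m n" using geometric_mat_telescope[OF A(1), of m] m(2) by simp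
  have AS: "A * ?S \<in> carrier_mat n n" using A(1) S by (rule mult_carrier_mat)
  have "A * ?S = ?S"
  proof (rule eq_matI)
    fix i j assume "i < dim_row ?S" "j < dim_col ?S"
    then have ij: "i < n" "j < n" using S by simp_all
    have "(1\<^sub>m n + A * ?S) $$ (i, j) = (?S + 1\<^sub>m n) $$ (i, j)" by (simp only: *)
    then show "(A * ?S) $$ (i, j) = ?S $$ (i, j)" using ij AS S A(1) by (simp del: index_mult_mat(1))
  next
    show "dim_row (A * ?S) = dim_row ?S" using A(1) S by simp
    show "dim_col (A * ?S) = dim_col ?S" using AS S by simp
  qed
  then have "A * ?S * X = ?S * X" by simp
  then show ?thesis using A(1) S X by (simp add: assoc_mult_mat[of A n n ?S n X n])
qed

text \<open>Equality case of the triangle inequality: the real parts are at most 1 and add up to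
  n.\<close>

lemma unit_complex_sum_eq_card:
  assumes "\<And>i. i < n \<Longrightarrow> cmod (z i) = 1" and "(\<Sum>i<n. z i) = of_nat n" and "i < n"
  shows "z i = (1 :: complex)"
proof -
  have le: "Re (z j) \<le> 1" if "j < n" for j using complex_Re_le_cmod[of "z j"] assms(1)[OF that] by simp
  have "(\<Sum>j<n. 1 - Re (z j)) = real n - Re (\<Sum>j<n. z j)" by (simp add: sum_subtractf)
  also have "\<dots> = 0" using assms(2) by simp
  finally have "\<forall>j\<in>{..<n}. 1 - Re (z j) = 0"
    using le by (subst (asm) sum_nonneg_eq_0_iff) auto
  then have "Re (z i) = 1" using assms(3) by simp
  moreover have "(cmod (z i))\<^sup>2 = 1" using assms by simp
  ultimately show ?thesis by (simp add: cmod_power2 complex_eq_iff)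
qed

text \<open>After Schur triangularization the diagonal consists of roots of unity with sum n, so all
  are 1, and a triangular matrix of finite order with unit diagonal is the identity. It serves to
  identify the kernel of a character with that of the representation.\<close>

lemma finite_order_tr_eq_dim:
  fixes A :: "complex mat"
  assumes A: "A \<in> carrier_mat n n" and m: "m > 0" "A ^\<^sub>m m = 1\<^sub>m n" and tr: "tr A = of_nat n"
  shows "A = 1\<^sub>m n"
proof -
  obtain es where es: "char_poly A = (\<Prod>a\<leftarrow>es. [:- a, 1:])"
    using char_poly_factorized[OF A] by blast
  obtain B where B: "B \<in> carrier_mat n n" "upper_triangular B" and sim: "similar_mat A B"
    using schur_decomposition_exists[OF A es] by blast
  obtain P Q where wit: "similar_mat_wit A B P Q" using sim unfolding similar_mat_def by blast
  note w = similar_mat_witD2[OF A wit]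
  have "tr A = tr (P * (B * Q))" using w(3) assoc_mult_mat[OF w(6,5,7)] by simp
  also have "\<dots> = tr (B * Q * P)" by (rule tr_mult_comm[OF w(6) mult_carrier_mat[OF w(5,7)]])
  also have "B * Q * P = B" using w(2) assoc_mult_mat[OF w(5,7,6)] B(1) by simp
  finally have trB: "(\<Sum>i<n. B $$ (i, i)) = of_nat n" using tr B by (simp add: tr_def)
  have Bm: "B ^\<^sub>m m = 1\<^sub>m n"
  proof -
    have "similar_mat_wit B A Q P" using wit by (rule similar_mat_wit_sym)
    from similar_mat_wit_pow[OF this, of m] have "B ^\<^sub>m m = Q * A ^\<^sub>m m * P"
      by (auto simp: similar_mat_wit_def Let_def)
    then show ?thesis using w(2,6,7) m(2) by simp
  qed
  \<comment> \<open>A diagonal entry is an eigenvalue, and its m-th power fixes a nonzero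
    eigenvector, so it is a root of unity.\<close>
  have cm: "cmod (B $$ (i, i)) = 1" if i: "i < n" for i
  proof -
    have "poly (char_poly B) (B $$ (i, i)) = 0"
      unfolding char_poly_upper_triangular[OF B] using i B(1)
      by (auto simp: poly_prod_list prod_list_zero_iff diag_mat_def)
    then have "eigenvalue B (B $$ (i, i))" using eigenvalue_root_char_poly[OF B(1)] by simp
    then obtain v where v: "eigenvector B v (B $$ (i, i))" by (auto simp: eigenvalue_def)
    then have vn: "v \<in> carrier_vec n" "v \<noteq> 0\<^sub>v n" using B by (auto simp: eigenvector_def)
    have "v = (B $$ (i, i)) ^ m \<cdot>\<^sub>v v" using eigenvector_pow[OF B(1) v, of m] Bm vn by simp
    then have eq: "v $ j = ((B $$ (i, i)) ^ m \<cdot>\<^sub>v v) $ j" for j by (rule arg_cong)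
    have "\<exists>j<n. v $ j \<noteq> 0"
    proof (rule ccontr)
      assume "\<not> (\<exists>j<n. v $ j \<noteq> 0)"
      then have "v = 0\<^sub>v n" using vn(1) by (intro eq_vecI) auto
      then show False using vn(2) by simp
    qed
    then obtain j where j: "j < n" "v $ j \<noteq> 0" by blast
    have "((B $$ (i, i)) ^ m \<cdot>\<^sub>v v) $ j = (B $$ (i, i)) ^ m * v $ j" using j(1) vn(1) by simp
    then have "v $ j = (B $$ (i, i)) ^ m * v $ j" by (rule trans[OF eq])
    then have "(B $$ (i, i)) ^ m = 1" using j by simp
    then show ?thesis using power_eq_1_iff m(1) by blast
  qed
  have "B $$ (i, i) = 1" if "i < n" for i
    by (rule unit_complex_sum_eq_card[of n "\<lambda>i. B $$ (i, i)", OF cm trB that])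
  then have B1: "B = 1\<^sub>m n" by (rule upper_triangular_finite_order[OF B _ m(1) Bm])
  show ?thesis unfolding w(3) B1 using w(1,6,7) by simp
qed

text \<open>Matrices of all sizes share one type, so the sizes are passed explicitly; they also fix
  the value of an empty sum.\<close>

definition mat_sum :: "nat \<Rightarrow> nat \<Rightarrow> ('i \<Rightarrow> complex mat) \<Rightarrow> 'i set \<Rightarrow> complex mat" where
  "mat_sum n m f S = mat n m (\<lambda>(i, j). \<Sum>s\<in>S. f s $$ (i, j))"

lemma mat_sum_carrier [simp]: "mat_sum n m f S \<in> carrier_mat n m"
  by (simp add: mat_sum_def)

lemma mat_sum_index: "i < n \<Longrightarrow> j < m \<Longrightarrow> mat_sum n m f S $$ (i, j) = (\<Sum>s\<in>S. f s $$ (i, j))"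
  by (simp add: mat_sum_def)

lemma mult_mat_index:
  assumes "(A :: complex mat) \<in> carrier_mat n m" "B \<in> carrier_mat m k" "i < n" "j < k"
  shows "(A * B) $$ (i, j) = (\<Sum>l<m. A $$ (i, l) * B $$ (l, j))"
  using assms by (auto simp: scalar_prod_def atLeast0LessThan intro!: sum.cong)

lemma mult_mat_sum:
  assumes A: "A \<in> carrier_mat k n" and f: "\<And>s. s \<in> S \<Longrightarrow> f s \<in> carrier_mat n m"
  shows "A * mat_sum n m f S = mat_sum k m (\<lambda>s. A * f s) S"
proof (rule eq_matI)
  fix i j assume "i < dim_row (mat_sum k m (\<lambda>s. A * f s) S)" "j < dim_col (mat_sum k m (\<lambda>s. A * f s) S)"
  then have ij: "i < k" "j < m" by (simp_all add: mat_sum_def)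
  have "(A * mat_sum n m f S) $$ (i, j) = (\<Sum>l<n. A $$ (i, l) * (\<Sum>s\<in>S. f s $$ (l, j)))"
    unfolding mult_mat_index[OF A mat_sum_carrier ij] using ij by (intro sum.cong refl) (simp add: mat_sum_index)
  also have "\<dots> = (\<Sum>s\<in>S. \<Sum>l<n. A $$ (i, l) * f s $$ (l, j))"
    unfolding sum_distrib_left by (rule sum.swap)
  also have "\<dots> = mat_sum k m (\<lambda>s. A * f s) S $$ (i, j)"
    unfolding mat_sum_index[OF ij] by (intro sum.cong refl mult_mat_index[OF A f ij, symmetric])
  finally show "(A * mat_sum n m f S) $$ (i, j) = mat_sum k m (\<lambda>s. A * f s) S $$ (i, j)" .
qed (use A in \<open>simp_all add: mat_sum_def\<close>)

lemma mat_sum_mult: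
  assumes A: "A \<in> carrier_mat m k" and f: "\<And>s. s \<in> S \<Longrightarrow> f s \<in> carrier_mat n m"
  shows "mat_sum n m f S * A = mat_sum n k (\<lambda>s. f s * A) S"
proof (rule eq_matI)
  fix i j assume "i < dim_row (mat_sum n k (\<lambda>s. f s * A) S)" "j < dim_col (mat_sum n k (\<lambda>s. f s * A) S)"
  then have ij: "i < n" "j < k" by (simp_all add: mat_sum_def)
  have "(mat_sum n m f S * A) $$ (i, j) = (\<Sum>l<m. (\<Sum>s\<in>S. f s $$ (i, l)) * A $$ (l, j))"
    unfolding mult_mat_index[OF mat_sum_carrier A ij] using ij by (intro sum.cong refl) (simp add: mat_sum_index)
  also have "\<dots> = (\<Sum>s\<in>S. \<Sum>l<m. f s $$ (i, l) * A $$ (l, j))"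
    unfolding sum_distrib_right by (rule sum.swap)
  also have "\<dots> = mat_sum n k (\<lambda>s. f s * A) S $$ (i, j)"
    unfolding mat_sum_index[OF ij] by (intro sum.cong refl mult_mat_index[OF f A ij, symmetric])
  finally show "(mat_sum n m f S * A) $$ (i, j) = mat_sum n k (\<lambda>s. f s * A) S $$ (i, j)" .
qed (use A in \<open>simp_all add: mat_sum_def\<close>)

lemma mat_sum_cong: "(\<And>s. s \<in> S \<Longrightarrow> f s = g s) \<Longrightarrow> mat_sum n m f S = mat_sum n m g S"
  by (simp add: mat_sum_def)

lemma mat_sum_reindex: "bij_betw h S T \<Longrightarrow> mat_sum n m f T = mat_sum n m (\<lambda>s. f (h s)) S"
  unfolding mat_sum_def by (intro eq_matI) (auto intro: sum.reindex_bij_betw[symmetric])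

lemma tr_mat_sum:
  assumes "\<And>s. s \<in> S \<Longrightarrow> f s \<in> carrier_mat n n"
  shows "tr (mat_sum n n f S) = (\<Sum>s\<in>S. tr (f s))"
proof -
  have "tr (mat_sum n n f S) = (\<Sum>i<n. \<Sum>s\<in>S. f s $$ (i, i))"
    by (simp add: tr_def mat_sum_def)
  also have "\<dots> = (\<Sum>s\<in>S. \<Sum>i<n. f s $$ (i, i))" by (rule sum.swap)
  also have "\<dots> = (\<Sum>s\<in>S. tr (f s))" using assms by (auto simp: tr_def intro!: sum.cong)
  finally show ?thesis .
qed

section \<open>Representations and Schur's lemma\<close>

text \<open>The image lies in the units because the matrix of \<open>inv g\<close> inverts that of
  g.\<close>

lemma (in group) representation_iff:
  "representation G n \<rho> \<longleftrightarrow>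
     (\<forall>g\<in>carrier G. \<rho> g \<in> carrier_mat n n) \<and>
     (\<forall>g\<in>carrier G. \<forall>h\<in>carrier G. \<rho> (g \<otimes> h) = \<rho> g * \<rho> h) \<and> \<rho> \<one> = 1\<^sub>m n"
  (is "?L \<longleftrightarrow> ?R")
proof
  interpret R: ring "ring_mat TYPE(complex) n ()" by (rule ring_mat)
  assume ?L
  then have h: "\<rho> \<in> hom G (units_of (ring_mat TYPE(complex) n ()))" by (simp add: representation_def)
  have "\<rho> \<one> = 1\<^sub>m n"
    using hom_one[OF h group_axioms R.units_group] by (simp add: units_of_def ring_mat_simps)
  moreover have "\<rho> g \<in> carrier_mat n n" if "g \<in> carrier G" for g
    using hom_in_carrier[OF h that] by (auto simp: units_of_def Units_def ring_mat_simps)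
  moreover have "\<rho> (g \<otimes> h') = \<rho> g * \<rho> h'" if "g \<in> carrier G" "h' \<in> carrier G" for g h'
    using hom_mult[OF h that] by (simp add: units_of_def ring_mat_simps)
  ultimately show ?R by blast
next
  assume R: ?R
  have "\<rho> g \<in> Units (ring_mat TYPE(complex) n ())" if g: "g \<in> carrier G" for g
  proof -
    have "\<rho> (inv g) * \<rho> g = 1\<^sub>m n" "\<rho> g * \<rho> (inv g) = 1\<^sub>m n"
      using R g by (metis inv_closed l_inv, metis inv_closed r_inv)
    then show ?thesis using R g by (auto simp: Units_def ring_mat_simps)
  qed
  then show ?L
    using R unfolding representation_def by (intro homI) (auto simp: units_of_def ring_mat_simps)
qed

locale finite_group = group +
  assumes finite_carrier: "finite (carrier G)"
begin

lemma representationD: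
  assumes "representation G n \<rho>"
  shows "g \<in> carrier G \<Longrightarrow> \<rho> g \<in> carrier_mat n n"
    and "g \<in> carrier G \<Longrightarrow> h \<in> carrier G \<Longrightarrow> \<rho> (g \<otimes> h) = \<rho> g * \<rho> h"
    and "\<rho> \<one> = 1\<^sub>m n"
  using assms by (auto simp: representation_iff)

lemma representation_pow:
  assumes "representation G n \<rho>" "g \<in> carrier G"
  shows "\<rho> (g [^] (k::nat)) = \<rho> g ^\<^sub>m k"
proof (induction k)
  case 0
  then show ?case using representationD(1,3)[OF assms(1)] assms(2) by auto
next
  case (Suc k)
  then show ?case using representationD(2)[OF assms(1), of "g [^] k" g] assms(2) by simp
qed

lemma character_eq_tr:
  assumes "representation G n \<rho>" "g \<in> carrier G"
  shows "character G n \<rho> g = tr (\<rho> g)"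
  using representationD(1)[OF assms] assms(2) by (simp add: character_def tr_def)

lemma character_one: "representation G n \<rho> \<Longrightarrow> character G n \<rho> \<one> = of_nat n"
  by (simp add: character_eq_tr representationD(3))

text \<open>By Lagrange the matrix of g has finite order, so its trace equals n only for the
  identity matrix. Kernels of characters thus become kernels of homomorphisms.\<close>

lemma character_kernel_eq:
  assumes "representation G n \<rho>"
  shows "character_kernel G (character G n \<rho>) = {g \<in> carrier G. \<rho> g = 1\<^sub>m n}"
proof -
  have "\<rho> g = 1\<^sub>m n" if g: "g \<in> carrier G" and "character G n \<rho> g = character G n \<rho> \<one>" for g
  proof (rule finite_order_tr_eq_dim)
    show "\<rho> g \<in> carrier_mat n n" using representationD(1)[OF assms g] .
    show "Coset.order G > 0" using finite_carrier by (simp add: order_gt_0_iff_finite)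
    show "\<rho> g ^\<^sub>m Coset.order G = 1\<^sub>m n"
      using representation_pow[OF assms g, of "Coset.order G"] pow_order_eq_1[OF g] representationD(3)[OF assms] by simp
    show "tr (\<rho> g) = of_nat n"
      using that character_one[OF assms] character_eq_tr[OF assms g] by simp
  qed
  moreover have "character G n \<rho> g = character G n \<rho> \<one>" if "g \<in> carrier G" "\<rho> g = 1\<^sub>m n" for g
    using that character_eq_tr[OF assms that(1)] character_one[OF assms] by simp
  ultimately show ?thesis unfolding character_kernel_def by blast
qed

lemma irreducibleD:
  assumes "irreducible_representation G n \<rho>"
  shows "representation G n \<rho>" "n > 0"
    and "VectorSpace.subspace class_ring W (module_vec TYPE(complex) n) \<Longrightarrow>
      (\<And>g w. g \<in> carrier G \<Longrightarrow> w \<in> W \<Longrightarrow> \<rho> g *\<^sub>v w \<in> W) \<Longrightarrow> W = {0\<^sub>v n} \<or> W = carrier_vec n"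
proof -
  show "representation G n \<rho>" "n > 0"
    using assms unfolding irreducible_representation_def by (rule conjunct1, elim conjE)
  assume "VectorSpace.subspace class_ring W (module_vec TYPE(complex) n)"
    and "\<And>g w. g \<in> carrier G \<Longrightarrow> w \<in> W \<Longrightarrow> \<rho> g *\<^sub>v w \<in> W"
  moreover have "\<forall>W. VectorSpace.subspace class_ring W (module_vec TYPE(complex) n) \<and>
      (\<forall>g\<in>carrier G. \<forall>w\<in>W. \<rho> g *\<^sub>v w \<in> W) \<longrightarrow> W = {0\<^sub>v n} \<or> W = carrier_vec n"
    using assms unfolding irreducible_representation_def by (elim conjE)
  ultimately show "W = {0\<^sub>v n} \<or> W = carrier_vec n"
    by simp
qed

section \<open>Intertwiners\<close>

lemma mult_mat_vec_zero: "(A :: complex mat) \<in> carrier_mat n m \<Longrightarrow> A *\<^sub>v 0\<^sub>v m = 0\<^sub>v n"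
  by (intro eq_vecI) auto

lemma mat_kernel_subspace:
  assumes T: "(T :: complex mat) \<in> carrier_mat m n"
  shows "VectorSpace.subspace class_ring {v \<in> carrier_vec n. T *\<^sub>v v = 0\<^sub>v m} (module_vec TYPE(complex) n)"
  unfolding subspace_iff
proof -
  have "a \<cdot>\<^sub>v 0\<^sub>v m = (0\<^sub>v m :: complex vec)" for a by (intro eq_vecI) auto
  then show "{v \<in> carrier_vec n. T *\<^sub>v v = 0\<^sub>v m} \<subseteq> carrier_vec n \<and> 0\<^sub>v n \<in> {v \<in> carrier_vec n. T *\<^sub>v v = 0\<^sub>v m} \<and>
    (\<forall>v\<in>{v \<in> carrier_vec n. T *\<^sub>v v = 0\<^sub>v m}. \<forall>w\<in>{v \<in> carrier_vec n. T *\<^sub>v v = 0\<^sub>v m}.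
      v + w \<in> {v \<in> carrier_vec n. T *\<^sub>v v = 0\<^sub>v m}) \<and>
    (\<forall>a. \<forall>v\<in>{v \<in> carrier_vec n. T *\<^sub>v v = 0\<^sub>v m}. a \<cdot>\<^sub>v v \<in> {v \<in> carrier_vec n. T *\<^sub>v v = 0\<^sub>v m})"
    by (simp add: mult_add_distrib_mat_vec[OF T] mult_mat_vec[OF T] mult_mat_vec_zero[OF T] subset_iff)
qed

text \<open>The kernel of T is invariant under \<rho>, hence zero or everything, and the latter
  would make T zero.\<close>

lemma intertwiner_kernel:
  assumes \<rho>: "irreducible_representation G n \<rho>" and \<sigma>: "representation G m \<sigma>"
    and T: "T \<in> carrier_mat m n" "T \<noteq> 0\<^sub>m m n"
    and comm: "\<And>g. g \<in> carrier G \<Longrightarrow> T * \<rho> g = \<sigma> g * T"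
  shows "inj_mat T"
proof -
  note r = irreducibleD(1)[OF \<rho>]
  let ?K = "{v \<in> carrier_vec n. T *\<^sub>v v = 0\<^sub>v m}"
  have "\<rho> g *\<^sub>v w \<in> ?K" if g: "g \<in> carrier G" and w: "w \<in> ?K" for g w
  proof -
    have wn: "w \<in> carrier_vec n" using w by simp
    have "T *\<^sub>v (\<rho> g *\<^sub>v w) = (T * \<rho> g) *\<^sub>v w"
      using assoc_mult_mat_vec[OF T(1) representationD(1)[OF r g] wn] by simp
    also have "\<dots> = \<sigma> g *\<^sub>v (T *\<^sub>v w)"
      unfolding comm[OF g] by (rule assoc_mult_mat_vec[OF representationD(1)[OF \<sigma> g] T(1) wn])
    also have "\<dots> = 0\<^sub>v m" using w mult_mat_vec_zero[OF representationD(1)[OF \<sigma> g]] by simp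
    finally show ?thesis using wn representationD(1)[OF r g] by simp
  qed
  then have "?K = {0\<^sub>v n} \<or> ?K = carrier_vec n"
    by (intro irreducibleD(3)[OF \<rho> mat_kernel_subspace[OF T(1)]])
  moreover have "?K \<noteq> carrier_vec n"
  proof
    assume K: "?K = carrier_vec n"
    have "T = 0\<^sub>m m n"
    proof (rule mat_eq_by_vec[OF T(1)])
      fix v :: "complex vec" assume "v \<in> carrier_vec n"
      moreover from this have "T *\<^sub>v v = 0\<^sub>v m" using K by blast
      ultimately show "T *\<^sub>v v = 0\<^sub>m m n *\<^sub>v v" by (auto intro!: eq_vecI simp: scalar_prod_def)
    qed simp
    then show False using T(2) by simp
  qed
  ultimately have "?K = {0\<^sub>v n}" by blast
  then show ?thesis using T(1) unfolding inj_mat_def by auto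
qed

text \<open>Besides the kernel, the range of T is invariant, this time under \<sigma>; so T is onto
  as well as injective.\<close>

lemma schur_inverse:
  assumes \<rho>: "irreducible_representation G n \<rho>" and \<sigma>: "irreducible_representation G m \<sigma>"
    and T: "T \<in> carrier_mat m n" "T \<noteq> 0\<^sub>m m n"
    and comm: "\<And>g. g \<in> carrier G \<Longrightarrow> T * \<rho> g = \<sigma> g * T"
  shows "\<exists>S\<in>carrier_mat n m. S * T = 1\<^sub>m n \<and> T * S = 1\<^sub>m m"
proof -
  note r = irreducibleD(1)[OF \<rho>] and s = irreducibleD(1)[OF \<sigma>]
  have inj: "inj_mat T" by (rule intertwiner_kernel[OF \<rho> s T comm])
  obtain S where S: "S \<in> carrier_mat n m" "S * T = 1\<^sub>m n" using inj_mat_left_inverse[OF T(1) inj] by blast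
  let ?R = "{T *\<^sub>v v | v. v \<in> carrier_vec n}"
  have "\<sigma> g *\<^sub>v w \<in> ?R" if g: "g \<in> carrier G" and w: "w \<in> ?R" for g w
  proof -
    obtain v where v: "v \<in> carrier_vec n" "w = T *\<^sub>v v" using w by blast
    have "\<sigma> g *\<^sub>v w = (\<sigma> g * T) *\<^sub>v v"
      unfolding v(2) by (rule assoc_mult_mat_vec[OF representationD(1)[OF s g] T(1) v(1), symmetric])
    also have "\<dots> = T *\<^sub>v (\<rho> g *\<^sub>v v)"
      unfolding comm[OF g, symmetric] by (rule assoc_mult_mat_vec[OF T(1) representationD(1)[OF r g] v(1)])
    finally show ?thesis using representationD(1)[OF r g] v(1) by (auto intro: mult_mat_vec_carrier)
  qed
  then have "?R = {0\<^sub>v m} \<or> ?R = carrier_vec m"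
    by (intro irreducibleD(3)[OF \<sigma> range_subspace[OF T(1)]])
  moreover have "?R \<noteq> {0\<^sub>v m}"
  proof
    assume R: "?R = {0\<^sub>v m}"
    have "T = 0\<^sub>m m n"
    proof (rule mat_eq_by_vec[OF T(1)])
      fix v :: "complex vec" assume "v \<in> carrier_vec n"
      moreover from this have "T *\<^sub>v v = 0\<^sub>v m" using R by blast
      ultimately show "T *\<^sub>v v = 0\<^sub>m m n *\<^sub>v v" by (auto intro!: eq_vecI simp: scalar_prod_def)
    qed simp
    then show False using T(2) by simp
  qed
  ultimately have surj: "?R = carrier_vec m" by blast
  have "T * S = 1\<^sub>m m"
  proof (rule mat_eq_by_vec)
    show "T * S \<in> carrier_mat m m" using T(1) S(1) by (rule mult_carrier_mat)
    fix w :: "complex vec" assume "w \<in> carrier_vec m"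
    then obtain v where v: "v \<in> carrier_vec n" "w = T *\<^sub>v v" using surj by blast
    have "(T * S) *\<^sub>v w = T *\<^sub>v (S *\<^sub>v (T *\<^sub>v v))"
      unfolding v(2) by (rule assoc_mult_mat_vec[OF T(1) S(1)]) (use T(1) v(1) in simp)
    also have "S *\<^sub>v (T *\<^sub>v v) = v"
      using assoc_mult_mat_vec[OF S(1) T(1) v(1)] S(2) v(1) by simp
    finally show "(T * S) *\<^sub>v w = 1\<^sub>m m *\<^sub>v w" using v T(1) by simp
  qed simp
  then show ?thesis using S by blast
qed

lemma schur_character_eq:
  assumes \<rho>: "irreducible_representation G n \<rho>" and \<sigma>: "irreducible_representation G m \<sigma>"
    and T: "T \<in> carrier_mat m n" "T \<noteq> 0\<^sub>m m n"
    and comm: "\<And>g. g \<in> carrier G \<Longrightarrow> T * \<rho> g = \<sigma> g * T"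
  shows "character G n \<rho> = character G m \<sigma>"
proof
  fix g
  obtain S where S: "S \<in> carrier_mat n m" "S * T = 1\<^sub>m n" "T * S = 1\<^sub>m m"
    using schur_inverse[OF \<rho> \<sigma> T comm] by blast
  show "character G n \<rho> g = character G m \<sigma> g"
  proof (cases "g \<in> carrier G")
    case g: True
    note r = representationD(1)[OF irreducibleD(1)[OF \<rho>] g]
      and s = representationD(1)[OF irreducibleD(1)[OF \<sigma>] g]
    have "\<rho> g = S * (T * \<rho> g)" using assoc_mult_mat[OF S(1) T(1) r] S(2) r by simp
    then have "tr (\<rho> g) = tr (S * (\<sigma> g * T))" using comm[OF g] by simp
    also have "\<dots> = tr (\<sigma> g * T * S)" by (rule tr_mult_comm[OF S(1) mult_carrier_mat[OF s T(1)]])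
    also have "\<sigma> g * T * S = \<sigma> g" using assoc_mult_mat[OF s T(1) S(1)] S(3) s by simp
    finally show ?thesis
      using character_eq_tr[OF irreducibleD(1)[OF \<rho>] g] character_eq_tr[OF irreducibleD(1)[OF \<sigma>] g] by simp
  qed (simp add: character_def)
qed

text \<open>T has a complex eigenvalue c; T - c is again an intertwiner but not injective, so it
  vanishes.\<close>

lemma schur_scalar:
  assumes \<rho>: "irreducible_representation G n \<rho>" and T: "T \<in> carrier_mat n n"
    and comm: "\<And>g. g \<in> carrier G \<Longrightarrow> T * \<rho> g = \<rho> g * T"
  shows "\<exists>c. T = c \<cdot>\<^sub>m 1\<^sub>m n"
proof -
  note r = representationD(1)[OF irreducibleD(1)[OF \<rho>]]
  obtain c where "eigenvalue T c"
    using spectrum_non_empty[OF T irreducibleD(2)[OF \<rho>]] by (auto simp: spectrum_def)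
  then obtain v where v: "v \<in> carrier_vec n" "v \<noteq> 0\<^sub>v n" and ev: "T *\<^sub>v v = c \<cdot>\<^sub>v v"
    using T by (auto simp: eigenvalue_def eigenvector_def)
  define U where "U = T - c \<cdot>\<^sub>m 1\<^sub>m n"
  have U: "U \<in> carrier_mat n n" unfolding U_def by (rule minus_carrier_mat) simp
  have Uc: "U * \<rho> g = \<rho> g * U" if g: "g \<in> carrier G" for g
  proof -
    have "U * \<rho> g = T * \<rho> g - c \<cdot>\<^sub>m 1\<^sub>m n * \<rho> g"
      unfolding U_def by (rule minus_mult_distrib_mat[OF T _ r[OF g]]) simp
    also have "c \<cdot>\<^sub>m 1\<^sub>m n * \<rho> g = \<rho> g * (c \<cdot>\<^sub>m 1\<^sub>m n)"
      using mult_smult_assoc_mat[OF one_carrier_mat r[OF g], of c] mult_smult_distrib[OF r[OF g] one_carrier_mat, of c] r[OF g]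
      by simp
    also have "T * \<rho> g - \<rho> g * (c \<cdot>\<^sub>m 1\<^sub>m n) = \<rho> g * U"
      unfolding U_def comm[OF g] by (rule mult_minus_distrib_mat[OF r[OF g] T, symmetric]) simp
    finally show ?thesis .
  qed
  have Uv: "U *\<^sub>v v = 0\<^sub>v n"
  proof -
    have "U *\<^sub>v v = T *\<^sub>v v - (c \<cdot>\<^sub>m 1\<^sub>m n) *\<^sub>v v"
      unfolding U_def by (rule minus_mult_distrib_mat_vec[OF T _ v(1)]) simp
    also have "(c \<cdot>\<^sub>m 1\<^sub>m n) *\<^sub>v v = c \<cdot>\<^sub>v v" using v(1) by (intro eq_vecI) auto
    finally show ?thesis using ev v(1) by simp
  qed
  have "U = 0\<^sub>m n n"
  proof (rule ccontr)
    assume "U \<noteq> 0\<^sub>m n n"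
    from intertwiner_kernel[OF \<rho> irreducibleD(1)[OF \<rho>] U this Uc]
    show False using Uv v U by (auto simp: inj_mat_def)
  qed
  then have "T = c \<cdot>\<^sub>m 1\<^sub>m n"
  proof -
    assume 0: "U = 0\<^sub>m n n"
    show ?thesis
    proof (rule eq_matI)
      fix i j assume "i < dim_row (c \<cdot>\<^sub>m 1\<^sub>m n)" "j < dim_col (c \<cdot>\<^sub>m 1\<^sub>m n)"
      then have ij: "i < n" "j < n" by simp_all
      have "U $$ (i, j) = 0" using 0 ij by simp
      then show "T $$ (i, j) = (c \<cdot>\<^sub>m 1\<^sub>m n) $$ (i, j)" using ij T unfolding U_def by simp
    qed (use T in simp_all)
  qed
  then show ?thesis ..
qed

end

section \<open>Characters\<close>

context finite_group
begin

section \<open>Averaging over the group and orthogonality\<close>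

lemma bij_betw_left_mult: "h \<in> carrier G \<Longrightarrow> bij_betw (\<lambda>g. h \<otimes> g) (carrier G) (carrier G)"
  by (rule bij_betwI[where g = "\<lambda>g. inv h \<otimes> g"]) (auto simp: m_assoc[symmetric])

text \<open>Turns an arbitrary X into an intertwiner from \<rho> to \<sigma>. There is no division
  by the group order, so |G| appears as a factor in the formulas.\<close>

definition average :: "nat \<Rightarrow> ('a \<Rightarrow> complex mat) \<Rightarrow> nat \<Rightarrow> ('a \<Rightarrow> complex mat) \<Rightarrow> complex mat \<Rightarrow> complex mat" where
  "average n \<rho> m \<sigma> X = mat_sum m n (\<lambda>g. \<sigma> g * X * \<rho> (inv g)) (carrier G)"

lemma average_carrier [simp]: "average n \<rho> m \<sigma> X \<in> carrier_mat m n"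
  by (simp add: average_def)

lemma average_intertwines:
  assumes \<rho>: "representation G n \<rho>" and \<sigma>: "representation G m \<sigma>"
    and X: "X \<in> carrier_mat m n" and h: "h \<in> carrier G"
  shows "average n \<rho> m \<sigma> X * \<rho> h = \<sigma> h * average n \<rho> m \<sigma> X"
proof -
  note r = representationD(1)[OF \<rho>] and s = representationD(1)[OF \<sigma>]
  have c: "\<sigma> g * X * \<rho> (inv g) \<in> carrier_mat m n" if "g \<in> carrier G" for g
    using r[of "inv g"] s[of g] X that by simp
  have "average n \<rho> m \<sigma> X * \<rho> h = mat_sum m n (\<lambda>g. \<sigma> g * X * \<rho> (inv g) * \<rho> h) (carrier G)"
    unfolding average_def by (rule mat_sum_mult[OF r[OF h] c])
  also have "\<dots> = mat_sum m n (\<lambda>g. \<sigma> (h \<otimes> g) * X * \<rho> (inv (h \<otimes> g)) * \<rho> h) (carrier G)"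
    by (rule mat_sum_reindex[OF bij_betw_left_mult[OF h]])
  also have "\<dots> = mat_sum m n (\<lambda>g. \<sigma> h * (\<sigma> g * X * \<rho> (inv g))) (carrier G)"
  proof (rule mat_sum_cong)
    fix g assume g: "g \<in> carrier G"
    have "\<rho> (inv (h \<otimes> g)) * \<rho> h = \<rho> (inv g)"
      using representationD(2)[OF \<rho>, of "inv (h \<otimes> g)" h] g h by (simp add: inv_mult_group m_assoc)
    then have 1: "\<sigma> (h \<otimes> g) * X * \<rho> (inv (h \<otimes> g)) * \<rho> h = \<sigma> (h \<otimes> g) * X * \<rho> (inv g)"
      using assoc_mult_mat[OF mult_carrier_mat[OF s X] r r, of "h \<otimes> g" "inv (h \<otimes> g)" h] g h by simp
    have 2: "\<sigma> (h \<otimes> g) * X = \<sigma> h * (\<sigma> g * X)"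
      using representationD(2)[OF \<sigma> h g] assoc_mult_mat[OF s[OF h] s[OF g] X] by simp
    show "\<sigma> (h \<otimes> g) * X * \<rho> (inv (h \<otimes> g)) * \<rho> h = \<sigma> h * (\<sigma> g * X * \<rho> (inv g))"
      unfolding 1 unfolding 2 using assoc_mult_mat[OF s[OF h] mult_carrier_mat[OF s[OF g] X] r, of "inv g"] g by simp
  qed
  also have "\<dots> = \<sigma> h * average n \<rho> m \<sigma> X"
    unfolding average_def by (rule mult_mat_sum[OF s[OF h] c, symmetric])
  finally show ?thesis .
qed

definition elementary_mat :: "nat \<Rightarrow> nat \<Rightarrow> nat \<Rightarrow> nat \<Rightarrow> complex mat" where
  "elementary_mat m n k l = mat m n (\<lambda>(i, j). if i = k \<and> j = l then 1 else 0)"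

lemma mult_elementary_mat_mult:
  assumes A: "(A :: complex mat) \<in> carrier_mat m m" and B: "B \<in> carrier_mat n n"
    and "i < m" "j < n" "k < m" "l < n"
  shows "(A * elementary_mat m n k l * B) $$ (i, j) = A $$ (i, k) * B $$ (l, j)"
proof -
  have E: "elementary_mat m n k l \<in> carrier_mat m n" by (simp add: elementary_mat_def)
  have AE: "(A * elementary_mat m n k l) $$ (i, q) = (if q = l then A $$ (i, k) else 0)" if "q < n" for q
  proof -
    have "(A * elementary_mat m n k l) $$ (i, q) = (\<Sum>p<m. if p = k then (if q = l then A $$ (i, k) else 0) else 0)"
      unfolding mult_mat_index[OF A E assms(3) that] using that by (intro sum.cong) (auto simp: elementary_mat_def)
    then show ?thesis using assms(5) by simp
  qed
  have "(A * elementary_mat m n k l * B) $$ (i, j) = (\<Sum>q<n. if q = l then A $$ (i, k) * B $$ (l, j) else 0)"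
    unfolding mult_mat_index[OF mult_carrier_mat[OF A E] B assms(3,4)] by (intro sum.cong) (auto simp: AE)
  then show ?thesis using assms(6) by simp
qed

lemma tr_elementary_mat: "k < n \<Longrightarrow> l < n \<Longrightarrow> tr (elementary_mat n n k l) = (if k = l then 1 else 0)"
proof -
  assume "k < n" "l < n"
  have "tr (elementary_mat n n k l) = (\<Sum>i<n. if i = k then (if k = l then 1 else 0) else 0)"
    unfolding tr_def by (intro sum.cong) (auto simp: elementary_mat_def)
  then show ?thesis using \<open>k < n\<close> by simp
qed

lemma average_elementary_index:
  assumes \<rho>: "representation G n \<rho>" and \<sigma>: "representation G m \<sigma>"
    and "i < m" "j < n" "k < m" "l < n"
  shows "average n \<rho> m \<sigma> (elementary_mat m n k l) $$ (i, j) = (\<Sum>g\<in>carrier G. \<sigma> g $$ (i, k) * \<rho> (inv g) $$ (l, j))"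
  unfolding average_def mat_sum_index[OF assms(3,4)]
  by (intro sum.cong refl mult_elementary_mat_mult assms representationD(1)[OF \<rho>] representationD(1)[OF \<sigma>]) auto

text \<open>Expanding both traces, the term for k and l is the sum of
  \<open>\<sigma> g $$ (k, k) * \<rho> (inv g) $$ (l, l)\<close> over g, which is entry (k, l) of
  the average of the matrix unit at (k, l).\<close>

lemma sum_character_product:
  assumes \<rho>: "representation G n \<rho>" and \<sigma>: "representation G m \<sigma>"
  shows "(\<Sum>g\<in>carrier G. character G m \<sigma> g * character G n \<rho> (inv g)) =
    (\<Sum>k<m. \<Sum>l<n. average n \<rho> m \<sigma> (elementary_mat m n k l) $$ (k, l))"
proof -
  have "(\<Sum>g\<in>carrier G. character G m \<sigma> g * character G n \<rho> (inv g)) =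
      (\<Sum>g\<in>carrier G. \<Sum>k<m. \<Sum>l<n. \<sigma> g $$ (k, k) * \<rho> (inv g) $$ (l, l))"
    by (intro sum.cong refl) (simp add: character_def sum_product)
  also have "\<dots> = (\<Sum>k<m. \<Sum>g\<in>carrier G. \<Sum>l<n. \<sigma> g $$ (k, k) * \<rho> (inv g) $$ (l, l))"
    by (rule sum.swap)
  also have "\<dots> = (\<Sum>k<m. \<Sum>l<n. \<Sum>g\<in>carrier G. \<sigma> g $$ (k, k) * \<rho> (inv g) $$ (l, l))"
    by (intro sum.cong refl sum.swap)
  also have "\<dots> = (\<Sum>k<m. \<Sum>l<n. average n \<rho> m \<sigma> (elementary_mat m n k l) $$ (k, l))"
    by (intro sum.cong refl) (simp add: average_elementary_index[OF \<rho> \<sigma>])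
  finally show ?thesis .
qed

text \<open>The average is scalar by Schur's lemma, and every summand has the trace of X, which
  determines the scalar.\<close>

lemma average_scalar:
  assumes \<rho>: "irreducible_representation G n \<rho>" and X: "X \<in> carrier_mat n n"
  shows "average n \<rho> n \<rho> X = (of_nat (card (carrier G)) * tr X / of_nat n) \<cdot>\<^sub>m 1\<^sub>m n"
proof -
  note R = irreducibleD(1)[OF \<rho>]
  note r = representationD(1)[OF R]
  obtain c where c: "average n \<rho> n \<rho> X = c \<cdot>\<^sub>m 1\<^sub>m n"
    using schur_scalar[OF \<rho> average_carrier average_intertwines[OF R R X]] by blast
  have "tr (average n \<rho> n \<rho> X) = (\<Sum>g\<in>carrier G. tr (\<rho> g * X * \<rho> (inv g)))"
    unfolding average_def
  proof (rule tr_mat_sum)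
    fix g assume "g \<in> carrier G"
    then show "\<rho> g * X * \<rho> (inv g) \<in> carrier_mat n n" using r[of g] r[of "inv g"] X by simp
  qed
  also have "\<dots> = (\<Sum>g\<in>carrier G. tr X)"
  proof (rule sum.cong[OF refl])
    fix g assume g: "g \<in> carrier G"
    note rg = r[OF g] r[OF inv_closed[OF g]]
    have "tr (\<rho> g * X * \<rho> (inv g)) = tr (\<rho> (inv g) * (\<rho> g * X))"
      by (rule tr_mult_comm[OF mult_carrier_mat[OF rg(1) X] rg(2)])
    also have "\<rho> (inv g) * (\<rho> g * X) = \<rho> (inv g \<otimes> g) * X"
      using assoc_mult_mat[OF rg(2,1) X] representationD(2)[OF R, of "inv g" g] g by simp
    also have "\<dots> = X" using g representationD(3)[OF R] X by simp
    finally show "tr (\<rho> g * X * \<rho> (inv g)) = tr X" .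
  qed
  finally have "c * of_nat n = of_nat (card (carrier G)) * tr X"
    unfolding c by (simp add: tr_def mult.commute)
  then have "c = of_nat (card (carrier G)) * tr X / of_nat n"
    using irreducibleD(2)[OF \<rho>] by (simp add: field_simps)
  then show ?thesis using c by simp
qed

theorem character_orthogonality:
  assumes "\<chi> \<in> Irr G" "\<psi> \<in> Irr G"
  shows "(\<Sum>g\<in>carrier G. \<chi> g * \<psi> (inv g)) = (if \<chi> = \<psi> then of_nat (card (carrier G)) else 0)"
proof (cases "\<chi> = \<psi>")
  case True
  obtain n \<rho> where \<rho>: "irreducible_representation G n \<rho>" and \<chi>: "\<chi> = character G n \<rho>"
    using assms by (auto simp: Irr_def)
  note R = irreducibleD(1)[OF \<rho>]
  have "(\<Sum>g\<in>carrier G. \<chi> g * \<psi> (inv g)) = (\<Sum>k<n. \<Sum>l<n. average n \<rho> n \<rho> (elementary_mat n n k l) $$ (k, l))"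
    using True \<chi> sum_character_product[OF R R] by simp
  \<comment> \<open>Only the n diagonal matrix units have nonzero trace; each contributes |G| /
    n.\<close>
  also have "\<dots> = (\<Sum>k<n. \<Sum>l<n. if l = k then of_nat (card (carrier G)) / of_nat n else 0)"
  proof (intro sum.cong refl)
    fix k l assume "k \<in> {..<n}" "l \<in> {..<n}"
    then have kl: "k < n" "l < n" by simp_all
    have E: "elementary_mat n n k l \<in> carrier_mat n n" by (simp add: elementary_mat_def)
    show "average n \<rho> n \<rho> (elementary_mat n n k l) $$ (k, l) = (if l = k then of_nat (card (carrier G)) / of_nat n else 0)"
      unfolding average_scalar[OF \<rho> E] tr_elementary_mat[OF kl] using kl by simp
  qed
  also have "\<dots> = of_nat (card (carrier G))" using irreducibleD(2)[OF \<rho>] by simp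
  finally show ?thesis using True by simp
next
  case False
  obtain n \<rho> where \<rho>: "irreducible_representation G n \<rho>" and \<psi>: "\<psi> = character G n \<rho>"
    using assms by (auto simp: Irr_def)
  obtain m \<sigma> where \<sigma>: "irreducible_representation G m \<sigma>" and \<chi>: "\<chi> = character G m \<sigma>"
    using assms by (auto simp: Irr_def)
  note R = irreducibleD(1)[OF \<rho>] and S = irreducibleD(1)[OF \<sigma>]
  \<comment> \<open>A nonzero average would intertwine the two representations and make their
    characters equal.\<close>
  have 0: "average n \<rho> m \<sigma> X = 0\<^sub>m m n" if X: "X \<in> carrier_mat m n" for X
  proof (rule ccontr)
    assume "average n \<rho> m \<sigma> X \<noteq> 0\<^sub>m m n"
    from schur_character_eq[OF \<rho> \<sigma> average_carrier this average_intertwines[OF R S X]]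
    show False using False \<psi> \<chi> by auto
  qed
  have "(\<Sum>g\<in>carrier G. \<chi> g * \<psi> (inv g)) = (\<Sum>k<m. \<Sum>l<n. average n \<rho> m \<sigma> (elementary_mat m n k l) $$ (k, l))"
    unfolding \<chi> \<psi> by (rule sum_character_product[OF R S])
  also have "\<dots> = 0"
    by (intro sum.neutral ballI) (subst 0, auto simp: elementary_mat_def)
  finally show ?thesis using False by simp
qed

text \<open>A composition series of a representation, obtained from the block decomposition of
  \<open>subspace_splitting\<close>; complete reducibility is not needed.\<close>

lemma tr_representation_decompose:
  assumes "representation G n \<rho>"
  shows "\<exists>\<psi>s. set \<psi>s \<subseteq> Irr G \<and> (\<forall>g\<in>carrier G. tr (\<rho> g) = (\<Sum>\<psi>\<leftarrow>\<psi>s. \<psi> g))"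
  using assms
proof (induction n arbitrary: \<rho> rule: less_induct)
  case (less n)
  note r = representationD(1)[OF less.prems]
  consider (zero) "n = 0" | (irreducible) "irreducible_representation G n \<rho>"
    | (reducible) "n > 0" "\<not> irreducible_representation G n \<rho>" by blast
  then show ?case
  proof cases
    case zero
    have "tr (\<rho> g) = 0" if "g \<in> carrier G" for g using r[OF that] zero by (simp add: tr_def)
    then show ?thesis by (intro exI[of _ "[]"]) simp
  next
    case irreducible
    then show ?thesis
      using character_eq_tr[OF less.prems] by (intro exI[of _ "[character G n \<rho>]"]) (auto simp: Irr_def)
  next
    case reducible
    then obtain W where W: "VectorSpace.subspace class_ring W (module_vec TYPE(complex) n)"
      and inv: "\<And>g w. g \<in> carrier G \<Longrightarrow> w \<in> W \<Longrightarrow> \<rho> g *\<^sub>v w \<in> W"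
      and ne: "W \<noteq> {0\<^sub>v n}" "W \<noteq> carrier_vec n"
      using less.prems reducible unfolding irreducible_representation_def by auto
    obtain k m B B' C C' where
      mats: "B \<in> carrier_mat n k" "B' \<in> carrier_mat k n" "C \<in> carrier_mat m n" "C' \<in> carrier_mat n m"
      and BB: "B' * B = 1\<^sub>m k" and CC: "C * C' = 1\<^sub>m m" and CB: "C * B = 0\<^sub>m m k"
      and sum1: "B * B' + C' * C = 1\<^sub>m n" and WB: "W = {B *\<^sub>v v | v. v \<in> carrier_vec k}"
      by (rule subspace_splitting[OF W])
    \<comment> \<open>Traces count dimensions: this gives n = k + m, and with k and m nonzero both
      blocks are smaller than n.\<close>
    have "tr (1\<^sub>m n) = tr (B * B') + tr (C' * C)"
      unfolding sum1[symmetric] by (rule tr_add) (use mats in auto)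
    also have "tr (B * B') = of_nat k" using tr_mult_comm[OF mats(1,2)] BB by simp
    also have "tr (C' * C) = of_nat m" using tr_mult_comm[OF mats(4,3)] CC by simp
    finally have "(of_nat n :: complex) = of_nat (k + m)" by simp
    then have nkm: "n = k + m" using of_nat_eq_iff by blast
    have "k \<noteq> 0"
    proof
      assume k: "k = 0"
      have "B *\<^sub>v v = 0\<^sub>v n" if "v \<in> carrier_vec k" for v :: "complex vec"
        using that mats(1) k by (intro eq_vecI) (auto simp: scalar_prod_def)
      then have "w = 0\<^sub>v n" if "w \<in> W" for w using that by (auto simp: WB)
      moreover have "0\<^sub>v n \<in> W" using W by (simp add: subspace_iff)
      ultimately have "W = {0\<^sub>v n}" by blast
      then show False using ne by simp
    qed
    have "m \<noteq> 0"
    proof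
      assume "m = 0"
      then have "C' * C = 0\<^sub>m n n" using mats by (intro eq_matI) (auto simp: scalar_prod_def)
      then have 1: "B * B' = 1\<^sub>m n" using sum1 mats(1,2) by simp
      have "v \<in> W" if v: "v \<in> carrier_vec n" for v
      proof -
        have "v = B *\<^sub>v (B' *\<^sub>v v)" using assoc_mult_mat_vec[OF mats(1,2) v] 1 v by simp
        then show ?thesis unfolding WB using mats(2) v mult_mat_vec_carrier by blast
      qed
      moreover have "W \<subseteq> carrier_vec n" using W by (simp add: subspace_iff)
      ultimately show False using ne(2) by blast
    qed
    \<comment> \<open>The lower left block of the matrix of g in the adapted basis, zero because W
      is invariant.\<close>
    have CrB: "C * (\<rho> g * B) = 0\<^sub>m m k" if g: "g \<in> carrier G" for g
    proof (rule mat_eq_by_vec)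
      show "C * (\<rho> g * B) \<in> carrier_mat m k" using mats r[OF g] by simp
      fix v :: "complex vec" assume v: "v \<in> carrier_vec k"
      then have "\<rho> g *\<^sub>v (B *\<^sub>v v) \<in> W" by (intro inv[OF g]) (auto simp: WB)
      then obtain u where u: "u \<in> carrier_vec k" "\<rho> g *\<^sub>v (B *\<^sub>v v) = B *\<^sub>v u" by (auto simp: WB)
      have "(C * (\<rho> g * B)) *\<^sub>v v = C *\<^sub>v (\<rho> g *\<^sub>v (B *\<^sub>v v))"
        using assoc_mult_mat_vec[OF mats(3) mult_carrier_mat[OF r[OF g] mats(1)] v]
          assoc_mult_mat_vec[OF r[OF g] mats(1) v] by simp
      also have "\<dots> = (C * B) *\<^sub>v u" unfolding u(2) by (rule assoc_mult_mat_vec[OF mats(3,1) u(1), symmetric])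
      finally show "(C * (\<rho> g * B)) *\<^sub>v v = 0\<^sub>m m k *\<^sub>v v"
        unfolding CB using u(1) v by (auto intro!: eq_vecI simp: scalar_prod_def)
    qed simp
    have split: "Y * Z = Y * (B * B') * Z + Y * (C' * C) * Z"
      if "Y \<in> carrier_mat p n" "Z \<in> carrier_mat n q" for Y Z p q
    proof -
      have BB': "B * B' \<in> carrier_mat n n" and CC': "C' * C \<in> carrier_mat n n" using mats by auto
      have "Y * Z = Y * (B * B' + C' * C) * Z" using that sum1 by simp
      also have "Y * (B * B' + C' * C) = Y * (B * B') + Y * (C' * C)"
        by (rule mult_add_distrib_mat[OF that(1) BB' CC'])
      also have "\<dots> * Z = Y * (B * B') * Z + Y * (C' * C) * Z"
        by (rule add_mult_distrib_mat[of _ p n, OF _ _ that(2)]) (use that(1) BB' CC' in auto)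
      finally show ?thesis .
    qed
    \<comment> \<open>The diagonal blocks: the action on W and the action on the quotient by
      W.\<close>
    define \<alpha> where "\<alpha> g = B' * (\<rho> g * B)" for g
    define \<delta> where "\<delta> g = C * (\<rho> g * C')" for g
    have \<alpha>: "representation G k \<alpha>"
      unfolding representation_iff
    proof (intro conjI ballI)
      fix g assume "g \<in> carrier G"
      then show "\<alpha> g \<in> carrier_mat k k"
        unfolding \<alpha>_def by (intro mult_carrier_mat[OF mats(2) mult_carrier_mat[OF r mats(1)]])
    next
      fix g h assume g: "g \<in> carrier G" and h: "h \<in> carrier G"
      note rg = r[OF g] and rh = r[OF h]
      have "\<alpha> (g \<otimes> h) = B' * (\<rho> g * (\<rho> h * B))"
        unfolding \<alpha>_def representationD(2)[OF less.prems g h] using assoc_mult_mat[OF rg rh mats(1)] by simp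
      also have "\<rho> g * (\<rho> h * B) = \<rho> g * (B * B') * (\<rho> h * B) + \<rho> g * (C' * C) * (\<rho> h * B)"
        by (rule split[OF rg mult_carrier_mat[OF rh mats(1)]])
      also have "\<rho> g * (C' * C) * (\<rho> h * B) = \<rho> g * C' * (C * (\<rho> h * B))"
        using assoc_mult_mat[OF rg mats(4,3)] assoc_mult_mat[OF mult_carrier_mat[OF rg mats(4)] mats(3) mult_carrier_mat[OF rh mats(1)]] by simp
      also have "\<dots> = 0\<^sub>m n k" unfolding CrB[OF h] using mats rg by simp
      also have "\<rho> g * (B * B') * (\<rho> h * B) = \<rho> g * B * (B' * (\<rho> h * B))"
        using assoc_mult_mat[OF rg mats(1,2)] assoc_mult_mat[OF mult_carrier_mat[OF rg mats(1)] mats(2) mult_carrier_mat[OF rh mats(1)]] by simp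
      also have "B' * (\<rho> g * B * (B' * (\<rho> h * B)) + 0\<^sub>m n k) = B' * (\<rho> g * B * \<alpha> h)"
        unfolding \<alpha>_def
        using mult_carrier_mat[OF mult_carrier_mat[OF rg mats(1)] mult_carrier_mat[OF mats(2) mult_carrier_mat[OF rh mats(1)]]]
        by simp
      also have "\<dots> = \<alpha> g * \<alpha> h"
        unfolding \<alpha>_def by (rule assoc_mult_mat[OF mats(2) mult_carrier_mat[OF rg mats(1)], symmetric])
          (use mats rh in auto)
      finally show "\<alpha> (g \<otimes> h) = \<alpha> g * \<alpha> h" .
    next
      show "\<alpha> \<one> = 1\<^sub>m k" unfolding \<alpha>_def using representationD(3)[OF less.prems] BB mats by simp
    qed
    have \<delta>: "representation G m \<delta>"
      unfolding representation_iff
    proof (intro conjI ballI)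
      fix g assume "g \<in> carrier G"
      then show "\<delta> g \<in> carrier_mat m m"
        unfolding \<delta>_def by (intro mult_carrier_mat[OF mats(3) mult_carrier_mat[OF r mats(4)]])
    next
      fix g h assume g: "g \<in> carrier G" and h: "h \<in> carrier G"
      note rg = r[OF g] and rh = r[OF h]
      have Cr: "C * \<rho> g \<in> carrier_mat m n" using mats rg by simp
      have "\<delta> (g \<otimes> h) = C * \<rho> g * (\<rho> h * C')"
        unfolding \<delta>_def representationD(2)[OF less.prems g h]
        using assoc_mult_mat[OF rg rh mats(4)] assoc_mult_mat[OF mats(3) rg mult_carrier_mat[OF rh mats(4)]] by simp
      also have "\<dots> = C * \<rho> g * (B * B') * (\<rho> h * C') + C * \<rho> g * (C' * C) * (\<rho> h * C')"
        by (rule split[OF Cr mult_carrier_mat[OF rh mats(4)]])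
      also have "C * \<rho> g * (B * B') = C * (\<rho> g * B) * B'"
        using assoc_mult_mat[OF Cr mats(1,2)] assoc_mult_mat[OF mats(3) rg mats(1)] by simp
      also have "\<dots> = 0\<^sub>m m n" unfolding CrB[OF g] using mats by simp
      also have "0\<^sub>m m n * (\<rho> h * C') = 0\<^sub>m m m" using mats rh by simp
      also have "C * \<rho> g * (C' * C) * (\<rho> h * C') = C * \<rho> g * C' * (C * (\<rho> h * C'))"
        using assoc_mult_mat[OF Cr mats(4,3)] assoc_mult_mat[OF mult_carrier_mat[OF Cr mats(4)] mats(3) mult_carrier_mat[OF rh mats(4)]] by simp
      also have "C * \<rho> g * C' = \<delta> g" unfolding \<delta>_def by (rule assoc_mult_mat[OF mats(3) rg mats(4)])
      also have "0\<^sub>m m m + \<delta> g * (C * (\<rho> h * C')) = \<delta> g * \<delta> h"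
        unfolding \<delta>_def
        using mult_carrier_mat[OF mult_carrier_mat[OF mats(3) mult_carrier_mat[OF rg mats(4)]] mult_carrier_mat[OF mats(3) mult_carrier_mat[OF rh mats(4)]]]
        by simp
      finally show "\<delta> (g \<otimes> h) = \<delta> g * \<delta> h" .
    next
      show "\<delta> \<one> = 1\<^sub>m m" unfolding \<delta>_def using representationD(3)[OF less.prems] CC mats by simp
    qed
    have tr: "tr (\<rho> g) = tr (\<alpha> g) + tr (\<delta> g)" if g: "g \<in> carrier G" for g
    proof -
      note rg = r[OF g]
      have "\<rho> g = \<rho> g * (B * B') + \<rho> g * (C' * C)"
        using split[OF rg one_carrier_mat] rg mats by simp
      then have "tr (\<rho> g) = tr (\<rho> g * (B * B') + \<rho> g * (C' * C))" by (rule arg_cong)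
      also have "\<dots> = tr (\<rho> g * (B * B')) + tr (\<rho> g * (C' * C))" by (rule tr_add) (use rg mats in auto)
      also have "\<rho> g * (B * B') = \<rho> g * B * B'" by (rule assoc_mult_mat[OF rg mats(1,2), symmetric])
      also have "tr (\<rho> g * B * B') = tr (\<alpha> g)"
        unfolding \<alpha>_def by (rule tr_mult_comm[OF mult_carrier_mat[OF rg mats(1)] mats(2)])
      also have "\<rho> g * (C' * C) = \<rho> g * C' * C" by (rule assoc_mult_mat[OF rg mats(4,3), symmetric])
      also have "tr (\<rho> g * C' * C) = tr (\<delta> g)"
        unfolding \<delta>_def by (rule tr_mult_comm[OF mult_carrier_mat[OF rg mats(4)] mats(3)])
      finally show ?thesis .
    qed
    have kn: "k < n" and mn: "m < n" using nkm \<open>m \<noteq> 0\<close> \<open>k \<noteq> 0\<close> by auto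
    obtain \<psi>1 where \<psi>1: "set \<psi>1 \<subseteq> Irr G" "\<forall>g\<in>carrier G. tr (\<alpha> g) = (\<Sum>\<psi>\<leftarrow>\<psi>1. \<psi> g)"
      using less.IH[OF kn \<alpha>] by blast
    obtain \<psi>2 where \<psi>2: "set \<psi>2 \<subseteq> Irr G" "\<forall>g\<in>carrier G. tr (\<delta> g) = (\<Sum>\<psi>\<leftarrow>\<psi>2. \<psi> g)"
      using less.IH[OF mn \<delta>] by blast
    show ?thesis
      using \<psi>1 \<psi>2 tr by (intro exI[of _ "\<psi>1 @ \<psi>2"]) auto
  qed
qed

end

section \<open>The regular representation and the degree equation\<close>

lemma sum_list_map_eq_sum_of_nat_count:
  "sum_list (map f xs) = (\<Sum>x\<in>set xs. of_nat (count_list xs x) * (f x :: complex))"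
proof (induction xs)
  case (Cons x xs)
  have "(\<Sum>y\<in>set (x # xs). of_nat (count_list (x # xs) y) * f y) =
      (\<Sum>y\<in>set (x # xs). of_nat (count_list xs y) * f y) + (\<Sum>y\<in>set (x # xs). if y = x then f x else 0)"
    unfolding sum.distrib[symmetric] by (intro sum.cong refl) (auto simp: distrib_right)
  also have "(\<Sum>y\<in>set (x # xs). of_nat (count_list xs y) * f y) = (\<Sum>y\<in>set xs. of_nat (count_list xs y) * f y)"
    by (rule sum.mono_neutral_right) (auto simp: count_list_0_iff)
  finally show ?case using Cons by simp
qed simp

context finite_group
begin

text \<open>Left translations, written as permutation matrices in an enumeration e of the group;
  translation by g other than the identity has no fixed point.\<close>

lemma regular_representation_exists:
  "\<exists>n \<rho>. representation G n \<rho> \<and>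
     (\<forall>g\<in>carrier G. tr (\<rho> g) = (if g = \<one> then of_nat (card (carrier G)) else 0))"
proof -
  define n where "n = card (carrier G)"
  obtain e where e: "bij_betw e {..<n} (carrier G)"
    using ex_bij_betw_nat_finite[OF finite_carrier] by (auto simp: n_def atLeast0LessThan)
  have ec: "e i \<in> carrier G" if "i < n" for i using e that by (auto simp: bij_betw_def)
  have ei: "e i = e j \<longleftrightarrow> i = j" if "i < n" "j < n" for i j
    using e that by (auto simp: bij_betw_def inj_on_def)
  define \<rho> where "\<rho> g = mat n n (\<lambda>(i, j). if e i = g \<otimes> e j then 1 else 0 :: complex)" for g
  have c: "\<rho> g \<in> carrier_mat n n" for g by (simp add: \<rho>_def)
  have "representation G n \<rho>"
    unfolding representation_iff
  proof (intro conjI ballI c)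
    fix g h assume g: "g \<in> carrier G" and h: "h \<in> carrier G"
    show "\<rho> (g \<otimes> h) = \<rho> g * \<rho> h"
    proof (rule eq_matI)
      fix i j assume "i < dim_row (\<rho> g * \<rho> h)" "j < dim_col (\<rho> g * \<rho> h)"
      then have ij: "i < n" "j < n" by (simp_all add: \<rho>_def)
      have "h \<otimes> e j \<in> e ` {..<n}" using h ec ij e by (simp add: bij_betw_def)
      then obtain l where l: "l < n" "e l = h \<otimes> e j" by auto
      have "(\<rho> g * \<rho> h) $$ (i, j) = (\<Sum>k<n. if k = l then (if e i = g \<otimes> (h \<otimes> e j) then 1 else 0) else 0)"
        unfolding mult_mat_index[OF c c ij]
      proof (rule sum.cong[OF refl])
        fix k assume "k \<in> {..<n}"
        then have k: "k < n" by simp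
        have "\<rho> h $$ (k, j) = (if k = l then 1 else 0)"
          using k ij ei[OF k l(1)] by (simp add: \<rho>_def l(2)[symmetric])
        then show "\<rho> g $$ (i, k) * \<rho> h $$ (k, j) = (if k = l then (if e i = g \<otimes> (h \<otimes> e j) then 1 else 0) else 0)"
          using k ij l by (auto simp: \<rho>_def)
      qed
      also have "\<dots> = \<rho> (g \<otimes> h) $$ (i, j)"
        using l(1) ij g h ec by (simp add: \<rho>_def m_assoc)
      finally show "\<rho> (g \<otimes> h) $$ (i, j) = (\<rho> g * \<rho> h) $$ (i, j)" by (rule sym)
    qed (simp_all add: \<rho>_def)
  next
    show "\<rho> \<one> = 1\<^sub>m n" using ec ei by (intro eq_matI) (auto simp: \<rho>_def)
  qed
  moreover have "tr (\<rho> g) = (if g = \<one> then of_nat (card (carrier G)) else 0)" if g: "g \<in> carrier G" for g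
  proof -
    have "e i = g \<otimes> e i \<longleftrightarrow> g = \<one>" if "i < n" for i
      using g ec[OF that] by (metis l_one one_closed right_cancel)
    then have "tr (\<rho> g) = (\<Sum>i<n. if g = \<one> then 1 else 0)"
      unfolding tr_def by (intro sum.cong) (auto simp: \<rho>_def)
    then show ?thesis by (simp add: n_def)
  qed
  ultimately show ?thesis by blast
qed

lemma IrrE:
  assumes "\<chi> \<in> Irr G"
  obtains n \<rho> where "irreducible_representation G n \<rho>" "\<chi> = character G n \<rho>"
  using assms by (auto simp: Irr_def)

text \<open>Read off the character itself, so that no representation has to be chosen; for a
  character the value at the identity is a natural number and the rounding is exact.\<close>

definition degree :: "('a \<Rightarrow> complex) \<Rightarrow> nat" where
  "degree \<chi> = nat \<lfloor>Re (\<chi> \<one>)\<rfloor>"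

lemma degree_character:
  "representation G n \<rho> \<Longrightarrow> degree (character G n \<rho>) = n"
  by (simp add: degree_def character_one)

lemma character_at_one: "\<chi> \<in> Irr G \<Longrightarrow> \<chi> \<one> = of_nat (degree \<chi>)"
  by (auto elim!: IrrE simp: degree_character character_one irreducibleD(1))

lemma degree_pos: "\<chi> \<in> Irr G \<Longrightarrow> degree \<chi> > 0"
  by (auto elim!: IrrE simp: degree_character irreducibleD(1) irreducibleD(2))

text \<open>Orthogonality computes the multiplicity of chi among the composition factors of the
  regular representation as chi(1). It is positive, so every irreducible character occurs in one
  finite list; this is where finiteness of \<open>Irr G\<close> comes from.\<close>

lemma regular_character_decomposition:
  "finite (Irr G) \<and> (\<forall>g\<in>carrier G.
     (\<Sum>\<chi>\<in>Irr G. of_nat (degree \<chi>) * \<chi> g) = (if g = \<one> then of_nat (card (carrier G)) else 0))"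
proof -
  have card0: "card (carrier G) \<noteq> 0" using finite_carrier by auto
  obtain n \<rho> where \<rho>: "representation G n \<rho>"
    "\<And>g. g \<in> carrier G \<Longrightarrow> tr (\<rho> g) = (if g = \<one> then of_nat (card (carrier G)) else 0)"
    using regular_representation_exists by blast
  obtain \<psi>s where sub: "set \<psi>s \<subseteq> Irr G" and \<psi>s: "\<And>g. g \<in> carrier G \<Longrightarrow> tr (\<rho> g) = (\<Sum>\<psi>\<leftarrow>\<psi>s. \<psi> g)"
    using tr_representation_decompose[OF \<rho>(1)] by blast
  have count: "of_nat (count_list \<psi>s \<chi>) = (of_nat (degree \<chi>) :: complex)" if \<chi>: "\<chi> \<in> Irr G" for \<chi>
  proof -
    have "(\<Sum>g\<in>carrier G. tr (\<rho> g) * \<chi> (inv g)) = (\<Sum>g\<in>carrier G. if g = \<one> then of_nat (card (carrier G)) * \<chi> \<one> else 0)"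
      by (intro sum.cong) (auto simp: \<rho>(2))
    also have "\<dots> = of_nat (card (carrier G)) * of_nat (degree \<chi>)"
      using finite_carrier character_at_one[OF \<chi>] by simp
    finally have 1: "(\<Sum>g\<in>carrier G. tr (\<rho> g) * \<chi> (inv g)) = of_nat (card (carrier G)) * of_nat (degree \<chi>)" .
    have "(\<Sum>g\<in>carrier G. (\<Sum>\<psi>\<leftarrow>\<phi>s. \<psi> g) * \<chi> (inv g)) = of_nat (card (carrier G)) * of_nat (count_list \<phi>s \<chi>)"
      if "set \<phi>s \<subseteq> Irr G" for \<phi>s
      using that
    proof (induction \<phi>s)
      case (Cons \<phi> \<phi>s)
      then have "(\<Sum>g\<in>carrier G. \<phi> g * \<chi> (inv g)) = (if \<phi> = \<chi> then of_nat (card (carrier G)) else 0)"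
        by (intro character_orthogonality \<chi>) simp
      then show ?case using Cons by (simp add: distrib_right sum.distrib distrib_left)
    qed simp
    from this[OF sub] have "(\<Sum>g\<in>carrier G. tr (\<rho> g) * \<chi> (inv g)) = of_nat (card (carrier G)) * of_nat (count_list \<psi>s \<chi>)"
      by (simp add: \<psi>s cong: sum.cong)
    then show ?thesis using 1 card0 by simp
  qed
  have "Irr G \<subseteq> set \<psi>s"
  proof
    fix \<chi> assume \<chi>: "\<chi> \<in> Irr G"
    then have "count_list \<psi>s \<chi> \<noteq> 0" using count[OF \<chi>] degree_pos[OF \<chi>] by (metis of_nat_eq_iff neq0_conv)
    then show "\<chi> \<in> set \<psi>s" by (metis count_list_0_iff)
  qed
  then have eq: "Irr G = set \<psi>s" using sub by blast
  have "(\<Sum>\<chi>\<in>Irr G. of_nat (degree \<chi>) * \<chi> g) = tr (\<rho> g)" if g: "g \<in> carrier G" for g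
  proof -
    have "(\<Sum>\<psi>\<leftarrow>\<psi>s. \<psi> g) = (\<Sum>\<chi>\<in>set \<psi>s. of_nat (count_list \<psi>s \<chi>) * \<chi> g)"
      by (rule sum_list_map_eq_sum_of_nat_count)
    also have "\<dots> = (\<Sum>\<chi>\<in>Irr G. of_nat (degree \<chi>) * \<chi> g)"
      unfolding eq[symmetric] by (intro sum.cong refl) (simp add: count)
    finally show ?thesis using \<psi>s[OF g] by simp
  qed
  moreover have "finite (Irr G)" unfolding eq by simp
  ultimately show ?thesis using \<rho>(2) by simp
qed

lemma finite_Irr: "finite (Irr G)"
  using regular_character_decomposition by blast

text \<open>The sum E of the matrices of N commutes with the representation, so it is a scalar c.
  Multiplying by the matrix of h in N leaves E unchanged, so c = 0 as soon as some h in N acts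
  nontrivially.\<close>

lemma sum_character_normal:
  assumes N: "N \<lhd> G" and \<chi>: "\<chi> \<in> Irr G"
  shows "(\<Sum>h\<in>N. \<chi> h) = (if N \<subseteq> character_kernel G \<chi> then of_nat (card N * degree \<chi>) else 0)"
proof -
  obtain n \<rho> where \<rho>: "irreducible_representation G n \<rho>" and \<chi>eq: "\<chi> = character G n \<rho>"
    using \<chi> by (rule IrrE)
  note R = irreducibleD(1)[OF \<rho>]
  note r = representationD(1)[OF R]
  interpret N: normal N G by (rule N)
  have NG: "h \<in> carrier G" if "h \<in> N" for h using that N.subset by blast
  have deg: "degree \<chi> = n" using degree_character[OF R] \<chi>eq by simp
  have ker: "N \<subseteq> character_kernel G \<chi> \<longleftrightarrow> (\<forall>h\<in>N. \<rho> h = 1\<^sub>m n)"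
    unfolding \<chi>eq character_kernel_eq[OF R] using NG by blast
  define E where "E = mat_sum n n \<rho> N"
  have E: "E \<in> carrier_mat n n" by (simp add: E_def)
  have trE: "tr E = (\<Sum>h\<in>N. \<chi> h)"
    unfolding E_def \<chi>eq using NG r
    by (subst tr_mat_sum) (auto simp: character_eq_tr[OF R] intro!: sum.cong)
  show ?thesis
  proof (cases "N \<subseteq> character_kernel G \<chi>")
    case True
    then have "\<chi> h = of_nat n" if "h \<in> N" for h
      using that deg character_at_one[OF \<chi>] by (auto simp: character_kernel_def)
    then show ?thesis using True deg by simp
  next
    case False
    then obtain h where h: "h \<in> N" "\<rho> h \<noteq> 1\<^sub>m n" using ker by blast
    have comm: "E * \<rho> g = \<rho> g * E" if g: "g \<in> carrier G" for g
    proof -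
      have canc: "inv g \<otimes> (g \<otimes> h) = h" "g \<otimes> (inv g \<otimes> h) = h" if "h \<in> N" for h
        using g NG[OF that] by (simp_all add: m_assoc[symmetric])
      have bij: "bij_betw (\<lambda>h. g \<otimes> h \<otimes> inv g) N N"
        by (rule bij_betwI[where g = "\<lambda>h. inv g \<otimes> h \<otimes> g"])
          (use g NG canc N.inv_op_closed1 N.inv_op_closed2 in \<open>auto simp: m_assoc inv_solve_left inv_solve_right\<close>)
      have "E * \<rho> g = mat_sum n n (\<lambda>h. \<rho> h * \<rho> g) N"
        unfolding E_def by (rule mat_sum_mult[OF r[OF g]]) (use r NG in auto)
      also have "\<dots> = mat_sum n n (\<lambda>h. \<rho> (g \<otimes> h \<otimes> inv g) * \<rho> g) N"
        by (rule mat_sum_reindex[OF bij])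
      also have "\<dots> = mat_sum n n (\<lambda>h. \<rho> g * \<rho> h) N"
      proof (rule mat_sum_cong)
        fix h assume "h \<in> N"
        then have h: "h \<in> carrier G" by (rule NG)
        show "\<rho> (g \<otimes> h \<otimes> inv g) * \<rho> g = \<rho> g * \<rho> h"
          using representationD(2)[OF R, of "g \<otimes> h \<otimes> inv g" g] representationD(2)[OF R, of g h] g h
          by (simp add: m_assoc)
      qed
      also have "\<dots> = \<rho> g * E"
        unfolding E_def by (rule mult_mat_sum[OF r[OF g], symmetric]) (use r NG in auto)
      finally show ?thesis .
    qed
    obtain c where c: "E = c \<cdot>\<^sub>m 1\<^sub>m n" using schur_scalar[OF \<rho> E comm] by blast
    have hG: "h \<in> carrier G" using h NG by blast
    have bij: "bij_betw (\<lambda>k. h \<otimes> k) N N"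
      by (rule bij_betwI[where g = "\<lambda>k. inv h \<otimes> k"]) (use h hG NG in \<open>auto simp: m_assoc[symmetric]\<close>)
    have "E = mat_sum n n (\<lambda>k. \<rho> (h \<otimes> k)) N" unfolding E_def by (rule mat_sum_reindex[OF bij])
    also have "\<dots> = mat_sum n n (\<lambda>k. \<rho> h * \<rho> k) N"
      by (rule mat_sum_cong) (use representationD(2)[OF R hG] NG in auto)
    also have "\<dots> = \<rho> h * E" unfolding E_def by (rule mult_mat_sum[OF r[OF hG], symmetric]) (use r NG in auto)
    finally have hE: "c \<cdot>\<^sub>m 1\<^sub>m n = c \<cdot>\<^sub>m \<rho> h"
      unfolding c using r[OF hG] mult_smult_distrib[OF r[OF hG] one_carrier_mat, of c] by simp
    have "c = 0"
    proof (rule ccontr)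
      assume "c \<noteq> 0"
      have "\<rho> h = 1\<^sub>m n"
      proof (rule eq_matI)
        fix i j assume "i < dim_row (1\<^sub>m n)" "j < dim_col (1\<^sub>m n)"
        then have ij: "i < n" "j < n" by simp_all
        have "(c \<cdot>\<^sub>m 1\<^sub>m n) $$ (i, j) = (c \<cdot>\<^sub>m \<rho> h) $$ (i, j)" using hE by simp
        then show "\<rho> h $$ (i, j) = 1\<^sub>m n $$ (i, j)" using ij r[OF hG] \<open>c \<noteq> 0\<close> by (simp split: if_splits)
      qed (use r[OF hG] in auto)
      then show False using h by simp
    qed
    then have "tr E = 0" unfolding c by (simp add: tr_def)
    then show ?thesis using False trE by simp
  qed
qed

text \<open>The regular character summed over N is |G|, from the identity alone; on the other side
  only the chi with N in the kernel survive. This is the degree equation of G/N, expressed through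
  kernels inside G.\<close>

theorem sum_degree_squares:
  assumes N: "N \<lhd> G"
  shows "card N * (\<Sum>\<chi> | \<chi> \<in> Irr G \<and> N \<subseteq> character_kernel G \<chi>. degree \<chi> ^ 2) = card (carrier G)"
proof -
  interpret N: normal N G by (rule N)
  have NG: "N \<subseteq> carrier G" by (rule N.subset)
  then have fN: "finite N" using finite_carrier finite_subset by blast
  have "(of_nat (card (carrier G)) :: complex) = (\<Sum>h\<in>N. if h = \<one> then of_nat (card (carrier G)) else 0)"
    using fN by simp
  also have "\<dots> = (\<Sum>h\<in>N. \<Sum>\<chi>\<in>Irr G. of_nat (degree \<chi>) * \<chi> h)"
    using NG conjunct2[OF regular_character_decomposition] by (intro sum.cong) auto
  also have "\<dots> = (\<Sum>\<chi>\<in>Irr G. \<Sum>h\<in>N. of_nat (degree \<chi>) * \<chi> h)" by (rule sum.swap)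
  also have "\<dots> = (\<Sum>\<chi>\<in>Irr G. if N \<subseteq> character_kernel G \<chi> then of_nat (card N * degree \<chi> ^ 2) else 0)"
    by (intro sum.cong refl) (auto simp: sum_distrib_left[symmetric] sum_character_normal[OF N] power2_eq_square)
  also have "\<dots> = (\<Sum>\<chi> | \<chi> \<in> Irr G \<and> N \<subseteq> character_kernel G \<chi>. of_nat (card N * degree \<chi> ^ 2))"
    using finite_Irr by (simp add: sum.If_cases Int_def)
  also have "\<dots> = of_nat (card N * (\<Sum>\<chi> | \<chi> \<in> Irr G \<and> N \<subseteq> character_kernel G \<chi>. degree \<chi> ^ 2))"
    by (simp add: sum_distrib_left)
  finally show ?thesis by (metis of_nat_eq_iff)
qed

end

section \<open>Kernels, degrees and linear characters\<close>

context finite_group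
begin

section \<open>Indices of subgroups\<close>

definition index :: "'a set \<Rightarrow> nat" where
  "index H = card (rcosets H)"

lemma index_mult_card: "subgroup H G \<Longrightarrow> index H * card H = card (carrier G)"
  unfolding index_def using lagrange by (simp add: Coset.order_def)

lemma card_carrier_pos: "card (carrier G) > 0"
  using finite_carrier by (auto simp: card_gt_0_iff)

lemma finite_subgroup: "subgroup H G \<Longrightarrow> finite H"
  using finite_carrier subgroup.subset finite_subset by metis

lemma card_subgroup_pos: "subgroup H G \<Longrightarrow> card H > 0"
  using finite_subgroup subgroup.one_closed by (fastforce simp: card_gt_0_iff)

lemma index_pos: "subgroup H G \<Longrightarrow> index H > 0"
  using index_mult_card card_carrier_pos by (metis mult_0 neq0_conv)

lemma card_subgroup_dvd:
  assumes "subgroup H G" "subgroup K G" "H \<subseteq> K"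
  shows "card H dvd card K"
proof -
  interpret K: group "G\<lparr>carrier := K\<rparr>" by (rule subgroup_imp_group[OF assms(2)])
  have "subgroup H (G\<lparr>carrier := K\<rparr>)" using subgroup_incl[OF assms] .
  from K.lagrange[OF this] have "card (rcosets\<^bsub>G\<lparr>carrier := K\<rparr>\<^esub> H) * card H = card K"
    by (simp add: Coset.order_def)
  then show ?thesis by (rule dvdI[OF trans[OF sym mult.commute]])
qed

lemma index_dvd:
  assumes "subgroup H G" "subgroup K G" "H \<subseteq> K"
  shows "index K dvd index H"
proof -
  obtain c where c: "card K = card H * c" using card_subgroup_dvd[OF assms] by blast
  have "index H * card H = index K * c * card H"
    using index_mult_card[OF assms(1)] index_mult_card[OF assms(2)] c by (simp add: mult_ac)
  then show ?thesis using card_subgroup_pos[OF assms(1)] by simp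
qed

lemma index_eqD:
  assumes "subgroup H G" "subgroup K G" "H \<subseteq> K" "index H \<le> index K"
  shows "H = K"
proof -
  have "index K * card K \<le> index K * card H"
    using index_mult_card[OF assms(1)] index_mult_card[OF assms(2)] assms(4) by (metis mult_le_mono1)
  then have "card K \<le> card H" using index_pos[OF assms(2)] by simp
  then show ?thesis using card_seteq[OF finite_subgroup[OF assms(2)] assms(3)] by simp
qed

section \<open>Kernels, codegrees and the principal character\<close>

lemma kernel_normal: "\<chi> \<in> Irr G \<Longrightarrow> character_kernel G \<chi> \<lhd> G"
proof -
  assume "\<chi> \<in> Irr G"
  then obtain n \<rho> where \<rho>: "irreducible_representation G n \<rho>" "\<chi> = character G n \<rho>" by (rule IrrE)
  note R = irreducibleD(1)[OF \<rho>(1)]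
  note r = representationD[OF R]
  show ?thesis
    unfolding \<rho>(2) character_kernel_eq[OF R] normal_inv_iff
  proof (intro conjI ballI)
    show "subgroup {g \<in> carrier G. \<rho> g = 1\<^sub>m n} G"
    proof (rule subgroup.intro)
      fix g assume "g \<in> {g \<in> carrier G. \<rho> g = 1\<^sub>m n}"
      then have g: "g \<in> carrier G" "\<rho> g = 1\<^sub>m n" by auto
      have "\<rho> (inv g) = \<rho> (inv g) * \<rho> g" using g r(1)[of "inv g"] by simp
      also have "\<dots> = 1\<^sub>m n" using r(2)[of "inv g" g] r(3) g by simp
      finally show "inv g \<in> {g \<in> carrier G. \<rho> g = 1\<^sub>m n}" using g by simp
    qed (auto simp: r)
  next
    fix g h assume g: "g \<in> carrier G" and "h \<in> {g \<in> carrier G. \<rho> g = 1\<^sub>m n}"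
    then have h: "h \<in> carrier G" "\<rho> h = 1\<^sub>m n" by auto
    have "\<rho> (g \<otimes> h \<otimes> inv g) = \<rho> g * \<rho> h * \<rho> (inv g)" using g h r(2) by simp
    also have "\<dots> = \<rho> (g \<otimes> inv g)" using h r(1)[OF g] r(2)[of g "inv g"] g by simp
    finally show "g \<otimes> h \<otimes> inv g \<in> {g \<in> carrier G. \<rho> g = 1\<^sub>m n}" using g h r(3) by simp
  qed
qed

lemma kernel_subgroup: "\<chi> \<in> Irr G \<Longrightarrow> subgroup (character_kernel G \<chi>) G"
  by (rule normal_imp_subgroup[OF kernel_normal])

lemma index_eq_sum_degree_squares:
  assumes "N \<lhd> G"
  shows "index N = (\<Sum>\<chi> | \<chi> \<in> Irr G \<and> N \<subseteq> character_kernel G \<chi>. degree \<chi> ^ 2)"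
proof -
  note N = normal_imp_subgroup[OF assms]
  have "card N * index N = card N * (\<Sum>\<chi> | \<chi> \<in> Irr G \<and> N \<subseteq> character_kernel G \<chi>. degree \<chi> ^ 2)"
    unfolding sum_degree_squares[OF assms] using index_mult_card[OF N] by (simp add: mult.commute)
  then show ?thesis using card_subgroup_pos[OF N] by simp
qed

lemma card_eq_sum_degree_squares: "card (carrier G) = (\<Sum>\<chi>\<in>Irr G. degree \<chi> ^ 2)"
proof -
  have "{\<one>} \<subseteq> character_kernel G \<chi>" for \<chi> by (simp add: character_kernel_def)
  then show ?thesis using sum_degree_squares[OF one_is_normal] by simp
qed

text \<open>Clears the complex denominator: from here on a codegree is handled as an equation
  between natural numbers.\<close>

lemma codegree_eq_iff:
  assumes "\<chi> \<in> Irr G"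
  shows "codegree G \<chi> = of_nat d \<longleftrightarrow> index (character_kernel G \<chi>) = d * degree \<chi>"
proof -
  have "codegree G \<chi> = of_nat (index (character_kernel G \<chi>)) / of_nat (degree \<chi>)"
    unfolding codegree_def index_def character_at_one[OF assms] ..
  moreover have "(of_nat (degree \<chi>) :: complex) \<noteq> 0" using degree_pos[OF assms] by simp
  ultimately show ?thesis
    by (simp add: nonzero_divide_eq_eq) (metis of_nat_eq_iff of_nat_mult)
qed

text \<open>For N = G the degree equation writes 1 as a sum of squares of positive integers, so
  there is exactly one term.\<close>

lemma principal_character:
  "\<exists>\<chi>. {\<chi> \<in> Irr G. character_kernel G \<chi> = carrier G} = {\<chi>} \<and> degree \<chi> = 1"
proof -
  let ?S = "{\<chi> \<in> Irr G. character_kernel G \<chi> = carrier G}"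
  have S: "?S = {\<chi>. \<chi> \<in> Irr G \<and> carrier G \<subseteq> character_kernel G \<chi>}"
    by (auto simp: character_kernel_def)
  have "index (carrier G) = 1"
    using index_mult_card[OF subgroup_self] card_carrier_pos by simp
  then have 1: "(\<Sum>\<chi>\<in>?S. degree \<chi> ^ 2) = 1"
    using index_eq_sum_degree_squares[OF normal_self] S by simp
  have fS: "finite ?S" using finite_Irr by simp
  have "?S \<noteq> {}"
  proof
    assume e: "?S = {}"
    show False using 1 unfolding e by simp
  qed
  then obtain \<chi> where \<chi>: "\<chi> \<in> ?S" by blast
  then have "(\<Sum>\<psi>\<in>?S. degree \<psi> ^ 2) = degree \<chi> ^ 2 + (\<Sum>\<psi>\<in>?S - {\<chi>}. degree \<psi> ^ 2)"
    using fS by (simp add: sum.remove)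
  moreover have "degree \<chi> ^ 2 \<ge> 1" using degree_pos \<chi> by (simp add: Suc_le_eq)
  ultimately have d: "degree \<chi> ^ 2 = 1" and z: "(\<Sum>\<psi>\<in>?S - {\<chi>}. degree \<psi> ^ 2) = 0" using 1 by linarith+
  have "?S - {\<chi>} = {}"
  proof (rule ccontr)
    assume "?S - {\<chi>} \<noteq> {}"
    then obtain \<psi> where \<psi>: "\<psi> \<in> ?S - {\<chi>}" by blast
    then have "degree \<psi> ^ 2 = 0" using z fS by (metis (no_types, lifting) finite_Diff sum_eq_0_iff)
    then show False using \<psi> degree_pos by fastforce
  qed
  then show ?thesis using \<chi> d by (intro exI[of _ \<chi>]) (auto simp: power_eq_1_iff)
qed

text \<open>The sum of squares for ker chi contains the principal character besides chi.\<close>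

lemma degree_square_less_index:
  assumes \<chi>: "\<chi> \<in> Irr G" and "degree \<chi> > 1"
  shows "degree \<chi> ^ 2 < index (character_kernel G \<chi>)"
proof -
  obtain \<pi> where \<pi>: "\<pi> \<in> Irr G" "character_kernel G \<pi> = carrier G" "degree \<pi> = 1"
    using principal_character by blast
  have "\<chi> \<noteq> \<pi>" using \<pi> assms by auto
  let ?S = "{\<psi>. \<psi> \<in> Irr G \<and> character_kernel G \<chi> \<subseteq> character_kernel G \<psi>}"
  have "(\<Sum>\<psi>\<in>{\<chi>, \<pi>}. degree \<psi> ^ 2) \<le> (\<Sum>\<psi>\<in>?S. degree \<psi> ^ 2)"
  proof (rule sum_mono2)
    show "finite ?S" using finite_Irr by simp
    have "character_kernel G \<chi> \<subseteq> carrier G" by (auto simp: character_kernel_def)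
    then show "{\<chi>, \<pi>} \<subseteq> ?S" using \<chi> \<pi> by auto
  qed simp
  then show ?thesis
    using \<open>\<chi> \<noteq> \<pi>\<close> \<pi>(3) index_eq_sum_degree_squares[OF kernel_normal[OF \<chi>]] by simp
qed

section \<open>Linear characters\<close>

lemma linear_character_mult:
  assumes \<chi>: "\<chi> \<in> Irr G" and "degree \<chi> = 1" and g: "g \<in> carrier G" and h: "h \<in> carrier G"
  shows "\<chi> (g \<otimes> h) = \<chi> g * \<chi> h"
proof -
  obtain n \<rho> where \<rho>: "irreducible_representation G n \<rho>" "\<chi> = character G n \<rho>" using \<chi> by (rule IrrE)
  note R = irreducibleD(1)[OF \<rho>(1)]
  have n: "n = 1" using degree_character[OF R] \<rho>(2) assms(2) by simp
  have v: "\<chi> k = \<rho> k $$ (0, 0)" if "k \<in> carrier G" for k using that \<rho>(2) n by (simp add: character_def)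
  have "\<chi> (g \<otimes> h) = (\<rho> g * \<rho> h) $$ (0, 0)" using v[of "g \<otimes> h"] representationD(2)[OF R g h] g h by simp
  also have "\<dots> = \<rho> g $$ (0, 0) * \<rho> h $$ (0, 0)"
    using mult_mat_index[OF representationD(1)[OF R g] representationD(1)[OF R h], of 0 0] n by simp
  finally show ?thesis using v g h by simp
qed

lemma linear_character_one: "\<chi> \<in> Irr G \<Longrightarrow> degree \<chi> = 1 \<Longrightarrow> \<chi> \<one> = 1"
  using character_at_one[of \<chi>] by simp

lemma linear_character_pow:
  assumes "\<chi> \<in> Irr G" "degree \<chi> = 1" "g \<in> carrier G"
  shows "\<chi> (g [^] (k::nat)) = \<chi> g ^ k"
  by (induction k) (simp_all add: assms linear_character_mult linear_character_one)

lemma linear_kernel_iff: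
  "\<chi> \<in> Irr G \<Longrightarrow> degree \<chi> = 1 \<Longrightarrow> g \<in> character_kernel G \<chi> \<longleftrightarrow> g \<in> carrier G \<and> \<chi> g = 1"
  by (simp add: character_kernel_def linear_character_one)

lemma linear_character_inv_mult:
  assumes "\<chi> \<in> Irr G" "degree \<chi> = 1" "g \<in> carrier G"
  shows "\<chi> (inv g) * \<chi> g = 1"
  using linear_character_mult[OF assms(1,2), of "inv g" g] assms(3) linear_character_one[OF assms(1,2)] by simp

text \<open>For the converse, when commutators act trivially all matrices commute and are scalars by
  Schur's lemma; then every line is invariant and the dimension is 1.\<close>

lemma linear_iff_derived_le_kernel:
  assumes \<chi>: "\<chi> \<in> Irr G"
  shows "degree \<chi> = 1 \<longleftrightarrow> derived G (carrier G) \<subseteq> character_kernel G \<chi>"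
proof
  assume d: "degree \<chi> = 1"
  show "derived G (carrier G) \<subseteq> character_kernel G \<chi>"
    unfolding derived_def
  proof (rule generate_subgroup_incl[OF _ kernel_subgroup[OF \<chi>]])
    show "derived_set G (carrier G) \<subseteq> character_kernel G \<chi>"
    proof
      fix c assume "c \<in> derived_set G (carrier G)"
      then obtain g h where g: "g \<in> carrier G" and h: "h \<in> carrier G" and c: "c = g \<otimes> h \<otimes> inv g \<otimes> inv h" by auto
      have "\<chi> c = (\<chi> (inv g) * \<chi> g) * (\<chi> (inv h) * \<chi> h)"
        unfolding c using g h by (simp add: linear_character_mult[OF \<chi> d])
      then show "c \<in> character_kernel G \<chi>"
        using g h linear_character_inv_mult[OF \<chi> d] by (simp add: linear_kernel_iff[OF \<chi> d] c)
    qed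
  qed
next
  assume D: "derived G (carrier G) \<subseteq> character_kernel G \<chi>"
  obtain n \<rho> where \<rho>: "irreducible_representation G n \<rho>" "\<chi> = character G n \<rho>" using \<chi> by (rule IrrE)
  note R = irreducibleD(1)[OF \<rho>(1)]
  note r = representationD[OF R]
  have comm: "\<rho> g * \<rho> h = \<rho> h * \<rho> g" if g: "g \<in> carrier G" and h: "h \<in> carrier G" for g h
  proof -
    let ?c = "g \<otimes> h \<otimes> inv g \<otimes> inv h"
    have "?c \<in> derived_set G (carrier G)" using g h by auto
    then have "?c \<in> derived G (carrier G)" unfolding derived_def by (rule generate.incl)
    then have c: "\<rho> ?c = 1\<^sub>m n" using D unfolding \<rho>(2) character_kernel_eq[OF R] by blast
    have "inv h \<otimes> (h \<otimes> g) = g" using g h by (simp add: m_assoc[symmetric])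
    then have "?c \<otimes> (h \<otimes> g) = g \<otimes> h" using g h by (simp add: m_assoc)
    then have "\<rho> (g \<otimes> h) = \<rho> ?c * \<rho> (h \<otimes> g)" using r(2)[of ?c "h \<otimes> g"] g h by simp
    then show ?thesis
      using c r(2)[OF g h] r(2)[OF h g] left_mult_one_mat[OF r(1)[OF m_closed[OF h g]]] by simp
  qed
  have scal: "\<exists>c. \<rho> g = c \<cdot>\<^sub>m 1\<^sub>m n" if g: "g \<in> carrier G" for g
    by (rule schur_scalar[OF \<rho>(1) r(1)[OF g]]) (rule comm[OF g])
  have n0: "n > 0" by (rule irreducibleD(2)[OF \<rho>(1)])
  let ?W = "{a \<cdot>\<^sub>v unit_vec n 0 | a :: complex. True}"
  have sub: "VectorSpace.subspace class_ring ?W (module_vec TYPE(complex) n)"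
    unfolding subspace_iff
  proof (intro conjI ballI allI)
    show "?W \<subseteq> carrier_vec n" by auto
    have "0\<^sub>v n = 0 \<cdot>\<^sub>v (unit_vec n 0 :: complex vec)" by (intro eq_vecI) auto
    then show "0\<^sub>v n \<in> ?W" by blast
  next
    fix v w assume "v \<in> ?W" "w \<in> ?W"
    then obtain a b where "v = a \<cdot>\<^sub>v unit_vec n 0" "w = b \<cdot>\<^sub>v unit_vec n 0" by blast
    then have "v + w = (a + b) \<cdot>\<^sub>v unit_vec n 0" by (simp add: add_smult_distrib_vec)
    then show "v + w \<in> ?W" by blast
  next
    fix b v assume "v \<in> ?W"
    then obtain a where "v = a \<cdot>\<^sub>v unit_vec n 0" by blast
    then have "b \<cdot>\<^sub>v v = (b * a) \<cdot>\<^sub>v unit_vec n 0" by (simp add: smult_smult_assoc)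
    then show "b \<cdot>\<^sub>v v \<in> ?W" by blast
  qed
  have "\<rho> g *\<^sub>v w \<in> ?W" if g: "g \<in> carrier G" and w: "w \<in> ?W" for g w
  proof -
    obtain c where c: "\<rho> g = c \<cdot>\<^sub>m 1\<^sub>m n" using scal[OF g] by blast
    obtain a where a: "w = a \<cdot>\<^sub>v unit_vec n 0" using w by blast
    have "\<rho> g *\<^sub>v w = (c * a) \<cdot>\<^sub>v unit_vec n 0" unfolding c a by (intro eq_vecI) auto
    then show ?thesis by blast
  qed
  then have "?W = {0\<^sub>v n} \<or> ?W = carrier_vec n" by (rule irreducibleD(3)[OF \<rho>(1) sub])
  moreover have "?W \<noteq> {0\<^sub>v n}"
  proof
    assume "?W = {0\<^sub>v n}"
    moreover have "1 \<cdot>\<^sub>v unit_vec n 0 \<in> ?W" by blast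
    ultimately have "1 \<cdot>\<^sub>v unit_vec n 0 = (0\<^sub>v n :: complex vec)" by blast
    then have "(1 \<cdot>\<^sub>v unit_vec n 0) $ 0 = (0\<^sub>v n :: complex vec) $ 0" by (rule arg_cong)
    then show False using n0 by simp
  qed
  ultimately have W: "?W = carrier_vec n" by blast
  have "n = 1"
  proof (rule ccontr)
    assume "n \<noteq> 1"
    then have n1: "1 < n" using n0 by simp
    have "unit_vec n 1 \<in> ?W" unfolding W by simp
    then obtain a :: complex where "unit_vec n 1 = a \<cdot>\<^sub>v unit_vec n 0" by blast
    then have "unit_vec n 1 $ 1 = (a \<cdot>\<^sub>v unit_vec n 0) $ 1" by (rule arg_cong)
    then show False using n1 by simp
  qed
  then show "degree \<chi> = 1" using degree_character[OF R] \<rho>(2) by simp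
qed

lemma card_linear_characters:
  assumes N: "N \<lhd> G" and D: "derived G (carrier G) \<subseteq> N"
  shows "card {\<chi> \<in> Irr G. N \<subseteq> character_kernel G \<chi>} = index N"
proof -
  have "index N = (\<Sum>\<chi> | \<chi> \<in> Irr G \<and> N \<subseteq> character_kernel G \<chi>. 1)"
    unfolding index_eq_sum_degree_squares[OF N]
  proof (intro sum.cong refl)
    fix \<chi> assume "\<chi> \<in> {\<chi>. \<chi> \<in> Irr G \<and> N \<subseteq> character_kernel G \<chi>}"
    then have "degree \<chi> = 1" using linear_iff_derived_le_kernel D by auto
    then show "degree \<chi> ^ 2 = 1" by simp
  qed
  then show ?thesis by simp
qed

lemma normal_derived: "derived G (carrier G) \<lhd> G"
  by (rule derived_is_normal[OF normal_self])

lemma card_degree_one: "card {\<chi> \<in> Irr G. degree \<chi> = 1} = index (derived G (carrier G))"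
proof -
  have "{\<chi> \<in> Irr G. degree \<chi> = 1} = {\<chi> \<in> Irr G. derived G (carrier G) \<subseteq> character_kernel G \<chi>}"
    using linear_iff_derived_le_kernel by blast
  then show ?thesis using card_linear_characters[OF normal_derived] by simp
qed

lemma pow_index_in_normal:
  assumes N: "N \<lhd> G" and g: "g \<in> carrier G"
  shows "g [^] index N \<in> N"
proof -
  interpret N: normal N G by (rule N)
  interpret Q: group "G Mod N" by (rule N.factorgroup_is_group)
  have "Coset.order (G Mod N) = index N" by (simp add: Coset.order_def FactGroup_def index_def)
  moreover have "N #> g \<in> carrier (G Mod N)" using g by (simp add: carrier_FactGroup)
  ultimately have "(N #> g) [^]\<^bsub>G Mod N\<^esub> index N = N" using Q.pow_order_eq_1 by (metis one_FactGroup)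
  then have "N #> (g [^] index N) = N" using N.FactGroup_pow[OF g] by simp
  then show ?thesis using g by (metis N.subgroup_axioms coset_join1 nat_pow_closed N.subset)
qed

text \<open>The fibres of chi are the cosets of its kernel.\<close>

lemma card_linear_values:
  assumes \<chi>: "\<chi> \<in> Irr G" "degree \<chi> = 1"
  shows "card (\<chi> ` carrier G) = index (character_kernel G \<chi>)"
proof -
  let ?K = "character_kernel G \<chi>"
  note K = kernel_subgroup[OF \<chi>(1)]
  have fiber: "card {g \<in> carrier G. \<chi> g = z} = card ?K" if "z \<in> \<chi> ` carrier G" for z
  proof -
    obtain x where x: "x \<in> carrier G" "z = \<chi> x" using \<open>z \<in> \<chi> ` carrier G\<close> by blast
    have "{g \<in> carrier G. \<chi> g = z} = (\<lambda>k. k \<otimes> x) ` ?K"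
    proof
      show "(\<lambda>k. k \<otimes> x) ` ?K \<subseteq> {g \<in> carrier G. \<chi> g = z}"
        using x by (auto simp: linear_kernel_iff[OF \<chi>] linear_character_mult[OF \<chi>])
      show "{g \<in> carrier G. \<chi> g = z} \<subseteq> (\<lambda>k. k \<otimes> x) ` ?K"
      proof
        fix g assume "g \<in> {g \<in> carrier G. \<chi> g = z}"
        then have g: "g \<in> carrier G" "\<chi> g = \<chi> x" using x by auto
        have "\<chi> (g \<otimes> inv x) = \<chi> (inv x) * \<chi> x"
          using g x linear_character_mult[OF \<chi> g(1), of "inv x"] by simp
        then have "\<chi> (g \<otimes> inv x) = 1" using linear_character_inv_mult[OF \<chi> x(1)] by simp
        then have "g \<otimes> inv x \<in> ?K" using g x by (simp add: linear_kernel_iff[OF \<chi>])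
        moreover have "g = g \<otimes> inv x \<otimes> x" using g x by (simp add: m_assoc)
        ultimately show "g \<in> (\<lambda>k. k \<otimes> x) ` ?K" by (rule rev_image_eqI)
      qed
    qed
    moreover have "inj_on (\<lambda>k. k \<otimes> x) ?K"
    proof (rule inj_onI)
      fix k l assume "k \<in> ?K" "l \<in> ?K" "k \<otimes> x = l \<otimes> x"
      then show "k = l" using x(1) subgroup.mem_carrier[OF K] by simp
    qed
    ultimately show ?thesis by (simp add: card_image)
  qed
  have "card (carrier G) = (\<Sum>z\<in>\<chi> ` carrier G. \<Sum>g\<in>{g \<in> carrier G. \<chi> g = z}. (1 :: nat))"
    using sum.image_gen[OF finite_carrier, of "\<lambda>_. 1 :: nat" \<chi>] by simp
  also have "\<dots> = card (\<chi> ` carrier G) * card ?K"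
    using fiber by simp
  finally show ?thesis
    using index_mult_card[OF K] card_subgroup_pos[OF K] by simp
qed

lemma linear_index_le:
  assumes \<chi>: "\<chi> \<in> Irr G" "degree \<chi> = 1" and m: "m > 0"
    and "\<And>g. g \<in> carrier G \<Longrightarrow> \<chi> g ^ m = 1"
  shows "index (character_kernel G \<chi>) \<le> m"
proof -
  have "\<chi> ` carrier G \<subseteq> {z. z ^ m = 1}" using assms(4) by blast
  moreover have "finite {z :: complex. z ^ m = 1}" using finite_roots_unity[of m] m by simp
  moreover have "card {z :: complex. z ^ m = 1} = m" using card_roots_unity_eq[of m] m by simp
  ultimately show ?thesis using card_mono card_linear_values[OF \<chi>] by metis
qed

lemma linear_pow_index:
  assumes "\<chi> \<in> Irr G" "degree \<chi> = 1" "g \<in> carrier G"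
  shows "\<chi> g ^ index (character_kernel G \<chi>) = 1"
  using pow_index_in_normal[OF kernel_normal[OF assms(1)] assms(3)] linear_character_pow[OF assms]
    linear_kernel_iff[OF assms(1,2)] by metis

text \<open>The values of a linear character form a finite group of roots of unity; in the prime power
  case some value is a primitive root because there are only \<open>p ^ i\<close> roots of order dividing \<open>p ^ i\<close>.\<close>

lemma linear_primitive_value:
  assumes \<chi>: "\<chi> \<in> Irr G" "degree \<chi> = 1" and p: "prime p" and i: "index (character_kernel G \<chi>) = p ^ Suc i"
  obtains x where "x \<in> carrier G" "\<chi> x ^ (p ^ i) \<noteq> 1"
    "\<And>g. g \<in> carrier G \<Longrightarrow> \<exists>k. inv (x [^] (k::nat)) \<otimes> g \<in> character_kernel G \<chi>"
proof -
  have "\<exists>x\<in>carrier G. \<chi> x ^ (p ^ i) \<noteq> 1"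
  proof (rule ccontr)
    assume "\<not> ?thesis"
    then have "index (character_kernel G \<chi>) \<le> p ^ i"
      using prime_gt_0_nat[OF p] by (intro linear_index_le[OF \<chi>]) auto
    then show False using i prime_gt_1_nat[OF p] by simp
  qed
  then obtain x where x: "x \<in> carrier G" "\<chi> x ^ (p ^ i) \<noteq> 1" by blast
  let ?n = "p ^ Suc i"
  have z1: "\<chi> x ^ ?n = 1" using linear_pow_index[OF \<chi> x(1)] i by simp
  have nz: "\<chi> x \<noteq> 0" using z1 prime_gt_0_nat[OF p] by (metis power_0_left zero_neq_one power_not_zero neq0_conv zero_less_power)
  have inj: "inj_on (\<lambda>k. \<chi> x ^ k) {..<?n}"
  proof (rule linorder_inj_onI')
    fix k l assume kl: "k \<in> {..<?n}" "l \<in> {..<?n}" "k < l"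
    show "\<chi> x ^ k \<noteq> \<chi> x ^ l"
    proof
      assume "\<chi> x ^ k = \<chi> x ^ l"
      also have "\<chi> x ^ l = \<chi> x ^ k * \<chi> x ^ (l - k)" using kl by (simp add: power_add[symmetric])
      finally have 1: "\<chi> x ^ (l - k) = 1" using nz by simp
      have "\<not> ?n dvd (l - k)" using kl by (auto dest: dvd_imp_le)
      \<comment> \<open>By Bezout the value of \<chi> at x has q-th power 1; as a power of p other
        than p^(i+1), q divides p^i, which contradicts the choice of x.\<close>
      moreover define q where "q = gcd (l - k) ?n"
      ultimately have "q \<noteq> ?n" by (metis gcd_dvd1)
      moreover obtain j where j: "j \<le> Suc i" "q = p ^ j"
        using divides_primepow_nat[OF p, of q "Suc i"] by (auto simp: q_def)
      ultimately have "j \<le> i" by (cases "j = Suc i") auto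
      then have "q dvd p ^ i" unfolding j(2) by (rule le_imp_power_dvd)
      then obtain c where c: "p ^ i = q * c" by blast
      have "l - k \<noteq> 0" using kl by simp
      then obtain a b where ab: "(l - k) * a = ?n * b + q" unfolding q_def using bezout_nat by blast
      have "\<chi> x ^ q = \<chi> x ^ (?n * b + q)" using z1 by (simp add: power_add power_mult del: power_Suc)
      also have "\<dots> = 1" unfolding ab[symmetric] using 1 by (simp add: power_mult)
      finally have "\<chi> x ^ (p ^ i) = 1" unfolding c by (simp add: power_mult)
      then show False using x by simp
    qed
  qed
  have "(\<lambda>k. \<chi> x ^ k) ` {..<?n} = \<chi> ` carrier G"
  proof (rule card_subset_eq)
    show "finite (\<chi> ` carrier G)" using finite_carrier by simp
    show "(\<lambda>k. \<chi> x ^ k) ` {..<?n} \<subseteq> \<chi> ` carrier G"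
      using linear_character_pow[OF \<chi> x(1), symmetric] x(1) by auto
    show "card ((\<lambda>k. \<chi> x ^ k) ` {..<?n}) = card (\<chi> ` carrier G)"
      unfolding card_linear_values[OF \<chi>] i using card_image[OF inj] by simp
  qed
  then have ex: "\<exists>k. \<chi> g = \<chi> x ^ k" if "g \<in> carrier G" for g using that by blast
  have "\<exists>k. inv (x [^] (k::nat)) \<otimes> g \<in> character_kernel G \<chi>" if g: "g \<in> carrier G" for g
  proof -
    obtain k where k: "\<chi> g = \<chi> x ^ k" using ex[OF g] by blast
    have "\<chi> (inv (x [^] k) \<otimes> g) = \<chi> (inv (x [^] k)) * \<chi> (x [^] k)"
      using x g k linear_character_mult[OF \<chi>, of "inv (x [^] k)" g] linear_character_pow[OF \<chi> x(1)] by simp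
    also have "\<dots> = 1" using linear_character_inv_mult[OF \<chi>, of "x [^] k"] x by simp
    finally show ?thesis using x g by (intro exI[of _ k]) (simp add: linear_kernel_iff[OF \<chi>])
  qed
  then show ?thesis using that x by blast
qed

end

section \<open>Quotients and commutators\<close>

context finite_group
begin

section \<open>Quotient groups\<close>

lemma quotient_finite_group:
  assumes "N \<lhd> G"
  shows "finite_group (G Mod N)"
proof -
  interpret N: normal N G by (rule assms)
  interpret Q: group "G Mod N" by (rule N.factorgroup_is_group)
  show ?thesis
    using finite_carrier by unfold_locales (simp add: carrier_FactGroup)
qed

lemma quotient_hom:
  assumes "N \<lhd> G"
  shows "group_hom G (G Mod N) (\<lambda>g. N #> g)"
  using assms normal.r_coset_hom_Mod normal.factorgroup_is_group is_group
  by (auto simp: group_hom_def group_hom_axioms_def)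

lemma card_quotient: "card (carrier (G Mod N)) = index N"
  by (simp add: FactGroup_def index_def)

lemma coset_eq_self_iff:
  assumes "subgroup N G" "g \<in> carrier G"
  shows "N #> g = N \<longleftrightarrow> g \<in> N"
  using assms coset_join1 coset_join2 subgroup.subset by metis

lemma preimage_quotient:
  assumes N: "N \<lhd> G" and A: "subgroup A (G Mod N)"
  defines "P \<equiv> {g \<in> carrier G. N #> g \<in> A}"
  shows "subgroup P G" "N \<subseteq> P" "card P = card N * card A" "A \<lhd> G Mod N \<Longrightarrow> P \<lhd> G"
proof -
  interpret N: normal N G by (rule N)
  have P: "P = \<Union>A" unfolding P_def N.factgroup_subgroup_union_char[OF A] ..
  show s: "subgroup P G" unfolding P by (rule N.factgroup_subgroup_union_subgroup[OF A])
  show "A \<lhd> G Mod N \<Longrightarrow> P \<lhd> G" unfolding P by (rule N.factgroup_subgroup_union_normal)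
  have NA: "N \<in> A" using subgroup.one_closed[OF A] by simp
  then show "N \<subseteq> P" unfolding P by blast
  have sub: "A \<subseteq> rcosets N" using subgroup.subset[OF A] by (simp add: FactGroup_def)
  have "card N * card A = card (\<Union>A)"
  proof (rule card_partition)
    show "finite (\<Union>A)" using finite_subgroup[OF s] P by simp
    then show "finite A" by (rule finite_UnionD)
    show "card c = card N" if "c \<in> A" for c
      using card_rcosets_equal[of c N, OF _ N.subset] that sub by auto
    show "c1 \<inter> c2 = {}" if "c1 \<in> A" "c2 \<in> A" "c1 \<noteq> c2" for c1 c2
      using rcos_disjoint[OF N.subgroup_axioms] that sub unfolding pairwise_def disjnt_def by blast
  qed
  then show "card P = card N * card A" using P by simp
qed

lemma card_image_quotient:
  assumes N: "N \<lhd> G" and K: "subgroup K G" and NK: "N \<subseteq> K"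
  shows "subgroup ((\<lambda>g. N #> g) ` K) (G Mod N)"
    and "{g \<in> carrier G. N #> g \<in> (\<lambda>g. N #> g) ` K} = K"
    and "card K = card N * card ((\<lambda>g. N #> g) ` K)"
proof -
  interpret \<pi>: group_hom G "G Mod N" "\<lambda>g. N #> g" by (rule quotient_hom[OF N])
  interpret N: normal N G by (rule N)
  show s: "subgroup ((\<lambda>g. N #> g) ` K) (G Mod N)" by (rule \<pi>.subgroup_img_is_subgroup[OF K])
  show e: "{g \<in> carrier G. N #> g \<in> (\<lambda>g. N #> g) ` K} = K"
  proof
    show "K \<subseteq> {g \<in> carrier G. N #> g \<in> (\<lambda>g. N #> g) ` K}" using subgroup.subset[OF K] by blast
    show "{g \<in> carrier G. N #> g \<in> (\<lambda>g. N #> g) ` K} \<subseteq> K"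
    proof
      fix g assume "g \<in> {g \<in> carrier G. N #> g \<in> (\<lambda>g. N #> g) ` K}"
      then obtain k where g: "g \<in> carrier G" and k: "k \<in> K" "N #> g = N #> k" by blast
      have "g \<in> N #> k" using rcos_self[OF g N.subgroup_axioms] k(2) by simp
      then obtain n where "n \<in> N" "g = n \<otimes> k" by (auto simp: r_coset_def)
      then show "g \<in> K" using NK k(1) subgroup.m_closed[OF K] by blast
    qed
  qed
  show "card K = card N * card ((\<lambda>g. N #> g) ` K)"
    using preimage_quotient(3)[OF N s] e by simp
qed

lemma derived_quotient:
  assumes N: "N \<lhd> G"
  shows "derived (G Mod N) (carrier (G Mod N)) = (\<lambda>g. N #> g) ` derived G (carrier G)"
proof -
  interpret \<pi>: group_hom G "G Mod N" "\<lambda>g. N #> g" by (rule quotient_hom[OF N])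
  show ?thesis using \<pi>.derived_img[of "carrier G"] by (simp add: carrier_FactGroup)
qed

section \<open>Commuting generators and powers of commutators\<close>

lemma generated_by_commuting:
  assumes S: "S \<subseteq> carrier G" and a: "a \<in> carrier G" and comm: "\<And>s. s \<in> S \<Longrightarrow> a \<otimes> s = s \<otimes> a"
    and g: "g \<in> generate G S"
  shows "a \<otimes> g = g \<otimes> a"
  using g
proof (induction g rule: generate.induct)
  case (inv h)
  then have h: "h \<in> carrier G" "a \<otimes> h = h \<otimes> a" using S comm by auto
  have "a \<otimes> inv h = inv h \<otimes> (h \<otimes> a) \<otimes> inv h" using h a by (simp add: m_assoc[symmetric])
  also have "\<dots> = inv h \<otimes> (a \<otimes> h) \<otimes> inv h" using h by simp
  also have "\<dots> = inv h \<otimes> a" using h(1) a by (simp add: m_assoc)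
  finally show ?case .
next
  case (eng h1 h2)
  then have h: "h1 \<in> carrier G" "h2 \<in> carrier G" using generate_in_carrier[OF S] by auto
  have "a \<otimes> (h1 \<otimes> h2) = h1 \<otimes> a \<otimes> h2" using h a eng by (simp add: m_assoc[symmetric])
  also have "\<dots> = h1 \<otimes> h2 \<otimes> a" using h a eng by (simp add: m_assoc)
  finally show ?case .
qed (use a comm in auto)

lemma comm_group_of_commuting_generators:
  assumes S: "S \<subseteq> carrier G" "generate G S = carrier G"
    and comm: "\<And>s t. s \<in> S \<Longrightarrow> t \<in> S \<Longrightarrow> s \<otimes> t = t \<otimes> s"
  shows "comm_group G"
proof (rule group_comm_groupI)
  fix g h assume g: "g \<in> carrier G" and h: "h \<in> carrier G"
  have "s \<otimes> g' = g' \<otimes> s" if "s \<in> S" "g' \<in> carrier G" for s g'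
    using generated_by_commuting[OF S(1), of s g'] that S comm by auto
  then show "g \<otimes> h = h \<otimes> g"
    using generated_by_commuting[OF S(1) g, of h] S(2) h g by metis
qed

lemma generate_powers_normal:
  assumes w: "w \<in> carrier G" and central: "\<And>g. g \<in> carrier G \<Longrightarrow> w \<otimes> g = g \<otimes> w"
  shows "generate G {w} \<lhd> G"
  unfolding normal_inv_iff
proof (intro conjI ballI)
  show "subgroup (generate G {w}) G" using w by (intro generate_is_subgroup) simp
  fix g h assume g: "g \<in> carrier G" and h: "h \<in> generate G {w}"
  then have hG: "h \<in> carrier G" using generate_in_carrier w by blast
  have "g \<otimes> h = h \<otimes> g" using generated_by_commuting[of "{w}" g h] g h w central by auto
  then have "g \<otimes> h \<otimes> inv g = h" using g hG by (simp add: m_assoc)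
  then show "g \<otimes> h \<otimes> inv g \<in> generate G {w}" using h by simp
qed

lemma generate_eq_powers: "w \<in> carrier G \<Longrightarrow> generate G {w} = {w [^] k | k :: nat. True}"
  using generate_pow_on_finite_carrier[OF finite_carrier] by blast

lemma card_generate_dvd:
  assumes "w \<in> carrier G" "w [^] (m :: nat) = \<one>"
  shows "card (generate G {w}) dvd m"
  using assms generate_pow_card[of w] pow_eq_id[of w m] by simp

text \<open>This is [x^k, y] = [x, y]^k. A commutator is represented as the factor c in x y = c y x,
  and c is assumed to commute with x only.\<close>

lemma commutator_pow_left:
  assumes x: "x \<in> carrier G" and y: "y \<in> carrier G" and c: "c \<in> carrier G"
    and eq: "x \<otimes> y = c \<otimes> (y \<otimes> x)" and comm: "x \<otimes> c = c \<otimes> x"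
  shows "x [^] (k :: nat) \<otimes> y = c [^] k \<otimes> (y \<otimes> x [^] k)"
proof (induction k)
  case (Suc k)
  have ck: "x \<otimes> c [^] k = c [^] k \<otimes> x" using group_commutes_pow[of c x k] comm c x by simp
  have "x [^] Suc k \<otimes> y = x \<otimes> (x [^] k \<otimes> y)" unfolding nat_pow_Suc2[OF x] using x y by (simp add: m_assoc)
  also have "\<dots> = x \<otimes> c [^] k \<otimes> (y \<otimes> x [^] k)" using Suc x y c by (simp add: m_assoc)
  also have "\<dots> = c [^] k \<otimes> (x \<otimes> y) \<otimes> x [^] k" unfolding ck using x y c by (simp add: m_assoc)
  also have "\<dots> = c [^] k \<otimes> c \<otimes> (y \<otimes> (x \<otimes> x [^] k))" unfolding eq using x y c by (simp add: m_assoc)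
  also have "\<dots> = c [^] Suc k \<otimes> (y \<otimes> x [^] Suc k)" unfolding nat_pow_Suc2[OF x] by simp
  finally show ?case .
qed (use x y in simp)

lemma commutator_pow_right:
  assumes x: "x \<in> carrier G" and y: "y \<in> carrier G" and c: "c \<in> carrier G"
    and eq: "x \<otimes> y = c \<otimes> (y \<otimes> x)" and comm: "y \<otimes> c = c \<otimes> y"
  shows "x \<otimes> y [^] (k :: nat) = c [^] k \<otimes> (y [^] k \<otimes> x)"
proof (induction k)
  case (Suc k)
  have ck: "y [^] k \<otimes> c = c \<otimes> y [^] k" using group_commutes_pow[of y c k] comm c y by simp
  have "x \<otimes> y [^] Suc k = (x \<otimes> y [^] k) \<otimes> y" using x y by (simp add: m_assoc)
  also have "\<dots> = c [^] k \<otimes> (y [^] k \<otimes> (x \<otimes> y))" using Suc x y c by (simp add: m_assoc)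
  also have "\<dots> = c [^] k \<otimes> ((y [^] k \<otimes> c) \<otimes> (y \<otimes> x))" unfolding eq using x y c by (simp add: m_assoc)
  also have "\<dots> = c [^] k \<otimes> c \<otimes> (y [^] k \<otimes> y \<otimes> x)" unfolding ck using x y c by (simp add: m_assoc)
  finally show ?case by simp
qed (use x y in simp)

lemma ex_commutator:
  assumes "x \<in> carrier G" "y \<in> carrier G"
  shows "\<exists>c\<in>derived G (carrier G). x \<otimes> y = c \<otimes> (y \<otimes> x)"
proof
  show "x \<otimes> y \<otimes> inv x \<otimes> inv y \<in> derived G (carrier G)"
    unfolding derived_def using assms by (intro generate.incl) auto
  have "inv y \<otimes> (y \<otimes> x) = x" using assms by (simp add: m_assoc[symmetric])
  then show "x \<otimes> y = x \<otimes> y \<otimes> inv x \<otimes> inv y \<otimes> (y \<otimes> x)" using assms by (simp add: m_assoc)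
qed

text \<open>Commutators of generators other than c and its inverse are trivial, and c is central, so
  G/<c> is abelian. Moreover c^p = [x, y^p] = 1.\<close>

lemma card_derived_dvd:
  assumes x: "x \<in> carrier G" and y: "y \<in> carrier G" and Z: "Z \<subseteq> carrier G"
    and gen: "generate G (insert x (insert y Z)) = carrier G"
    and central: "\<And>z g. z \<in> Z \<Longrightarrow> g \<in> carrier G \<Longrightarrow> z \<otimes> g = g \<otimes> z"
    and c: "c \<in> carrier G" "x \<otimes> y = c \<otimes> (y \<otimes> x)"
    and cx: "c \<otimes> x = x \<otimes> c" and cy: "c \<otimes> y = y \<otimes> c"
    and yp: "x \<otimes> y [^] (p :: nat) = y [^] p \<otimes> x"
  shows "card (derived G (carrier G)) dvd p"
proof -
  let ?S = "insert x (insert y Z)"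
  have S: "?S \<subseteq> carrier G" using x y Z by simp
  have cS: "c \<otimes> s = s \<otimes> c" if "s \<in> ?S" for s
    using that cx cy central[OF _ c(1)] by (elim insertE) simp_all
  have cc: "c \<otimes> g = g \<otimes> c" if "g \<in> carrier G" for g
    using generated_by_commuting[OF S c(1) cS, of g] that gen by simp
  have "c [^] p \<otimes> (y [^] p \<otimes> x) = \<one> \<otimes> (y [^] p \<otimes> x)"
    using commutator_pow_right[OF x y c cy[symmetric], of p] yp x y by simp
  then have cp: "c [^] p = \<one>" using x y c(1) by (metis m_closed nat_pow_closed one_closed right_cancel)
  let ?N = "generate G {c}"
  have N: "?N \<lhd> G" by (rule generate_powers_normal[OF c(1) cc])
  have xy: "?N #> (x \<otimes> y) = ?N #> (y \<otimes> x)"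
  proof -
    have NG: "?N \<subseteq> carrier G" by (rule subgroup.subset[OF normal_imp_subgroup[OF N]])
    have "?N #> c = ?N" using c(1) generate.incl[of c "{c}" G]
      by (intro coset_join2 generate_is_subgroup) auto
    then show ?thesis using coset_mult_assoc[OF NG c(1), of "y \<otimes> x"] c(2) x y by simp
  qed
  have "s \<otimes> t = t \<otimes> s \<or> s = x \<and> t = y \<or> s = y \<and> t = x" if "s \<in> ?S" "t \<in> ?S" for s t
    using that central x y Z by (metis insertE subsetD)
  then have commS: "?N #> (s \<otimes> t) = ?N #> (t \<otimes> s)" if "s \<in> ?S" "t \<in> ?S" for s t
    using that xy by metis
  interpret \<pi>: group_hom G "G Mod ?N" "\<lambda>g. ?N #> g" by (rule quotient_hom[OF N])
  interpret Q: finite_group "G Mod ?N" by (rule quotient_finite_group[OF N])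
  have "comm_group (G Mod ?N)"
  proof (rule Q.comm_group_of_commuting_generators)
    show "(\<lambda>g. ?N #> g) ` ?S \<subseteq> carrier (G Mod ?N)" using S \<pi>.hom_closed by blast
    show "generate (G Mod ?N) ((\<lambda>g. ?N #> g) ` ?S) = carrier (G Mod ?N)"
      using \<pi>.generate_img[OF S] gen by (simp add: carrier_FactGroup)
    fix s t assume "s \<in> (\<lambda>g. ?N #> g) ` ?S" "t \<in> (\<lambda>g. ?N #> g) ` ?S"
    then obtain s' t' where st: "s' \<in> ?S" "t' \<in> ?S" "s = ?N #> s'" "t = ?N #> t'" by blast
    then have c': "s' \<in> carrier G" "t' \<in> carrier G" using S by blast+
    show "s \<otimes>\<^bsub>G Mod ?N\<^esub> t = t \<otimes>\<^bsub>G Mod ?N\<^esub> s"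
      unfolding st(3,4) \<pi>.hom_mult[OF c', symmetric] \<pi>.hom_mult[OF c'(2,1), symmetric] by (rule commS[OF st(1,2)])
  qed
  then have "derived G (carrier G) \<subseteq> ?N" by (rule derived_minimal[OF N])
  then have "card (derived G (carrier G)) dvd card ?N"
    by (intro card_subgroup_dvd derived_is_subgroup normal_imp_subgroup[OF N]) auto
  also have "card ?N dvd p" by (rule card_generate_dvd[OF c(1) cp])
  finally show ?thesis .
qed

section \<open>The class equation\<close>

lemma card_orbit_conjugation_dvd:
  assumes x: "x \<in> carrier G"
  shows "card {g \<otimes> x \<otimes> inv g | g. g \<in> carrier G} dvd card (carrier G)"
proof -
  interpret A: group_action G "carrier G" "\<lambda>g. \<lambda>h\<in>carrier G. g \<otimes> h \<otimes> inv g" by (rule action_by_conjugation)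
  have eq: "orbit G (\<lambda>g. \<lambda>h\<in>carrier G. g \<otimes> h \<otimes> inv g) x = {g \<otimes> x \<otimes> inv g | g. g \<in> carrier G}"
    unfolding orbit_def using x by simp
  from A.orbit_stabilizer_theorem[OF x, symmetric, unfolded Coset.order_def eq] show ?thesis by (rule dvdI)
qed

text \<open>The conjugacy classes inside M have p-power size, so if only the identity were central,
  |M| would be 1 modulo p, although p divides |M|.\<close>

lemma p_group_central_element:
  assumes p: "prime p" and G: "card (carrier G) = p ^ k" and M: "M \<lhd> G" "M \<noteq> {\<one>}"
  shows "\<exists>z\<in>M. z \<noteq> \<one> \<and> (\<forall>g\<in>carrier G. z \<otimes> g = g \<otimes> z)"
proof (rule ccontr)
  assume no: "\<not> ?thesis"
  interpret M: normal M G by (rule M(1))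
  define orb where "orb x = {g \<otimes> x \<otimes> inv g | g. g \<in> carrier G}" for x
  have self: "x \<in> orb x" if "x \<in> M" for x
  proof -
    have "x = \<one> \<otimes> x \<otimes> inv \<one>" using that M.mem_carrier by simp
    then show ?thesis unfolding orb_def by blast
  qed
  have sub: "orb x \<subseteq> M" if "x \<in> M" for x using that M.inv_op_closed2 by (auto simp: orb_def)
  have eq: "orb y = orb x" if y: "y \<in> orb x" and xM: "x \<in> M" for x y
  proof -
    have x: "x \<in> carrier G" using xM M.mem_carrier by simp
    obtain g where g: "g \<in> carrier G" "y = g \<otimes> x \<otimes> inv g" using y unfolding orb_def by blast
    have 1: "orb y \<subseteq> orb x"
    proof
      fix t assume "t \<in> orb y"
      then obtain h where h: "h \<in> carrier G" "t = h \<otimes> y \<otimes> inv h" unfolding orb_def by blast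
      have "t = (h \<otimes> g) \<otimes> x \<otimes> inv (h \<otimes> g)" using h g x by (simp add: m_assoc inv_mult_group)
      moreover have "h \<otimes> g \<in> carrier G" using h g by simp
      ultimately show "t \<in> orb x" unfolding orb_def by blast
    qed
    have 2: "orb x \<subseteq> orb y"
    proof
      fix t assume "t \<in> orb x"
      then obtain h where h: "h \<in> carrier G" "t = h \<otimes> x \<otimes> inv h" unfolding orb_def by blast
      have "inv g \<otimes> (g \<otimes> u) = u" if "u \<in> carrier G" for u using that g by (simp add: m_assoc[symmetric])
      then have "t = (h \<otimes> inv g) \<otimes> y \<otimes> inv (h \<otimes> inv g)" using h g x by (simp add: m_assoc inv_mult_group)
      moreover have "h \<otimes> inv g \<in> carrier G" using h g by simp
      ultimately show "t \<in> orb y" unfolding orb_def by blast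
    qed
    show ?thesis using 1 2 by blast
  qed
  have disj: "pairwise disjnt (orb ` M)"
    using eq unfolding pairwise_def disjnt_def by blast
  have un: "\<Union> (orb ` M) = M" using self sub by blast
  have finM: "finite M" using finite_subgroup M.subgroup_axioms by blast
  have one: "orb \<one> = {\<one>}" unfolding orb_def by (auto intro!: exI[of _ \<one>])
  have big: "p dvd card (orb x)" if x: "x \<in> M" "orb x \<noteq> {\<one>}" for x
  proof -
    have xG: "x \<in> carrier G" using x M.mem_carrier by simp
    obtain j where j: "card (orb x) = p ^ j"
      using card_orbit_conjugation_dvd[OF xG] divides_primepow_nat[OF p] unfolding orb_def G by blast
    have "j \<noteq> 0"
    proof
      assume "j = 0"
      then have "card (orb x) = 1" using j by simp
      then have o: "orb x = {x}" using self[OF x(1)] by (metis card_1_singletonE singletonD)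
      have "x \<otimes> g = g \<otimes> x" if g: "g \<in> carrier G" for g
      proof -
        have "g \<otimes> x \<otimes> inv g = x" using o g unfolding orb_def by blast
        then have "x \<otimes> g = g \<otimes> x \<otimes> inv g \<otimes> g" by simp
        then show ?thesis using g xG by (simp add: m_assoc)
      qed
      moreover have "x \<noteq> \<one>" using x(2) one by blast
      ultimately show False using no x(1) by blast
    qed
    then show ?thesis using j by (simp add: dvd_power)
  qed
  have "card M = card (\<Union> (orb ` M))" using un by simp
  also have "\<dots> = (\<Sum>o'\<in>orb ` M. card o')"
    using disj finite_subset[OF sub finM] by (intro card_Union_disjoint) auto
  also have "\<dots> = card (orb \<one>) + (\<Sum>o'\<in>orb ` M - {orb \<one>}. card o')"
    using finM M.one_closed by (intro sum.remove) auto
  also have "card (orb \<one>) = 1" using one by simp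
  finally have cM: "card M = 1 + (\<Sum>o'\<in>orb ` M - {orb \<one>}. card o')" .
  have "p dvd (\<Sum>o'\<in>orb ` M - {orb \<one>}. card o')"
    using big one by (intro dvd_sum) auto
  moreover have "p dvd card M"
  proof -
    have "card M dvd p ^ k" using card_subgroup_dvd[OF M.subgroup_axioms subgroup_self M.subset] G by simp
    then obtain j where j: "card M = p ^ j" using divides_primepow_nat[OF p] by blast
    have "j \<noteq> 0"
    proof
      assume "j = 0"
      then have "card M = 1" using j by simp
      then show False using M(2) M.one_closed by (metis card_1_singletonE singletonD)
    qed
    then show ?thesis using j by (simp add: dvd_power)
  qed
  ultimately have "p dvd 1" unfolding cM by (metis dvd_add_left_iff)
  then show False using p by simp
qed

end

section \<open>Groups of prime power order\<close>

context finite_group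
begin

section \<open>Sections of order p in p-groups\<close>

lemma subgroup_nat_pow_closed:
  assumes "subgroup H G" "h \<in> H"
  shows "h [^] (k :: nat) \<in> H"
  by (induction k) (simp_all add: assms subgroup.one_closed subgroup.m_closed)

lemma coset_eq_iff:
  assumes N: "N \<lhd> G" and "a \<in> carrier G" "b \<in> carrier G"
  shows "N #> a = N #> b \<longleftrightarrow> a \<otimes> inv b \<in> N"
proof -
  interpret N: normal N G by (rule N)
  show ?thesis
    using N.rcos_module[OF is_group assms(3,2)] repr_independence[OF _ assms(3) N.subgroup_axioms]
      rcos_self[OF assms(2) N.subgroup_axioms] by metis
qed

lemma normal_image_quotient:
  assumes N: "N \<lhd> G" and M: "M \<lhd> G"
  shows "(\<lambda>g. N #> g) ` M \<lhd> G Mod N"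
proof -
  interpret M: normal M G by (rule M)
  interpret \<pi>: group_hom G "G Mod N" "\<lambda>g. N #> g" by (rule quotient_hom[OF N])
  show ?thesis
    unfolding \<pi>.H.normal_inv_iff
  proof (intro conjI ballI)
    show "subgroup ((\<lambda>g. N #> g) ` M) (G Mod N)" by (rule \<pi>.subgroup_img_is_subgroup[OF M.subgroup_axioms])
    fix h m assume "h \<in> carrier (G Mod N)" "m \<in> (\<lambda>g. N #> g) ` M"
    then obtain g k where g: "g \<in> carrier G" "h = N #> g" and k: "k \<in> M" "m = N #> k"
      by (auto simp: carrier_FactGroup)
    have kG: "k \<in> carrier G" using k M.mem_carrier by simp
    have "h \<otimes>\<^bsub>G Mod N\<^esub> m \<otimes>\<^bsub>G Mod N\<^esub> inv\<^bsub>G Mod N\<^esub> h = N #> (g \<otimes> k \<otimes> inv g)"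
      unfolding g(2) k(2) \<pi>.hom_inv[OF g(1), symmetric] \<pi>.hom_mult[OF g(1) kG, symmetric]
      by (rule \<pi>.hom_mult[symmetric]) (use g kG in simp_all)
    then show "h \<otimes>\<^bsub>G Mod N\<^esub> m \<otimes>\<^bsub>G Mod N\<^esub> inv\<^bsub>G Mod N\<^esub> h \<in> (\<lambda>g. N #> g) ` M"
      using M.inv_op_closed2[OF g(1) k(1)] by simp
  qed
qed

lemma p_group_quotient:
  assumes "prime p" "card (carrier G) = p ^ k" "N \<lhd> G"
  shows "\<exists>j. card (carrier (G Mod N)) = p ^ j"
  using index_mult_card[OF normal_imp_subgroup[OF assms(3)]] divides_primepow_nat[OF assms(1)] card_quotient assms(2)
  by (metis dvd_triv_left)

text \<open>Lagrange's theorem in K/N.\<close>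

lemma pow_mem_of_card:
  assumes N: "N \<lhd> G" and K: "subgroup K G" "N \<subseteq> K" and c: "card K = m * card N" and g: "g \<in> K"
  shows "g [^] m \<in> N"
proof -
  interpret Q: finite_group "G Mod N" by (rule quotient_finite_group[OF N])
  interpret \<pi>: group_hom G "G Mod N" "\<lambda>g. N #> g" by (rule quotient_hom[OF N])
  let ?K = "(\<lambda>g. N #> g) ` K"
  note im = card_image_quotient[OF N K]
  have gG: "g \<in> carrier G" using g subgroup.subset[OF K(1)] by blast
  have "card ?K = m" using im(3) c card_subgroup_pos[OF normal_imp_subgroup[OF N]] by simp
  moreover have "card (generate (G Mod N) {N #> g}) dvd card ?K"
    using g gG by (intro Q.card_subgroup_dvd Q.generate_is_subgroup im(1) Q.generate_subgroup_incl) auto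
  ultimately have "(N #> g) [^]\<^bsub>G Mod N\<^esub> m = \<one>\<^bsub>G Mod N\<^esub>"
    using Q.pow_eq_id[of "N #> g" m] Q.generate_pow_card[of "N #> g"] \<pi>.hom_closed[OF gG] by simp
  then have "N #> (g [^] m) = N" using normal.FactGroup_pow[OF N gG] by simp
  then show ?thesis using coset_eq_self_iff[OF normal_imp_subgroup[OF N]] gG by simp
qed

text \<open>M/K contains a nontrivial element that is central in G/K and, being of order p, is
  generated by it.\<close>

lemma p_group_section_central:
  assumes p: "prime p" "card (carrier G) = p ^ k"
    and K: "K \<lhd> G" and M: "M \<lhd> G" and KM: "K \<subseteq> M" and c: "card M = p * card K"
    and m: "m \<in> M" and g: "g \<in> carrier G"
  shows "K #> (m \<otimes> g) = K #> (g \<otimes> m)"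
proof -
  interpret Q: finite_group "G Mod K" by (rule quotient_finite_group[OF K])
  interpret \<pi>: group_hom G "G Mod K" "\<lambda>g. K #> g" by (rule quotient_hom[OF K])
  let ?M = "(\<lambda>g. K #> g) ` M"
  note im = card_image_quotient[OF K normal_imp_subgroup[OF M] KM]
  obtain j where j: "card (carrier (G Mod K)) = p ^ j" using p_group_quotient[OF p K] by blast
  have cM: "card ?M = p" using im(3) c card_subgroup_pos[OF normal_imp_subgroup[OF K]] by simp
  have "?M \<noteq> {\<one>\<^bsub>G Mod K\<^esub>}"
  proof
    assume "?M = {\<one>\<^bsub>G Mod K\<^esub>}"
    then have "card ?M = 1" by simp
    then show False using cM prime_gt_1_nat[OF p(1)] by simp
  qed
  then obtain z where z: "z \<in> ?M" "z \<noteq> \<one>\<^bsub>G Mod K\<^esub>"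
    "\<And>h. h \<in> carrier (G Mod K) \<Longrightarrow> z \<otimes>\<^bsub>G Mod K\<^esub> h = h \<otimes>\<^bsub>G Mod K\<^esub> z"
    using Q.p_group_central_element[OF p(1) j normal_image_quotient[OF K M]] by blast
  have zc: "z \<in> carrier (G Mod K)" using z(1) subgroup.subset[OF im(1)] by blast
  let ?Z = "generate (G Mod K) {z}"
  have Z: "subgroup ?Z (G Mod K)" using zc by (intro Q.generate_is_subgroup) simp
  have ZM: "?Z \<subseteq> ?M" using z(1) by (intro Q.generate_subgroup_incl im(1)) simp
  have "card ?Z dvd p" using Q.card_subgroup_dvd[OF Z im(1) ZM] cM by simp
  moreover have "card ?Z \<noteq> 1"
  proof
    assume "card ?Z = 1"
    then obtain a where "?Z = {a}" by (auto simp: card_1_singleton_iff)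
    then show False using z(2) generate.incl[of z "{z}" "G Mod K"] subgroup.one_closed[OF Z] by auto
  qed
  ultimately have "card ?Z = p" using p(1) by (metis prime_nat_iff)
  then have "?Z = ?M" using ZM cM card_subset_eq[OF Q.finite_subgroup[OF im(1)]] by metis
  then have mZ: "K #> m \<in> ?Z" using m by blast
  have mG: "m \<in> carrier G" using m subgroup.subset[OF normal_imp_subgroup[OF M]] by blast
  have gQ: "K #> g \<in> carrier (G Mod K)" using g by (rule \<pi>.hom_closed)
  have "(K #> g) \<otimes>\<^bsub>G Mod K\<^esub> (K #> m) = (K #> m) \<otimes>\<^bsub>G Mod K\<^esub> (K #> g)"
    using Q.generated_by_commuting[of "{z}" "K #> g" "K #> m"] zc z(3)[OF gQ] mZ gQ by simp
  then show ?thesis using \<pi>.hom_mult[OF g mG] \<pi>.hom_mult[OF mG g] by simp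
qed

text \<open>For N of maximal order among the normal subgroups properly inside M, M/N contains an
  element w of order p that is central in G/N; the preimage of <w> is normal and lies strictly above
  N, so it is M.\<close>

lemma p_group_normal_index_p:
  assumes p: "prime p" "card (carrier G) = p ^ k" and M: "M \<lhd> G" "M \<noteq> {\<one>}"
  shows "\<exists>N. N \<lhd> G \<and> N \<subseteq> M \<and> card M = p * card N"
proof -
  note Ms = normal_imp_subgroup[OF M(1)]
  let ?S = "{N. N \<lhd> G \<and> N \<subset> M}"
  have "finite ?S" using finite_subgroup[OF Ms] by (auto intro: finite_subset[of _ "Pow M"])
  moreover have "{\<one>} \<in> ?S" using one_is_normal M(2) subgroup.one_closed[OF Ms] by auto
  ultimately have fin: "finite (card ` ?S)" and "card ` ?S \<noteq> {}" by auto
  from Max_in[OF this] obtain N where N: "Max (card ` ?S) = card N" "N \<in> ?S" by (rule imageE)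
  have max: "card N' \<le> card N" if "N' \<in> ?S" for N'
    unfolding N(1)[symmetric] by (rule Max_ge[OF fin imageI[OF that]])
  have NG: "N \<lhd> G" and NM: "N \<subset> M" using N(2) by auto
  interpret Q: finite_group "G Mod N" by (rule quotient_finite_group[OF NG])
  interpret \<pi>: group_hom G "G Mod N" "\<lambda>g. N #> g" by (rule quotient_hom[OF NG])
  note im = card_image_quotient[OF NG Ms psubset_imp_subset[OF NM]]
  let ?M = "(\<lambda>g. N #> g) ` M"
  obtain j where j: "card (carrier (G Mod N)) = p ^ j" using p_group_quotient[OF p NG] by blast
  have ne: "?M \<noteq> {\<one>\<^bsub>G Mod N\<^esub>}"
  proof
    assume "?M = {\<one>\<^bsub>G Mod N\<^esub>}"
    then have "card M = card N" using im(3) by simp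
    then show False using NM finite_subgroup[OF Ms] psubset_card_mono by (metis nat_neq_iff)
  qed
  obtain z where z: "z \<in> ?M" "z \<noteq> \<one>\<^bsub>G Mod N\<^esub>"
    "\<And>h. h \<in> carrier (G Mod N) \<Longrightarrow> z \<otimes>\<^bsub>G Mod N\<^esub> h = h \<otimes>\<^bsub>G Mod N\<^esub> z"
    using Q.p_group_central_element[OF p(1) j normal_image_quotient[OF NG M(1)] ne] by blast
  have zc: "z \<in> carrier (G Mod N)" using z(1) subgroup.subset[OF im(1)] by blast
  have "group.ord (G Mod N) z dvd p ^ j" using Q.ord_dvd_group_order[OF zc] j by (simp add: Coset.order_def)
  then obtain r where r: "group.ord (G Mod N) z = p ^ r" using divides_primepow_nat[OF p(1)] by blast
  have "r \<noteq> 0" using r z(2) Q.ord_eq_1[OF zc] by (metis power_0)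
  then obtain s where s: "r = Suc s" by (cases r) auto
  \<comment> \<open>The last nontrivial iterated p-th power of z, which has order exactly p and is
    still central.\<close>
  define w where "w = z [^]\<^bsub>G Mod N\<^esub> (p ^ s)"
  have wc: "w \<in> carrier (G Mod N)" unfolding w_def using zc by simp
  have w1: "w \<noteq> \<one>\<^bsub>G Mod N\<^esub>"
    unfolding w_def Q.pow_eq_id[OF zc] r s using prime_gt_1_nat[OF p(1)] by (auto dest!: dvd_imp_le)
  have wp: "w [^]\<^bsub>G Mod N\<^esub> p = \<one>\<^bsub>G Mod N\<^esub>"
    unfolding w_def using zc Q.pow_eq_id[OF zc, of "p ^ s * p"] r s by (simp add: Q.nat_pow_pow mult.commute)
  let ?H = "generate (G Mod N) {w}"
  have wM: "w \<in> ?M"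
  proof -
    have "generate (G Mod N) {z} \<subseteq> ?M" using z(1) by (intro Q.generate_subgroup_incl im(1)) simp
    then show ?thesis using Q.generate_eq_powers[OF zc] unfolding w_def by blast
  qed
  have wcen: "w \<otimes>\<^bsub>G Mod N\<^esub> h = h \<otimes>\<^bsub>G Mod N\<^esub> w" if "h \<in> carrier (G Mod N)" for h
    unfolding w_def using Q.group_commutes_pow[OF z(3)[OF that] zc that] .
  have H: "?H \<lhd> G Mod N" by (rule Q.generate_powers_normal[OF wc wcen])
  note Hs = normal_imp_subgroup[OF H]
  have "card ?H dvd p" by (rule Q.card_generate_dvd[OF wc wp])
  moreover have "card ?H \<noteq> 1" using Q.generate_pow_card[OF wc] Q.ord_eq_1[OF wc] w1 by simp
  ultimately have cH: "card ?H = p" using p(1) by (metis prime_nat_iff)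
  note pre = preimage_quotient[OF NG Hs]
  let ?P = "{g \<in> carrier G. N #> g \<in> ?H}"
  have PM: "?P \<subseteq> M"
  proof -
    have "?H \<subseteq> ?M" using wM by (intro Q.generate_subgroup_incl im(1)) simp
    then have "?P \<subseteq> {g \<in> carrier G. N #> g \<in> ?M}" by blast
    then show ?thesis unfolding im(2) .
  qed
  have cP: "card ?P = card N * p" using pre(3) cH by simp
  have "?P = M"
  proof (rule ccontr)
    assume "?P \<noteq> M"
    then have "?P \<in> ?S" using PM pre(4)[OF H] by blast
    then have "card ?P \<le> card N" by (rule max)
    then show False using cP card_subgroup_pos[OF normal_imp_subgroup[OF NG]] prime_gt_1_nat[OF p(1)] by simp
  qed
  then show ?thesis using NG NM cP by (intro exI[of _ N]) (auto simp: mult.commute)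
qed

section \<open>Derived subgroups of groups generated by two elements modulo them\<close>

lemma card_derived_dvd_mod:
  assumes L: "L \<lhd> G" and LD: "L \<subseteq> derived G (carrier G)"
    and "card (derived (G Mod L) (carrier (G Mod L))) dvd m"
  shows "card (derived G (carrier G)) dvd m * card L"
  using card_image_quotient(3)[OF L normal_imp_subgroup[OF normal_derived] LD] assms(3)
  unfolding derived_quotient[OF L] by (simp add: mult.commute)

text \<open>If \<open>G = \<langle>x, y\<rangle> D\<close> with \<open>y\<^sup>p \<in> D\<close>, then modulo the intersection \<open>L\<close> of two such subgroups
  the derived subgroup \<open>D\<close> is generated by the commutator of \<open>x\<close> and \<open>y\<close>, which has order \<open>p\<close>.\<close>

lemma derived_index_p_unique:
  fixes D defines "D \<equiv> derived G (carrier G)"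
  assumes p: "prime p" "card (carrier G) = p ^ k"
    and x: "x \<in> carrier G" and y: "y \<in> carrier G"
    and gen: "\<And>g. g \<in> carrier G \<Longrightarrow> \<exists>i j. \<exists>d\<in>D. g = x [^] (i :: nat) \<otimes> (y [^] (j :: nat) \<otimes> d)"
    and yp: "y [^] p \<in> D"
    and N: "N \<lhd> G" "N \<subseteq> D" "card D = p * card N"
    and N': "N' \<lhd> G" "N' \<subseteq> D" "card D = p * card N'"
  shows "N = N'"
proof -
  have D: "D \<lhd> G" unfolding D_def by (rule normal_derived)
  note Ds = normal_imp_subgroup[OF D]
  have DG: "d \<in> carrier G" if "d \<in> D" for d using that subgroup.subset[OF Ds] by blast
  define L where "L = N \<inter> N'"
  have L: "L \<lhd> G" unfolding L_def by (rule normal_subgroup_intersect[OF N(1) N'(1)])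
  \<comment> \<open>D/N and D/N' have order p and are central, so commutators of D with G lie in
    both N and N'.\<close>
  have cen: "L #> (d \<otimes> g) = L #> (g \<otimes> d)" if d: "d \<in> D" and g: "g \<in> carrier G" for d g
    using p_group_section_central[OF p N(1) D N(2,3) d g] p_group_section_central[OF p N'(1) D N'(2,3) d g]
      DG[OF d] g by (simp add: coset_eq_iff L N(1) N'(1)) (simp add: L_def)
  interpret Q: finite_group "G Mod L" by (rule quotient_finite_group[OF L])
  interpret \<pi>: group_hom G "G Mod L" "\<lambda>g. L #> g" by (rule quotient_hom[OF L])
  let ?Z = "(\<lambda>g. L #> g) ` D"
  have cenQ: "(L #> d) \<otimes>\<^bsub>G Mod L\<^esub> (L #> g) = (L #> g) \<otimes>\<^bsub>G Mod L\<^esub> (L #> d)"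
    if "d \<in> D" "g \<in> carrier G" for d g
    using cen[OF that] \<pi>.hom_mult[OF DG[OF that(1)] that(2)] \<pi>.hom_mult[OF that(2) DG[OF that(1)]] by simp
  obtain c where c: "c \<in> D" "x \<otimes> y = c \<otimes> (y \<otimes> x)" using ex_commutator[OF x y] unfolding D_def by blast
  let ?S = "insert (L #> x) (insert (L #> y) ?Z)"
  have Z: "?Z \<subseteq> carrier (G Mod L)" using DG \<pi>.hom_closed by blast
  have S: "?S \<subseteq> carrier (G Mod L)" using Z x y \<pi>.hom_closed by simp
  have "card (derived (G Mod L) (carrier (G Mod L))) dvd p"
  proof (rule Q.card_derived_dvd[where x = "L #> x" and y = "L #> y" and Z = ?Z and c = "L #> c"])
    interpret GS: subgroup "generate (G Mod L) ?S" "G Mod L" by (rule Q.generate_is_subgroup[OF S])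
    show "generate (G Mod L) ?S = carrier (G Mod L)"
    proof
      show "carrier (G Mod L) \<subseteq> generate (G Mod L) ?S"
      proof
        fix h assume "h \<in> carrier (G Mod L)"
        then obtain g where g: "g \<in> carrier G" "h = L #> g" by (auto simp: carrier_FactGroup)
        obtain i j :: nat and d where d: "d \<in> D" "g = x [^] i \<otimes> (y [^] j \<otimes> d)" using gen[OF g(1)] by blast
        have "h = (L #> x) [^]\<^bsub>G Mod L\<^esub> i \<otimes>\<^bsub>G Mod L\<^esub> ((L #> y) [^]\<^bsub>G Mod L\<^esub> j \<otimes>\<^bsub>G Mod L\<^esub> (L #> d))"
          unfolding g(2) d(2) using x y DG[OF d(1)] by (simp add: \<pi>.hom_nat_pow)
        moreover have "L #> x \<in> generate (G Mod L) ?S" "L #> y \<in> generate (G Mod L) ?S" "L #> d \<in> generate (G Mod L) ?S"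
          using d(1) by (auto intro: generate.incl)
        ultimately show "h \<in> generate (G Mod L) ?S"
          by (simp only: GS.m_closed Q.subgroup_nat_pow_closed[OF GS.subgroup_axioms])
      qed
    qed (rule GS.subset)
    show "z \<otimes>\<^bsub>G Mod L\<^esub> g = g \<otimes>\<^bsub>G Mod L\<^esub> z" if "z \<in> ?Z" "g \<in> carrier (G Mod L)" for z g
      using that cenQ by (auto simp: carrier_FactGroup)
    show "(L #> x) \<otimes>\<^bsub>G Mod L\<^esub> (L #> y) = (L #> c) \<otimes>\<^bsub>G Mod L\<^esub> ((L #> y) \<otimes>\<^bsub>G Mod L\<^esub> (L #> x))"
      using \<pi>.hom_mult[OF x y] \<pi>.hom_mult[OF y x] \<pi>.hom_mult[OF DG[OF c(1)], of "y \<otimes> x"] c(2) x y by simp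
    show "(L #> c) \<otimes>\<^bsub>G Mod L\<^esub> (L #> x) = (L #> x) \<otimes>\<^bsub>G Mod L\<^esub> (L #> c)" by (rule cenQ[OF c(1) x])
    show "(L #> c) \<otimes>\<^bsub>G Mod L\<^esub> (L #> y) = (L #> y) \<otimes>\<^bsub>G Mod L\<^esub> (L #> c)" by (rule cenQ[OF c(1) y])
    show "(L #> x) \<otimes>\<^bsub>G Mod L\<^esub> (L #> y) [^]\<^bsub>G Mod L\<^esub> p = (L #> y) [^]\<^bsub>G Mod L\<^esub> p \<otimes>\<^bsub>G Mod L\<^esub> (L #> x)"
      using cenQ[OF yp x] \<pi>.hom_nat_pow[OF y, of p] by simp
  qed (use x y DG[OF c(1)] \<pi>.hom_closed Z in auto)
  then have dv: "card D dvd p * card L"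
    using card_derived_dvd_mod[OF L] N(2) unfolding D_def L_def by blast
  \<comment> \<open>|D| divides p |L| whereas |D| = p |K|; so |K| divides |L| and K collapses to L.
    Both N and N' qualify as K.\<close>
  have le: "K = L" if K: "K \<lhd> G" "L \<subseteq> K" "card D = p * card K" for K
  proof -
    have "card K dvd card L" using dv K(3) prime_gt_0_nat[OF p(1)] by simp
    then have "card K \<le> card L" using card_subgroup_pos[OF normal_imp_subgroup[OF L]] by (rule dvd_imp_le)
    then show ?thesis using card_seteq[OF finite_subgroup[OF normal_imp_subgroup[OF K(1)]] K(2)] by simp
  qed
  show ?thesis using le[OF N(1) _ N(3)] le[OF N'(1) _ N'(3)] unfolding L_def by blast
qed

lemma mem_preimage_powers:
  assumes N: "N \<lhd> G" and x: "x \<in> carrier G" and d: "d \<in> carrier G" "N #> d \<in> generate (G Mod N) {N #> x}"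
  shows "\<exists>i. \<exists>n\<in>N. d = n \<otimes> x [^] (i :: nat)"
proof -
  interpret Q: finite_group "G Mod N" by (rule quotient_finite_group[OF N])
  interpret \<pi>: group_hom G "G Mod N" "\<lambda>g. N #> g" by (rule quotient_hom[OF N])
  obtain i :: nat where "N #> d = (N #> x) [^]\<^bsub>G Mod N\<^esub> i"
    using d(2) Q.generate_eq_powers[OF \<pi>.hom_closed[OF x]] by blast
  then have "N #> d = N #> x [^] i" using normal.FactGroup_pow[OF N x] by simp
  then have "d \<in> N #> x [^] i" using rcos_self[OF d(1) normal_imp_subgroup[OF N]] by simp
  then show ?thesis by (auto simp: r_coset_def)
qed

text \<open>\<open>star\<close> is what the codegrees provide, and \<open>xp\<close> holds when a is
  at least 2. As x^p is not in D, <x^p>N is larger than D and x^(p^2) is still outside N, so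
  \<open>star\<close> applies to both powers. The exponent p^2 is chosen because c in D satisfies
  c^(p^2) = 1 modulo L, where N/L has order p.\<close>

lemma derived_prime_order:
  fixes D defines "D \<equiv> derived G (carrier G)"
  assumes p: "prime p" "card (carrier G) = p ^ k"
    and x: "x \<in> carrier G" and y: "y \<in> carrier G"
    and gen: "\<And>g. g \<in> carrier G \<Longrightarrow> \<exists>i j. \<exists>d\<in>D. g = x [^] (i :: nat) \<otimes> (y [^] (j :: nat) \<otimes> d)"
    and yp: "y [^] p \<in> D" and xp: "x [^] p \<notin> D"
    and nonabelian: "D \<noteq> {\<one>}"
    and star: "\<And>N L. N \<lhd> G \<Longrightarrow> N \<subseteq> D \<Longrightarrow> card D = p * card N \<Longrightarrow> L \<lhd> G \<Longrightarrow> N \<subset> L \<Longrightarrow> D \<subseteq> L"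
  shows "card D = p"
proof (rule ccontr)
  assume cD: "card D \<noteq> p"
  have D: "D \<lhd> G" unfolding D_def by (rule normal_derived)
  note Ds = normal_imp_subgroup[OF D]
  have DG: "d \<in> carrier G" if "d \<in> D" for d using that subgroup.subset[OF Ds] by blast
  obtain N where N: "N \<lhd> G" "N \<subseteq> D" "card D = p * card N"
    using p_group_normal_index_p[OF p D nonabelian] by blast
  note Ns = normal_imp_subgroup[OF N(1)]
  have NG: "n \<in> carrier G" if "n \<in> N" for n using that N(2) DG by blast
  have "N \<noteq> {\<one>}" using cD N(3) by auto
  then obtain L where L: "L \<lhd> G" "L \<subseteq> N" "card N = p * card L"
    using p_group_normal_index_p[OF p N(1)] by blast
  note Ls = normal_imp_subgroup[OF L(1)]
  have fin_le: "A = B" if "subgroup B G" "A \<subseteq> B" "card B \<le> card A" for A B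
    using card_seteq[OF finite_subgroup[OF that(1)]] that by simp
  \<comment> \<open>\<open>p\<close>-th powers are central modulo \<open>N\<close>, so \<open>\<langle>x ^ p\<rangle> N\<close> is normal.\<close>
  have D_powers: "\<exists>i. \<exists>n\<in>N. d = n \<otimes> (x [^] (p * p)) [^] (i :: nat)" if d: "d \<in> D" for d
  proof -
    interpret Q: finite_group "G Mod N" by (rule quotient_finite_group[OF N(1)])
    interpret \<pi>: group_hom G "G Mod N" "\<lambda>g. N #> g" by (rule quotient_hom[OF N(1)])
    have xpc: "x [^] p \<in> carrier G" using x by simp
    define w where "w = N #> x [^] p"
    have w: "w \<in> carrier (G Mod N)" unfolding w_def by (rule \<pi>.hom_closed[OF xpc])
    \<comment> \<open>[x^p, g] = [x, g]^p modulo N, since D/N is central, and this is trivial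
      because D/N has order p.\<close>
    have cen: "w \<otimes>\<^bsub>G Mod N\<^esub> h = h \<otimes>\<^bsub>G Mod N\<^esub> w" if "h \<in> carrier (G Mod N)" for h
    proof -
      obtain g where g: "g \<in> carrier G" "h = N #> g" using \<open>h \<in> carrier (G Mod N)\<close> by (auto simp: carrier_FactGroup)
      obtain c where c: "c \<in> D" "x \<otimes> g = c \<otimes> (g \<otimes> x)" using ex_commutator[OF x g(1)] unfolding D_def by blast
      have cG: "c \<in> carrier G" by (rule DG[OF c(1)])
      have cp: "(N #> c) [^]\<^bsub>G Mod N\<^esub> p = \<one>\<^bsub>G Mod N\<^esub>"
        using pow_mem_of_card[OF N(1) Ds N(2,3) c(1)] normal.FactGroup_pow[OF N(1) cG, of p]
          coset_eq_self_iff[OF Ns, of "c [^] p"] cG by simp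
      have "(N #> x) [^]\<^bsub>G Mod N\<^esub> p \<otimes>\<^bsub>G Mod N\<^esub> (N #> g)
          = (N #> c) [^]\<^bsub>G Mod N\<^esub> p \<otimes>\<^bsub>G Mod N\<^esub> ((N #> g) \<otimes>\<^bsub>G Mod N\<^esub> (N #> x) [^]\<^bsub>G Mod N\<^esub> p)"
      proof (rule Q.commutator_pow_left)
        show "(N #> x) \<otimes>\<^bsub>G Mod N\<^esub> (N #> g) = (N #> c) \<otimes>\<^bsub>G Mod N\<^esub> ((N #> g) \<otimes>\<^bsub>G Mod N\<^esub> (N #> x))"
          using \<pi>.hom_mult[OF x g(1)] \<pi>.hom_mult[OF g(1) x] \<pi>.hom_mult[OF cG, of "g \<otimes> x"] c(2) x g by simp
        show "(N #> x) \<otimes>\<^bsub>G Mod N\<^esub> (N #> c) = (N #> c) \<otimes>\<^bsub>G Mod N\<^esub> (N #> x)"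
          using p_group_section_central[OF p N(1) D N(2,3) c(1) x] \<pi>.hom_mult[OF x cG] \<pi>.hom_mult[OF cG x] by simp
      qed (use x g cG \<pi>.hom_closed in auto)
      also have "\<dots> = (N #> g) \<otimes>\<^bsub>G Mod N\<^esub> (N #> x) [^]\<^bsub>G Mod N\<^esub> p"
        unfolding cp using \<pi>.hom_closed[OF g(1)] \<pi>.hom_closed[OF x] by (intro Q.l_one Q.m_closed Q.nat_pow_closed)
      finally show ?thesis unfolding w_def g(2) using normal.FactGroup_pow[OF N(1) x, of p] by simp
    qed
    have wp: "w [^]\<^bsub>G Mod N\<^esub> p = N #> x [^] (p * p)"
      unfolding w_def using normal.FactGroup_pow[OF N(1) xpc, of p] x by (simp add: nat_pow_pow)
    have W: "generate (G Mod N) {w} \<lhd> G Mod N" by (rule Q.generate_powers_normal[OF w cen])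
    have wpc: "w [^]\<^bsub>G Mod N\<^esub> p \<in> carrier (G Mod N)" using w by (rule Q.nat_pow_closed)
    have W2: "generate (G Mod N) {w [^]\<^bsub>G Mod N\<^esub> p} \<lhd> G Mod N"
    proof (rule Q.generate_powers_normal[OF wpc])
      fix h assume h: "h \<in> carrier (G Mod N)"
      show "w [^]\<^bsub>G Mod N\<^esub> p \<otimes>\<^bsub>G Mod N\<^esub> h = h \<otimes>\<^bsub>G Mod N\<^esub> w [^]\<^bsub>G Mod N\<^esub> p"
        by (rule Q.group_commutes_pow[OF cen[OF h] w h])
    qed
    note pre = preimage_quotient[OF N(1) normal_imp_subgroup[OF W]]
    note pre2 = preimage_quotient[OF N(1) normal_imp_subgroup[OF W2]]
    have above: "N \<subset> {g \<in> carrier G. N #> g \<in> generate (G Mod N) {N #> u}}"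
      if "u \<in> carrier G" "u \<notin> N" "N \<subseteq> {g \<in> carrier G. N #> g \<in> generate (G Mod N) {N #> u}}" for u
    proof -
      have "u \<in> {g \<in> carrier G. N #> g \<in> generate (G Mod N) {N #> u}}"
        using that(1) by (auto intro: generate.incl)
      then show ?thesis using that(2,3) by blast
    qed
    have "x [^] p \<notin> N" using xp N(2) by blast
    then have DW: "D \<subseteq> {g \<in> carrier G. N #> g \<in> generate (G Mod N) {w}}"
      using above[OF xpc] pre(2) unfolding w_def[symmetric] by (intro star[OF N pre(4)[OF W]]) simp
    \<comment> \<open>Otherwise <x^p>N/N has order at most p, so <x^p>N, which contains D, equals D
      and x^p lies in D.\<close>
    have "x [^] (p * p) \<notin> N"
    proof
      assume "x [^] (p * p) \<in> N"
      then have "w [^]\<^bsub>G Mod N\<^esub> p = \<one>\<^bsub>G Mod N\<^esub>"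
        unfolding wp using coset_eq_self_iff[OF Ns, of "x [^] (p * p)"] x by simp
      then have "card (generate (G Mod N) {w}) \<le> p"
        using Q.card_generate_dvd[OF w] prime_gt_0_nat[OF p(1)] dvd_imp_le by blast
      then have "card {g \<in> carrier G. N #> g \<in> generate (G Mod N) {w}} \<le> card D"
        unfolding pre(3) N(3) by (simp add: mult.commute)
      from fin_le[OF pre(1) DW this] have "x [^] p \<in> D"
        using xpc unfolding w_def by (auto intro: generate.incl)
      then show False using xp by simp
    qed
    then have "D \<subseteq> {g \<in> carrier G. N #> g \<in> generate (G Mod N) {w [^]\<^bsub>G Mod N\<^esub> p}}"
      using above[of "x [^] (p * p)"] pre2(2) x unfolding wp[symmetric] by (intro star[OF N pre2(4)[OF W2]]) simp
    then have "N #> d \<in> generate (G Mod N) {N #> x [^] (p * p)}" using d unfolding wp by blast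
    then show ?thesis using x by (intro mem_preimage_powers[OF N(1) _ DG[OF d]]) simp_all
  qed
  interpret Q: finite_group "G Mod L" by (rule quotient_finite_group[OF L(1)])
  interpret \<pi>: group_hom G "G Mod L" "\<lambda>g. L #> g" by (rule quotient_hom[OF L(1)])
  let ?X = "L #> x" and ?Y = "L #> y" and ?Z = "(\<lambda>g. L #> g) ` N"
  note X = \<pi>.hom_closed[OF x] and Y = \<pi>.hom_closed[OF y]
  have Zc: "?Z \<subseteq> carrier (G Mod L)" using NG \<pi>.hom_closed by blast
  have cenN: "z \<otimes>\<^bsub>G Mod L\<^esub> h = h \<otimes>\<^bsub>G Mod L\<^esub> z" if zh: "z \<in> ?Z" "h \<in> carrier (G Mod L)" for z h
  proof -
    obtain n g where ng: "n \<in> N" "z = L #> n" "g \<in> carrier G" "h = L #> g" using zh by (auto simp: carrier_FactGroup)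
    show ?thesis
      unfolding ng(2,4) \<pi>.hom_mult[OF NG[OF ng(1)] ng(3), symmetric] \<pi>.hom_mult[OF ng(3) NG[OF ng(1)], symmetric]
      by (rule p_group_section_central[OF p L(1) N(1) L(2,3) ng(1,3)])
  qed
  have Dpow: "\<exists>i. \<exists>z\<in>?Z. L #> d = z \<otimes>\<^bsub>G Mod L\<^esub> (?X [^]\<^bsub>G Mod L\<^esub> (p * p)) [^]\<^bsub>G Mod L\<^esub> (i :: nat)" if d: "d \<in> D" for d
  proof -
    obtain i n where n: "n \<in> N" "d = n \<otimes> (x [^] (p * p)) [^] (i :: nat)" using D_powers[OF d] by blast
    have "L #> d = (L #> n) \<otimes>\<^bsub>G Mod L\<^esub> (?X [^]\<^bsub>G Mod L\<^esub> (p * p)) [^]\<^bsub>G Mod L\<^esub> i"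
      unfolding n(2) using x NG[OF n(1)] by (simp add: \<pi>.hom_nat_pow del: mult_FactGroup)
    then show ?thesis using n(1) by blast
  qed
  \<comment> \<open>N/L is central and D is covered by N and the powers of x^(p^2): whatever
    commutes with x^(p^2) modulo L commutes with D modulo L.\<close>
  have Dcomm: "(L #> d) \<otimes>\<^bsub>G Mod L\<^esub> h = h \<otimes>\<^bsub>G Mod L\<^esub> (L #> d)"
    if d: "d \<in> D" and h: "h \<in> carrier (G Mod L)"
      and hx: "?X [^]\<^bsub>G Mod L\<^esub> (p * p) \<otimes>\<^bsub>G Mod L\<^esub> h = h \<otimes>\<^bsub>G Mod L\<^esub> ?X [^]\<^bsub>G Mod L\<^esub> (p * p)" for d h
  proof -
    obtain i z where z: "z \<in> ?Z" "L #> d = z \<otimes>\<^bsub>G Mod L\<^esub> (?X [^]\<^bsub>G Mod L\<^esub> (p * p)) [^]\<^bsub>G Mod L\<^esub> (i :: nat)"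
      using Dpow[OF d] by blast
    define V where "V = (?X [^]\<^bsub>G Mod L\<^esub> (p * p)) [^]\<^bsub>G Mod L\<^esub> i"
    have Xp: "?X [^]\<^bsub>G Mod L\<^esub> (p * p) \<in> carrier (G Mod L)" by (rule Q.nat_pow_closed[OF X])
    have V: "V \<in> carrier (G Mod L)" unfolding V_def by (rule Q.nat_pow_closed[OF Xp])
    have Vh: "V \<otimes>\<^bsub>G Mod L\<^esub> h = h \<otimes>\<^bsub>G Mod L\<^esub> V" unfolding V_def by (rule Q.group_commutes_pow[OF hx Xp h])
    have zc: "z \<in> carrier (G Mod L)" using z(1) Zc by blast
    have "z \<otimes>\<^bsub>G Mod L\<^esub> V \<otimes>\<^bsub>G Mod L\<^esub> h = z \<otimes>\<^bsub>G Mod L\<^esub> h \<otimes>\<^bsub>G Mod L\<^esub> V"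
      using Vh zc V h by (simp only: Q.m_assoc)
    also have "\<dots> = h \<otimes>\<^bsub>G Mod L\<^esub> (z \<otimes>\<^bsub>G Mod L\<^esub> V)"
      unfolding cenN[OF z(1) h] using zc V h by (simp only: Q.m_assoc)
    finally show ?thesis unfolding z(2) V_def .
  qed
  obtain c where c: "c \<in> D" "x \<otimes> y = c \<otimes> (y \<otimes> x)" using ex_commutator[OF x y] unfolding D_def by blast
  have cG: "c \<in> carrier G" by (rule DG[OF c(1)])
  note C = \<pi>.hom_closed[OF cG]
  have Xpp_X: "?X [^]\<^bsub>G Mod L\<^esub> (p * p) \<otimes>\<^bsub>G Mod L\<^esub> ?X = ?X \<otimes>\<^bsub>G Mod L\<^esub> ?X [^]\<^bsub>G Mod L\<^esub> (p * p)"
    by (rule Q.group_commutes_pow[OF refl X X])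
  have XY: "?X \<otimes>\<^bsub>G Mod L\<^esub> ?Y = (L #> c) \<otimes>\<^bsub>G Mod L\<^esub> (?Y \<otimes>\<^bsub>G Mod L\<^esub> ?X)"
    using \<pi>.hom_mult[OF x y] \<pi>.hom_mult[OF y x] \<pi>.hom_mult[OF cG, of "y \<otimes> x"] c(2) x y by simp
  have CX: "(L #> c) \<otimes>\<^bsub>G Mod L\<^esub> ?X = ?X \<otimes>\<^bsub>G Mod L\<^esub> (L #> c)" by (rule Dcomm[OF c(1) X Xpp_X])
  \<comment> \<open>One factor p for each of the sections D/N and N/L.\<close>
  have cpp: "(L #> c) [^]\<^bsub>G Mod L\<^esub> (p * p) = \<one>\<^bsub>G Mod L\<^esub>"
  proof -
    have "c [^] p \<in> N" by (rule pow_mem_of_card[OF N(1) Ds N(2,3) c(1)])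
    then have "(c [^] p) [^] p \<in> L" by (rule pow_mem_of_card[OF L(1) Ns L(2,3)])
    then have "c [^] (p * p) \<in> L" using cG by (simp add: nat_pow_pow)
    then show ?thesis
      using normal.FactGroup_pow[OF L(1) cG, of "p * p"] coset_eq_self_iff[OF Ls, of "c [^] (p * p)"] cG by simp
  qed
  \<comment> \<open>[x^(p^2), y] = [x, y]^(p^2) modulo L; with this D commutes with both generators
    modulo L.\<close>
  have Xpp_Y: "?X [^]\<^bsub>G Mod L\<^esub> (p * p) \<otimes>\<^bsub>G Mod L\<^esub> ?Y = ?Y \<otimes>\<^bsub>G Mod L\<^esub> ?X [^]\<^bsub>G Mod L\<^esub> (p * p)"
  proof -
    have "?X [^]\<^bsub>G Mod L\<^esub> (p * p) \<otimes>\<^bsub>G Mod L\<^esub> ?Y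
        = (L #> c) [^]\<^bsub>G Mod L\<^esub> (p * p) \<otimes>\<^bsub>G Mod L\<^esub> (?Y \<otimes>\<^bsub>G Mod L\<^esub> ?X [^]\<^bsub>G Mod L\<^esub> (p * p))"
      by (rule Q.commutator_pow_left[OF X Y C XY CX[symmetric]])
    also have "\<dots> = ?Y \<otimes>\<^bsub>G Mod L\<^esub> ?X [^]\<^bsub>G Mod L\<^esub> (p * p)"
      unfolding cpp by (intro Q.l_one Q.m_closed Q.nat_pow_closed X Y)
    finally show ?thesis .
  qed
  let ?S = "insert ?X (insert ?Y ?Z)"
  have S: "?S \<subseteq> carrier (G Mod L)" using X Y Zc by simp
  have "card (derived (G Mod L) (carrier (G Mod L))) dvd p"
  proof (rule Q.card_derived_dvd[OF X Y Zc _ cenN C XY CX])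
    interpret GS: subgroup "generate (G Mod L) ?S" "G Mod L" by (rule Q.generate_is_subgroup[OF S])
    note pc = Q.subgroup_nat_pow_closed[OF GS.subgroup_axioms]
    have inS: "s \<in> generate (G Mod L) ?S" if "s \<in> ?S" for s using that by (rule generate.incl)
    show "generate (G Mod L) ?S = carrier (G Mod L)"
    proof
      show "carrier (G Mod L) \<subseteq> generate (G Mod L) ?S"
      proof
        fix h assume "h \<in> carrier (G Mod L)"
        then obtain g where g: "g \<in> carrier G" "h = L #> g" by (auto simp: carrier_FactGroup)
        obtain i j :: nat and d where d: "d \<in> D" "g = x [^] i \<otimes> (y [^] j \<otimes> d)" using gen[OF g(1)] by blast
        have h: "h = ?X [^]\<^bsub>G Mod L\<^esub> i \<otimes>\<^bsub>G Mod L\<^esub> (?Y [^]\<^bsub>G Mod L\<^esub> j \<otimes>\<^bsub>G Mod L\<^esub> (L #> d))"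
          unfolding g(2) d(2) using x y DG[OF d(1)] by (simp add: \<pi>.hom_nat_pow)
        obtain l z where z: "z \<in> ?Z" "L #> d = z \<otimes>\<^bsub>G Mod L\<^esub> (?X [^]\<^bsub>G Mod L\<^esub> (p * p)) [^]\<^bsub>G Mod L\<^esub> (l :: nat)"
          using Dpow[OF d(1)] by blast
        show "h \<in> generate (G Mod L) ?S"
          unfolding h z(2) by (intro GS.m_closed pc inS) (use z(1) in auto)
      qed
    qed (rule GS.subset)
    show "(L #> c) \<otimes>\<^bsub>G Mod L\<^esub> ?Y = ?Y \<otimes>\<^bsub>G Mod L\<^esub> (L #> c)" by (rule Dcomm[OF c(1) Y Xpp_Y])
    show "?X \<otimes>\<^bsub>G Mod L\<^esub> ?Y [^]\<^bsub>G Mod L\<^esub> p = ?Y [^]\<^bsub>G Mod L\<^esub> p \<otimes>\<^bsub>G Mod L\<^esub> ?X"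
      using Dcomm[OF yp X Xpp_X] \<pi>.hom_nat_pow[OF y, of p] by simp
  qed
  then have "card D dvd p * card L"
    using card_derived_dvd_mod[OF L(1)] L(2) N(2) unfolding D_def by blast
  \<comment> \<open>This clashes with |D| = p |N| = p^2 |L|.\<close>
  then have "card N dvd card L" using N(3) prime_gt_0_nat[OF p(1)] by simp
  then have "p * card L \<le> card L" using L(3) card_subgroup_pos[OF Ls] by (simp add: dvd_imp_le)
  then show False using card_subgroup_pos[OF Ls] prime_gt_1_nat[OF p(1)] by simp
qed

end

section \<open>Codegrees\<close>

lemma prime_power_if_unique_prime_divisor:
  assumes "(m :: nat) > 0" and "prime p" and "\<And>q. prime q \<Longrightarrow> q dvd m \<Longrightarrow> q = p"
  shows "\<exists>k. m = p ^ k"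
proof -
  obtain r where r: "m = p ^ multiplicity p m * r" "\<not> p dvd r"
    using multiplicity_decompose'[of m p] assms(1,2) by (metis neq0_conv not_prime_unit)
  have "r = 1"
  proof (rule ccontr)
    assume "r \<noteq> 1"
    then obtain q where "prime q" "q dvd r" using prime_factor_nat by blast
    then have "q = p" using assms(3)[of q] r(1) by (metis dvd_mult)
    then show False using \<open>q dvd r\<close> r(2) by simp
  qed
  then show ?thesis using r(1) by auto
qed

context finite_group
begin

text \<open>|G : N \<inter> K| = |G : K| |KN : N|, and |KN : N| divides |G : N|.\<close>

lemma index_inter_dvd:
  assumes N: "N \<lhd> G" and K: "subgroup K G"
  shows "index (N \<inter> K) dvd index N * index K"
proof -
  note Ns = normal_imp_subgroup[OF N]
  have NK: "subgroup (N \<inter> K) G" by (rule subgroups_Inter_pair[OF Ns K])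
  interpret Q: finite_group "G Mod N" by (rule quotient_finite_group[OF N])
  interpret \<pi>: group_hom G "G Mod N" "\<lambda>g. N #> g" by (rule quotient_hom[OF N])
  let ?K = "(\<lambda>g. N #> g) ` K"
  have KG: "k \<in> carrier G" if "k \<in> K" for k using that subgroup.subset[OF K] by blast
  have fiber: "card {k \<in> K. N #> k = c} = card (N \<inter> K)" if cK: "c \<in> ?K" for c
  proof -
    obtain x where x: "x \<in> K" "c = N #> x" using cK by blast
    have "{k \<in> K. N #> k = c} = (\<lambda>u. u \<otimes> x) ` (N \<inter> K)"
    proof
      show "(\<lambda>u. u \<otimes> x) ` (N \<inter> K) \<subseteq> {k \<in> K. N #> k = c}"
      proof
        fix k assume "k \<in> (\<lambda>u. u \<otimes> x) ` (N \<inter> K)"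
        then obtain u where u: "u \<in> N" "u \<in> K" "k = u \<otimes> x" by blast
        have "k \<otimes> inv x = u" using u KG x by (simp add: m_assoc)
        then show "k \<in> {k \<in> K. N #> k = c}"
          using coset_eq_iff[OF N, of k x] u x KG subgroup.m_closed[OF K] by simp
      qed
      show "{k \<in> K. N #> k = c} \<subseteq> (\<lambda>u. u \<otimes> x) ` (N \<inter> K)"
      proof
        fix k assume "k \<in> {k \<in> K. N #> k = c}"
        then have k: "k \<in> K" "k \<otimes> inv x \<in> N" using coset_eq_iff[OF N, of k x] x KG by auto
        have "k \<otimes> inv x \<in> N \<inter> K" using k x subgroup.m_closed[OF K] subgroup.m_inv_closed[OF K] by simp
        moreover have "k = k \<otimes> inv x \<otimes> x" using k x KG by (simp add: m_assoc)
        ultimately show "k \<in> (\<lambda>u. u \<otimes> x) ` (N \<inter> K)" by (rule rev_image_eqI)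
      qed
    qed
    moreover have "inj_on (\<lambda>u. u \<otimes> x) (N \<inter> K)"
    proof (rule inj_onI)
      fix u v assume "u \<in> N \<inter> K" "v \<in> N \<inter> K" "u \<otimes> x = v \<otimes> x"
      then show "u = v" using KG x by simp
    qed
    ultimately show ?thesis by (simp add: card_image)
  qed
  have "card K = (\<Sum>c\<in>?K. \<Sum>k\<in>{k \<in> K. N #> k = c}. (1 :: nat))"
    using sum.image_gen[OF finite_subgroup[OF K], of "\<lambda>_. 1 :: nat" "\<lambda>g. N #> g"] by simp
  also have "\<dots> = card ?K * card (N \<inter> K)" using fiber by simp
  finally have cK: "card K = card ?K * card (N \<inter> K)" .
  have "card ?K dvd index N"
    using Q.card_subgroup_dvd[OF \<pi>.subgroup_img_is_subgroup[OF K] Q.subgroup_self] card_quotient KG \<pi>.hom_closed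
    by (metis image_subsetI)
  then obtain d where d: "index N = card ?K * d" by blast
  have "index (N \<inter> K) * card (N \<inter> K) = index K * card ?K * card (N \<inter> K)"
    using index_mult_card[OF NK] index_mult_card[OF K] cK by simp
  then have "index (N \<inter> K) = index K * card ?K" using card_subgroup_pos[OF NK] by simp
  then show ?thesis using d by simp
qed

text \<open>The quotient of |G : ker chi| by chi(1) is a power of p, so a prime q other than p
  divides both or neither; this ties divisibility of degrees to kernels.\<close>

lemma prime_power_card:
  assumes p: "prime p" and cod: "\<And>\<chi>. \<chi> \<in> Irr G \<Longrightarrow> \<exists>j. index (character_kernel G \<chi>) = p ^ j * degree \<chi>"
  shows "\<exists>k. card (carrier G) = p ^ k"
proof (rule prime_power_if_unique_prime_divisor[OF card_carrier_pos p], rule ccontr)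
  fix q assume q: "prime q" and qG: "q dvd card (carrier G)" and qp: "q \<noteq> p"
  have qdeg: "q dvd index (character_kernel G \<chi>) \<longleftrightarrow> q dvd degree \<chi>" if \<chi>: "\<chi> \<in> Irr G" for \<chi>
  proof -
    obtain j where j: "index (character_kernel G \<chi>) = p ^ j * degree \<chi>" using cod[OF \<chi>] by blast
    have "\<not> q dvd p ^ j" using prime_dvd_power[OF q, of p j] primes_dvd_imp_eq[OF q p] qp by blast
    then show ?thesis unfolding j using q by (simp add: prime_dvd_mult_iff)
  qed
  let ?S = "{\<chi> \<in> Irr G. \<not> q dvd degree \<chi>}"
  \<comment> \<open>The intersection of the kernels, taken one character at a time so that the index
    stays prime to q.\<close>
  have F: "\<exists>N. N \<lhd> G \<and> \<not> q dvd index N \<and> (\<forall>\<chi>\<in>F. N \<subseteq> character_kernel G \<chi>)" if "finite F" "F \<subseteq> ?S" for F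
    using that
  proof (induction F rule: finite_induct)
    case empty
    have "index (carrier G) = 1" using index_mult_card[OF subgroup_self] card_carrier_pos by simp
    then have "\<not> q dvd index (carrier G)" using prime_gt_1_nat[OF q] by simp
    then show ?case using normal_self by auto
  next
    case (insert \<chi> F)
    then obtain N where N: "N \<lhd> G" "\<not> q dvd index N" "\<forall>\<chi>\<in>F. N \<subseteq> character_kernel G \<chi>" by auto
    have \<chi>: "\<chi> \<in> Irr G" "\<not> q dvd degree \<chi>" using insert.prems by auto
    have "\<not> q dvd index (N \<inter> character_kernel G \<chi>)"
    proof
      assume "q dvd index (N \<inter> character_kernel G \<chi>)"
      then have "q dvd index N * index (character_kernel G \<chi>)"
        by (rule dvd_trans[OF _ index_inter_dvd[OF N(1) kernel_subgroup[OF \<chi>(1)]]])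
      then show False using N(2) qdeg[OF \<chi>(1)] \<chi>(2) by (simp add: prime_dvd_mult_iff[OF q])
    qed
    moreover have "N \<inter> character_kernel G \<chi> \<lhd> G"
      by (rule normal_subgroup_intersect[OF N(1) kernel_normal[OF \<chi>(1)]])
    ultimately show ?case using N(3) by blast
  qed
  have "finite ?S" using finite_Irr by simp
  from F[OF this order_refl] obtain N
    where N: "N \<lhd> G" "\<not> q dvd index N" "\<forall>\<chi>\<in>?S. N \<subseteq> character_kernel G \<chi>" by blast
  have "N \<subseteq> character_kernel G \<chi> \<longleftrightarrow> \<not> q dvd degree \<chi>" if \<chi>: "\<chi> \<in> Irr G" for \<chi>
  proof
    assume "N \<subseteq> character_kernel G \<chi>"
    then have "index (character_kernel G \<chi>) dvd index N"
      by (rule index_dvd[OF normal_imp_subgroup[OF N(1)] kernel_subgroup[OF \<chi>]])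
    then show "\<not> q dvd degree \<chi>" using N(2) qdeg[OF \<chi>] dvd_trans by blast
  qed (use N(3) \<chi> in blast)
  then have "{\<chi>. \<chi> \<in> Irr G \<and> N \<subseteq> character_kernel G \<chi>} = ?S" by blast
  then have iN: "index N = (\<Sum>\<chi>\<in>?S. degree \<chi> ^ 2)" using index_eq_sum_degree_squares[OF N(1)] by simp
  have "card (carrier G) = (\<Sum>\<chi>\<in>?S. degree \<chi> ^ 2) + (\<Sum>\<chi>\<in>Irr G - ?S. degree \<chi> ^ 2)"
    unfolding card_eq_sum_degree_squares using finite_Irr by (subst add.commute, intro sum.subset_diff) auto
  \<comment> \<open>The remaining degrees are divisible by q, so |G| and |G : N| agree modulo
    q.\<close>
  moreover have "q dvd (\<Sum>\<chi>\<in>Irr G - ?S. degree \<chi> ^ 2)"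
    by (intro dvd_sum) (auto simp: power2_eq_square)
  ultimately have "q dvd index N" using qG iN by (simp only: dvd_add_left_iff)
  then show False using N(2) by simp
qed

lemma linear_value_from_generator:
  assumes \<psi>: "\<psi> \<in> Irr G" "degree \<psi> = 1" and x: "x \<in> carrier G" and g: "g \<in> carrier G"
    and k: "inv (x [^] (k :: nat)) \<otimes> g \<in> character_kernel G \<psi>"
  shows "\<psi> g = \<psi> x ^ k"
proof -
  have xk: "x [^] k \<in> carrier G" using x by simp
  have "\<psi> (inv (x [^] k)) * \<psi> g = 1"
    using k linear_kernel_iff[OF \<psi>] linear_character_mult[OF \<psi> inv_closed[OF xk] g] by simp
  moreover have "\<psi> (inv (x [^] k)) * \<psi> (x [^] k) = 1" by (rule linear_character_inv_mult[OF \<psi> xk])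
  ultimately show ?thesis
    unfolding linear_character_pow[OF \<psi> x] by (metis mult_cancel_left mult_zero_left zero_neq_one)
qed

text \<open>A linear character of a group with cyclic abelianization is determined by its value at
  x, here a p-th root of unity.\<close>

lemma card_linear_le_of_cyclic:
  assumes x: "x \<in> carrier G" and p: "p > 0"
    and gen: "\<And>g. g \<in> carrier G \<Longrightarrow> \<exists>k. inv (x [^] (k :: nat)) \<otimes> g \<in> derived G (carrier G)"
    and S: "\<And>\<psi>. \<psi> \<in> S \<Longrightarrow> \<psi> \<in> Irr G \<and> degree \<psi> = 1 \<and> \<psi> x ^ p = 1"
  shows "card S \<le> p"
proof -
  have "inj_on (\<lambda>\<psi>. \<psi> x) S"
  proof (rule inj_onI)
    fix \<psi> \<phi> assume \<psi>: "\<psi> \<in> S" and \<phi>: "\<phi> \<in> S" and eq: "\<psi> x = \<phi> x"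
    show "\<psi> = \<phi>"
    proof
      fix g
      show "\<psi> g = \<phi> g"
      proof (cases "g \<in> carrier G")
        case True
        obtain k :: nat where k: "inv (x [^] k) \<otimes> g \<in> derived G (carrier G)" using gen[OF True] by blast
        have v: "\<psi>' g = \<psi>' x ^ k" if "\<psi>' \<in> S" for \<psi>'
          using linear_value_from_generator[of \<psi>' x g k] S[OF that] x True k linear_iff_derived_le_kernel[of \<psi>'] by blast
        show ?thesis unfolding v[OF \<psi>] v[OF \<phi>] eq ..
      next
        case False
        \<comment> \<open>Off the carrier both characters are \<open>undefined\<close>.\<close>
        then show ?thesis using S[OF \<psi>] S[OF \<phi>] by (auto simp: character_def elim!: IrrE)
      qed
    qed
  qed
  moreover have "(\<lambda>\<psi>. \<psi> x) ` S \<subseteq> {z. z ^ p = 1}" using S by auto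
  moreover have "finite {z :: complex. z ^ p = 1}" "card {z :: complex. z ^ p = 1} = p"
    using finite_roots_unity[of p] card_roots_unity_eq[of p] p by auto
  ultimately show ?thesis by (metis card_inj_on_le)
qed

text \<open>If all characters with L in the kernel were linear, they would also have L G' in the
  kernel; the degree equation would then give L and L G' the same index.\<close>

lemma nonlinear_character_exists:
  assumes L: "L \<lhd> G" and D: "\<not> derived G (carrier G) \<subseteq> L"
  shows "\<exists>\<chi>\<in>Irr G. L \<subseteq> character_kernel G \<chi> \<and> degree \<chi> \<noteq> 1"
proof (rule ccontr)
  assume no: "\<not> ?thesis"
  let ?D = "derived G (carrier G)"
  let ?M = "L <#> ?D"
  have M: "?M \<lhd> G" by (rule normal_subgroup_set_mult_closed[OF L normal_derived])
  note Ls = normal_imp_subgroup[OF L] and Ds = normal_imp_subgroup[OF normal_derived]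
  have LM: "L \<subseteq> ?M"
  proof
    fix l assume "l \<in> L"
    then have "l = l \<otimes> \<one>" using subgroup.subset[OF Ls] by auto
    then show "l \<in> ?M" using \<open>l \<in> L\<close> subgroup.one_closed[OF Ds] unfolding set_mult_def by blast
  qed
  have DM: "?D \<subseteq> ?M"
  proof
    fix d assume "d \<in> ?D"
    then have "d = \<one> \<otimes> d" using subgroup.subset[OF Ds] by auto
    then show "d \<in> ?M" using \<open>d \<in> ?D\<close> subgroup.one_closed[OF Ls] unfolding set_mult_def by blast
  qed
  have "?M \<subseteq> character_kernel G \<chi>" if \<chi>: "\<chi> \<in> Irr G" "L \<subseteq> character_kernel G \<chi>" for \<chi>
  proof -
    have "?D \<subseteq> character_kernel G \<chi>" using no \<chi> linear_iff_derived_le_kernel by blast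
    then show ?thesis using \<chi>(2) subgroup.m_closed[OF kernel_subgroup[OF \<chi>(1)]] unfolding set_mult_def by blast
  qed
  then have "{\<chi>. \<chi> \<in> Irr G \<and> L \<subseteq> character_kernel G \<chi>} = {\<chi>. \<chi> \<in> Irr G \<and> ?M \<subseteq> character_kernel G \<chi>}"
    using LM by blast
  then have "index L = index ?M" using index_eq_sum_degree_squares[OF L] index_eq_sum_degree_squares[OF M] by simp
  then have "L = ?M" using index_eqD[OF Ls normal_imp_subgroup[OF M] LM] by simp
  then show False using D DM by blast
qed

end

text \<open>The multiplicities are kept in cumulative form: C_(p^n) x C_p has p^(j+1) characters of
  codegree at most p^j. The value j = 0 is excluded because only the principal character has
  codegree 1, not p characters. Both the abelian group and the unknown group are placed in this
  locale.\<close>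

locale codegree_like_rank_two = finite_group +
  fixes p n :: nat
  assumes prime: "prime p" and n_pos: "n > 0"
    and codegrees: "\<chi> \<in> Irr G \<Longrightarrow> \<exists>j\<le>n. index (character_kernel G \<chi>) = p ^ j * degree \<chi>"
    and codegree_count: "1 \<le> j \<Longrightarrow> j \<le> n \<Longrightarrow>
      card {\<chi> \<in> Irr G. \<exists>i\<le>j. index (character_kernel G \<chi>) = p ^ i * degree \<chi>} = p ^ Suc j"
begin

abbreviation D where "D \<equiv> derived G (carrier G)"

lemma p_gt_1: "p > 1"
  by (rule prime_gt_1_nat[OF prime])

lemma p_group: "\<exists>k. card (carrier G) = p ^ k"
  using prime_power_card[OF prime] codegrees by blast

lemma degree_prime_power:
  assumes \<chi>: "\<chi> \<in> Irr G"
  shows "\<exists>e. degree \<chi> = p ^ e"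
proof -
  obtain k where k: "card (carrier G) = p ^ k" using p_group by blast
  obtain j where j: "index (character_kernel G \<chi>) = p ^ j * degree \<chi>" using codegrees[OF \<chi>] by blast
  have "index (character_kernel G \<chi>) dvd p ^ k"
    using index_mult_card[OF kernel_subgroup[OF \<chi>]] k by (metis dvd_triv_left)
  then have "degree \<chi> dvd p ^ k" using j by (metis dvd_mult_right)
  then show ?thesis using divides_primepow_nat[OF prime] by blast
qed

lemma nonlinear_degree_dvd:
  assumes "\<chi> \<in> Irr G" "degree \<chi> \<noteq> 1"
  shows "p dvd degree \<chi>"
proof -
  obtain e where "degree \<chi> = p ^ e" using degree_prime_power[OF assms(1)] by blast
  then show ?thesis using assms(2) by (cases e) auto
qed

lemma nonlinear_degree_ge:
  assumes "\<chi> \<in> Irr G" "degree \<chi> \<noteq> 1"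
  shows "p \<le> degree \<chi>"
  using nonlinear_degree_dvd[OF assms] degree_pos[OF assms(1)] by (rule dvd_imp_le)

lemma nonlinear_degree_less:
  assumes \<chi>: "\<chi> \<in> Irr G" "degree \<chi> \<noteq> 1" and j: "index (character_kernel G \<chi>) = p ^ j * degree \<chi>"
  shows "degree \<chi> < p ^ j"
proof -
  have "degree \<chi> > 1" using degree_pos[OF \<chi>(1)] \<chi>(2) by simp
  from degree_square_less_index[OF \<chi>(1) this] show ?thesis
    unfolding j by (simp add: power2_eq_square)
qed

definition up_to :: "nat \<Rightarrow> ('a \<Rightarrow> complex) set" where
  "up_to j = {\<chi> \<in> Irr G. \<exists>i\<le>j. index (character_kernel G \<chi>) = p ^ i * degree \<chi>}"

lemma card_up_to: "1 \<le> j \<Longrightarrow> j \<le> n \<Longrightarrow> card (up_to j) = p ^ Suc j"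
  unfolding up_to_def by (rule codegree_count)

lemma finite_up_to: "finite (up_to j)"
  unfolding up_to_def using finite_Irr by simp

lemma up_to_n: "up_to n = Irr G"
  unfolding up_to_def using codegrees by blast

lemma card_Irr: "card (Irr G) = p ^ Suc n"
  using card_up_to[of n] n_pos up_to_n by simp

text \<open>A nonlinear character has degree less than its codegree but at least p.\<close>

lemma up_to_1_linear: "\<chi> \<in> up_to 1 \<Longrightarrow> degree \<chi> = 1"
proof (rule ccontr)
  assume "\<chi> \<in> up_to 1" and d: "degree \<chi> \<noteq> 1"
  then obtain i where \<chi>: "\<chi> \<in> Irr G" and i: "i \<le> 1" "index (character_kernel G \<chi>) = p ^ i * degree \<chi>"
    unfolding up_to_def by blast
  have "degree \<chi> < p ^ i" by (rule nonlinear_degree_less[OF \<chi> d i(2)])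
  also have "p ^ i \<le> p ^ 1" using p_gt_1 i(1) by (intro power_increasing) auto
  finally show False using nonlinear_degree_ge[OF \<chi> d] by simp
qed

text \<open>The p^2 characters of codegree at most p are linear, and their values at x are p-th
  roots of unity; a cyclic abelianization has at most p such characters.\<close>

lemma not_cyclic_abelianization:
  assumes x: "x \<in> carrier G"
  shows "\<exists>g\<in>carrier G. \<forall>k::nat. inv (x [^] k) \<otimes> g \<notin> D"
proof (rule ccontr)
  assume "\<not> ?thesis"
  then have gen: "\<exists>k. inv (x [^] (k :: nat)) \<otimes> g \<in> D" if "g \<in> carrier G" for g using that by blast
  have "card (up_to 1) \<le> p"
  proof (rule card_linear_le_of_cyclic[OF x _ gen])
    show "p > 0" using p_gt_1 by simp
    fix \<psi> assume \<psi>: "\<psi> \<in> up_to 1"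
    then have d: "degree \<psi> = 1" by (rule up_to_1_linear)
    obtain i where I: "\<psi> \<in> Irr G" and i: "i \<le> 1" "index (character_kernel G \<psi>) = p ^ i"
      using \<psi> d unfolding up_to_def by auto
    have "\<psi> x ^ (p ^ i) = 1" using linear_pow_index[OF I d x] i(2) by simp
    then have "(\<psi> x ^ (p ^ i)) ^ (p ^ (1 - i)) = 1" by simp
    then have "\<psi> x ^ (p ^ i * p ^ (1 - i)) = 1" by (simp only: power_mult)
    then have "\<psi> x ^ p = 1" using i(1) by (simp add: power_add[symmetric])
    then show "\<psi> \<in> Irr G \<and> degree \<psi> = 1 \<and> \<psi> x ^ p = 1" using I d by simp
  qed
  then show False using card_up_to[of 1] n_pos p_gt_1 by simp
qed

text \<open>The lower bound comes from the p^2 linear characters of codegree at most p, the upper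
  bound from |Irr G| = p^(n+1). The exponent is written a + 1 in analogy with the order of C_(p^a) x
  C_p.\<close>

lemma index_D: "\<exists>a\<ge>1. a \<le> n \<and> index D = p ^ Suc a"
proof -
  obtain k where k: "card (carrier G) = p ^ k" using p_group by blast
  have "index D dvd p ^ k"
    using index_mult_card[OF normal_imp_subgroup[OF normal_derived]] k by (metis dvd_triv_left)
  then obtain b where b: "index D = p ^ b" using divides_primepow_nat[OF prime] by blast
  have "up_to 1 \<subseteq> {\<chi> \<in> Irr G. degree \<chi> = 1}" using up_to_1_linear unfolding up_to_def by blast
  then have "p ^ Suc 1 \<le> p ^ b"
    using card_mono[of "{\<chi> \<in> Irr G. degree \<chi> = 1}" "up_to 1"] finite_Irr card_up_to[of 1] n_pos
    unfolding card_degree_one b by simp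
  then have b2: "Suc 1 \<le> b" using power_le_imp_le_exp[OF p_gt_1] by blast
  have "p ^ b \<le> p ^ Suc n"
    unfolding b[symmetric] card_degree_one[symmetric] card_Irr[symmetric] using finite_Irr by (intro card_mono) auto
  then have "b \<le> Suc n" using power_le_imp_le_exp[OF p_gt_1] by blast
  then show ?thesis using b b2 by (intro exI[of _ "b - 1"]) auto
qed

end

section \<open>Characters of the abelianization, of order p^(a+1)\<close>

locale codegree_like_rank_two_abelianization = codegree_like_rank_two +
  fixes a :: nat
  assumes a_pos: "1 \<le> a" and a_le: "a \<le> n" and index_D_eq: "index D = p ^ Suc a"
begin

text \<open>Order p^(a+1) would make the kernel equal to D and G/D cyclic.\<close>

lemma linear_in_up_to:
  assumes \<chi>: "\<chi> \<in> Irr G" "degree \<chi> = 1"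
  shows "\<exists>i\<le>a. index (character_kernel G \<chi>) = p ^ i"
proof -
  obtain i where i: "index (character_kernel G \<chi>) = p ^ i" using codegrees[OF \<chi>(1)] \<chi>(2) by auto
  note K = kernel_subgroup[OF \<chi>(1)] and Ds = normal_imp_subgroup[OF normal_derived]
  have DK: "D \<subseteq> character_kernel G \<chi>" using linear_iff_derived_le_kernel[OF \<chi>(1)] \<chi>(2) by simp
  have "p ^ i dvd p ^ Suc a" using index_dvd[OF Ds K DK] i index_D_eq by simp
  then have "p ^ i \<le> p ^ Suc a" using p_gt_1 by (intro dvd_imp_le) auto
  then have ia: "i \<le> Suc a" using power_le_imp_le_exp[OF p_gt_1] by blast
  have "i \<noteq> Suc a"
  proof
    assume ie: "i = Suc a"
    have DK': "D = character_kernel G \<chi>" using index_eqD[OF Ds K DK] i ie index_D_eq by simp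
    obtain x where x: "x \<in> carrier G" "\<And>g. g \<in> carrier G \<Longrightarrow> \<exists>k. inv (x [^] (k::nat)) \<otimes> g \<in> character_kernel G \<chi>"
      using linear_primitive_value[OF \<chi> prime] i ie by blast
    show False using not_cyclic_abelianization[OF x(1)] x(2) unfolding DK' by blast
  qed
  then show ?thesis using i ia by (intro exI[of _ i]) simp
qed

text \<open>An inclusion of sets that both have p^(a+1) elements. From here on a codegree above p^a
  is the mark of a nonlinear character.\<close>

lemma up_to_a: "up_to a = {\<chi> \<in> Irr G. degree \<chi> = 1}"
proof (rule sym, rule card_subset_eq[OF finite_up_to])
  show "{\<chi> \<in> Irr G. degree \<chi> = 1} \<subseteq> up_to a" unfolding up_to_def using linear_in_up_to by auto
  show "card {\<chi> \<in> Irr G. degree \<chi> = 1} = card (up_to a)"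
    unfolding card_degree_one index_D_eq using card_up_to[OF a_pos a_le] by simp
qed

lemma nonlinear_index:
  assumes "\<chi> \<in> Irr G" "degree \<chi> \<noteq> 1"
  shows "\<exists>j>a. index (character_kernel G \<chi>) = p ^ j * degree \<chi>"
proof -
  obtain j where j: "index (character_kernel G \<chi>) = p ^ j * degree \<chi>" using codegrees[OF assms(1)] by blast
  have "\<chi> \<notin> up_to a" using up_to_a assms(2) by simp
  then have "\<not> j \<le> a" using j assms(1) unfolding up_to_def by blast
  then show ?thesis using j by (intro exI[of _ j]) simp
qed

lemma nonlinear_index_ge:
  assumes "\<chi> \<in> Irr G" "degree \<chi> \<noteq> 1"
  shows "p ^ Suc a * degree \<chi> \<le> index (character_kernel G \<chi>)"
proof -
  obtain j where j: "j > a" "index (character_kernel G \<chi>) = p ^ j * degree \<chi>" using nonlinear_index[OF assms] by blast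
  have "p ^ Suc a \<le> p ^ j" using j(1) p_gt_1 by (intro power_increasing) auto
  then show ?thesis unfolding j(2) by simp
qed

text \<open>Otherwise all p^(a+1) linear characters would have order at most p^(a-1), but only p^a
  characters have codegree that small.\<close>

lemma linear_of_order_p_a: "\<exists>\<theta>\<in>Irr G. degree \<theta> = 1 \<and> index (character_kernel G \<theta>) = p ^ a"
proof (rule ccontr)
  assume no: "\<not> ?thesis"
  have less: "\<exists>i\<le>a - 1. index (character_kernel G \<chi>) = p ^ i" if \<chi>: "\<chi> \<in> Irr G" "degree \<chi> = 1" for \<chi>
  proof -
    obtain i where i: "i \<le> a" "index (character_kernel G \<chi>) = p ^ i" using linear_in_up_to[OF \<chi>] by blast
    moreover from this have "i \<noteq> a" using no \<chi> by blast
    ultimately show ?thesis by (intro exI[of _ i]) simp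
  qed
  show False
  \<comment> \<open>The count does not cover codegree p^0; there order 1 leaves only the principal
    character.\<close>
  proof (cases "a = 1")
    case True
    obtain \<pi> where \<pi>: "{\<chi> \<in> Irr G. character_kernel G \<chi> = carrier G} = {\<pi>}" using principal_character by blast
    have "{\<chi> \<in> Irr G. degree \<chi> = 1} \<subseteq> {\<pi>}"
      unfolding \<pi>[symmetric]
    proof
      fix \<chi> assume "\<chi> \<in> {\<chi> \<in> Irr G. degree \<chi> = 1}"
      then have \<chi>: "\<chi> \<in> Irr G" "degree \<chi> = 1" by auto
      have K: "character_kernel G \<chi> \<subseteq> carrier G" by (auto simp: character_kernel_def)
      have "index (carrier G) > 0" by (rule index_pos[OF subgroup_self])
      moreover have "index (character_kernel G \<chi>) = 1" using less[OF \<chi>] True by simp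
      ultimately have "character_kernel G \<chi> = carrier G"
        by (intro index_eqD[OF kernel_subgroup[OF \<chi>(1)] subgroup_self K]) simp
      then show "\<chi> \<in> {\<chi> \<in> Irr G. character_kernel G \<chi> = carrier G}" using \<chi> by simp
    qed
    then have "card {\<chi> \<in> Irr G. degree \<chi> = 1} \<le> 1" using card_mono[of "{\<pi>}"] by simp
    then have "p ^ Suc a \<le> 1" unfolding card_degree_one index_D_eq .
    moreover have "1 < p ^ Suc a" using p_gt_1 by (intro one_less_power) auto
    ultimately show False by simp
  next
    case False
    have sub: "{\<chi> \<in> Irr G. degree \<chi> = 1} \<subseteq> up_to (a - 1)" unfolding up_to_def using less by auto
    have "1 \<le> a - 1" "a - 1 \<le> n" using False a_pos a_le by auto
    from card_mono[OF finite_up_to sub, unfolded card_degree_one index_D_eq card_up_to[OF this]]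
    have "p ^ Suc a \<le> p ^ Suc (a - 1)" .
    then have "Suc a \<le> Suc (a - 1)" using power_le_imp_le_exp[OF p_gt_1] by blast
    then show False using a_pos by simp
  qed
qed

text \<open>A linear character of order \<open>p ^ a\<close> splits the abelianization as \<open>\<langle>x\<rangle> \<times> \<langle>y\<rangle>\<close>.\<close>

lemma generators:
  obtains x y R where "x \<in> carrier G" "y \<in> R" "y \<notin> D" "R \<lhd> G" "D \<subseteq> R" "card R = p * card D"
    "x [^] (p ^ (a - 1)) \<notin> R" "x [^] (p ^ a) \<in> R" "y [^] p \<in> D"
    "\<forall>g\<in>carrier G. \<exists>i j. \<exists>d\<in>D. g = x [^] (i :: nat) \<otimes> (y [^] (j :: nat) \<otimes> d)"
proof -
  obtain \<theta> where l: "\<theta> \<in> Irr G" "degree \<theta> = 1" "index (character_kernel G \<theta>) = p ^ a"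
    using linear_of_order_p_a by blast
  define R where "R = character_kernel G \<theta>"
  have R: "R \<lhd> G" unfolding R_def by (rule kernel_normal[OF l(1)])
  note Rs = normal_imp_subgroup[OF R] and Ds = normal_imp_subgroup[OF normal_derived]
  have DR: "D \<subseteq> R" unfolding R_def using linear_iff_derived_le_kernel[OF l(1)] l(2) by simp
  have "p ^ a * card R = p ^ a * (p * card D)"
    using index_mult_card[OF Rs] index_mult_card[OF Ds] index_D_eq l(3) unfolding R_def[symmetric] by (simp add: mult_ac)
  then have cR: "card R = p * card D" using p_gt_1 by simp
  have aS: "p ^ a = p ^ Suc (a - 1)" using a_pos by simp
  \<comment> \<open>The value of \<theta> at x is a primitive root of unity of order p^a; a - 1 fits
    the successor in \<open>linear_primitive_value\<close>.\<close>
  obtain x where x: "x \<in> carrier G" "\<theta> x ^ (p ^ (a - 1)) \<noteq> 1"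
    and gx: "\<And>g. g \<in> carrier G \<Longrightarrow> \<exists>k. inv (x [^] (k::nat)) \<otimes> g \<in> R"
    using linear_primitive_value[OF l(1,2) prime, of "a - 1"] l(3) aS unfolding R_def by metis
  have xR: "x [^] (p ^ (a - 1)) \<notin> R"
    unfolding R_def using x linear_kernel_iff[OF l(1,2)] linear_character_pow[OF l(1,2) x(1)] by simp
  have xR': "x [^] (p ^ a) \<in> R" using pow_index_in_normal[OF R x(1)] l(3) unfolding R_def by simp
  have "card D < card R" using cR p_gt_1 card_subgroup_pos[OF Ds] by simp
  then have "\<not> R \<subseteq> D" using card_mono[OF finite_subgroup[OF Ds]] by (metis leD)
  then obtain y where y: "y \<in> R" "y \<notin> D" by blast
  have yG: "y \<in> carrier G" using y subgroup.subset[OF Rs] by blast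
  have yp: "y [^] p \<in> D" by (rule pow_mem_of_card[OF normal_derived Rs DR cR y(1)])
  interpret Q: finite_group "G Mod D" by (rule quotient_finite_group[OF normal_derived])
  interpret \<pi>: group_hom G "G Mod D" "\<lambda>g. D #> g" by (rule quotient_hom[OF normal_derived])
  let ?R = "(\<lambda>g. D #> g) ` R" and ?Y = "generate (G Mod D) {D #> y}"
  note im = card_image_quotient[OF normal_derived Rs DR]
  have Yc: "D #> y \<in> carrier (G Mod D)" by (rule \<pi>.hom_closed[OF yG])
  have Ys: "subgroup ?Y (G Mod D)" using Yc by (intro Q.generate_is_subgroup) simp
  have YR: "?Y \<subseteq> ?R" using y(1) by (intro Q.generate_subgroup_incl[OF _ im(1)]) simp
  have cR': "card ?R = p" using im(3) cR card_subgroup_pos[OF Ds] by simp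
  have "card ?Y dvd p" using Q.card_subgroup_dvd[OF Ys im(1) YR] cR' by simp
  moreover have "card ?Y \<noteq> 1"
  proof
    assume "card ?Y = 1"
    then obtain b where "?Y = {b}" by (auto simp: card_1_singleton_iff)
    then have "D #> y = D" using generate.incl[of "D #> y" "{D #> y}" "G Mod D"] subgroup.one_closed[OF Ys] by auto
    then show False using coset_eq_self_iff[OF Ds yG] y(2) by simp
  qed
  ultimately have "card ?Y = p" using prime by (metis prime_nat_iff)
  then have YR': "?Y = ?R" using YR cR' card_subset_eq[OF Q.finite_subgroup[OF im(1)]] by metis
  have gen: "\<exists>i j. \<exists>d\<in>D. g = x [^] (i :: nat) \<otimes> (y [^] (j :: nat) \<otimes> d)" if g: "g \<in> carrier G" for g
  proof -
    obtain k :: nat where k: "inv (x [^] k) \<otimes> g \<in> R" using gx[OF g] by blast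
    define r where "r = inv (x [^] k) \<otimes> g"
    have rG: "r \<in> carrier G" unfolding r_def using x g by simp
    have "D #> r \<in> ?Y" unfolding YR' r_def using k by blast
    then obtain j d where d: "d \<in> D" "r = d \<otimes> y [^] (j :: nat)"
      using mem_preimage_powers[OF normal_derived yG rG] by blast
    \<comment> \<open>Conjugation by y^j moves the factor from D to the right of the power of
      y.\<close>
    define d' where "d' = inv (y [^] j) \<otimes> d \<otimes> y [^] j"
    have dG: "d \<in> carrier G" using d(1) subgroup.subset[OF Ds] by blast
    have d': "d' \<in> D" unfolding d'_def using normal.inv_op_closed1[OF normal_derived _ d(1)] yG by simp
    have yd: "y [^] j \<otimes> d' = r"
      unfolding d'_def d(2) using yG dG by (simp add: m_assoc[symmetric])
    have "g = x [^] k \<otimes> r" unfolding r_def using x g by (simp add: m_assoc[symmetric])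
    then show ?thesis using yd d' by metis
  qed
  show ?thesis by (rule that[OF x(1) y R DR cR xR xR' yp ballI[OF gen]])
qed

text \<open>A nonlinear chi with L in its kernel has |G : ker chi| >= p^(a+1) chi(1) >= p^(a+2) = |G
  : N|, so its kernel cannot properly contain N.\<close>

lemma normal_above_maximal:
  assumes N: "N \<lhd> G" "N \<subseteq> D" "card D = p * card N" and L: "L \<lhd> G" "N \<subset> L"
  shows "D \<subseteq> L"
proof (rule ccontr)
  assume "\<not> D \<subseteq> L"
  then obtain \<chi> where \<chi>: "\<chi> \<in> Irr G" "L \<subseteq> character_kernel G \<chi>" "degree \<chi> \<noteq> 1"
    using nonlinear_character_exists[OF L(1)] by blast
  note Ns = normal_imp_subgroup[OF N(1)] and Ds = normal_imp_subgroup[OF normal_derived]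
  have "index N * card N = p ^ Suc a * p * card N"
    using index_mult_card[OF Ns] index_mult_card[OF Ds] N(3) index_D_eq by simp
  then have iN: "index N = p ^ Suc a * p" using card_subgroup_pos[OF Ns] by simp
  have "index N \<le> p ^ Suc a * degree \<chi>" unfolding iN using nonlinear_degree_ge[OF \<chi>(1,3)] by simp
  also have "\<dots> \<le> index (character_kernel G \<chi>)" by (rule nonlinear_index_ge[OF \<chi>(1,3)])
  finally have "N = character_kernel G \<chi>"
    using index_eqD[OF Ns kernel_subgroup[OF \<chi>(1)]] L(2) \<chi>(2) by blast
  then show False using L(2) \<chi>(2) by blast
qed

section \<open>Exclusion of a < n\<close>

lemma a_eq_n_if_D_trivial:
  assumes "D = {\<one>}"
  shows "a = n"
proof -
  have "D \<subseteq> character_kernel G \<chi>" if "\<chi> \<in> Irr G" for \<chi>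
    unfolding assms using subgroup.one_closed[OF kernel_subgroup[OF that]] by simp
  then have "{\<chi> \<in> Irr G. degree \<chi> = 1} = Irr G" using linear_iff_derived_le_kernel by blast
  from arg_cong[OF this, of card] have "p ^ Suc a = p ^ Suc n"
    unfolding card_degree_one index_D_eq card_Irr .
  then have "Suc a = Suc n" by (rule iffD1[OF power_inject_exp[OF p_gt_1]])
  then show ?thesis by simp
qed

text \<open>A character of codegree p^2 has degree p, since a nonlinear degree is a power of p below
  the codegree. Its kernel has index p^3, and the work lies in showing that this kernel is a
  subgroup of index p in D.\<close>

lemma not_small_abelianization:
  assumes a: "a = 1" and n: "a < n"
  shows False
proof -
  obtain k where k: "card (carrier G) = p ^ k" using p_group by blast
  obtain x y R where gens: "x \<in> carrier G" "y \<in> R" "y \<notin> D" "R \<lhd> G" "D \<subseteq> R" "card R = p * card D"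
    "x [^] (p ^ (a - 1)) \<notin> R" "x [^] (p ^ a) \<in> R" "y [^] p \<in> D"
    "\<forall>g\<in>carrier G. \<exists>i j. \<exists>d\<in>D. g = x [^] (i :: nat) \<otimes> (y [^] (j :: nat) \<otimes> d)"
    by (rule generators)
  note x = gens(1) and y = gens(2) and R = gens(4) and yp = gens(9) and gen = bspec[OF gens(10)]
  have yG: "y \<in> carrier G" using y subgroup.subset[OF normal_imp_subgroup[OF R]] by blast
  have "D \<noteq> {\<one>}" using a_eq_n_if_D_trivial n by blast
  then obtain N where N: "N \<lhd> G" "N \<subseteq> D" "card D = p * card N"
    using p_group_normal_index_p[OF prime k normal_derived] by blast
  note Ns = normal_imp_subgroup[OF N(1)] and Ds = normal_imp_subgroup[OF normal_derived]
  \<comment> \<open>The characters of codegree p^2; they number p^3 - p^2 because n is at least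
    2.\<close>
  let ?T = "up_to 2 - up_to 1"
  have T: "N \<subseteq> character_kernel G \<chi> \<and> degree \<chi> = p" if T: "\<chi> \<in> ?T" for \<chi>
  proof -
    have \<chi>: "\<chi> \<in> Irr G" using T unfolding up_to_def by blast
    have d: "degree \<chi> \<noteq> 1" using T up_to_a a \<chi> by simp
    obtain i where i: "i \<le> 2" "index (character_kernel G \<chi>) = p ^ i * degree \<chi>"
      using DiffD1[OF T] unfolding up_to_def by blast
    have "\<not> i \<le> 1" using T i(2) \<chi> unfolding up_to_def by blast
    then have i2: "i = 2" using i(1) by simp
    obtain e where e: "degree \<chi> = p ^ e" using degree_prime_power[OF \<chi>] by blast
    have "p ^ e < p ^ 2" using nonlinear_degree_less[OF \<chi> d i(2)] e i2 by simp
    then have "e < 2" using power_less_imp_less_exp[OF p_gt_1] by blast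
    moreover have "e \<noteq> 0" using d e by (cases e) auto
    ultimately have "e = 1" by simp
    then have deg: "degree \<chi> = p" using e by simp
    let ?K = "character_kernel G \<chi>"
    note Ks = kernel_subgroup[OF \<chi>]
    have iK: "index ?K = p ^ 2 * p" using i(2) i2 deg by simp
    let ?A = "{\<psi> \<in> Irr G. degree \<psi> = 1 \<and> ?K \<subseteq> character_kernel G \<psi>}"
    let ?B = "{\<psi>. \<psi> \<in> Irr G \<and> ?K \<subseteq> character_kernel G \<psi>}"
    have fB: "finite ?B" using finite_Irr by simp
    have "index ?K = (\<Sum>\<psi>\<in>?B. degree \<psi> ^ 2)" by (rule index_eq_sum_degree_squares[OF kernel_normal[OF \<chi>]])
    also have "\<dots> = (\<Sum>\<psi>\<in>?B - ?A. degree \<psi> ^ 2) + (\<Sum>\<psi>\<in>?A. degree \<psi> ^ 2)"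
      using fB by (intro sum.subset_diff) auto
    also have "(\<Sum>\<psi>\<in>?A. degree \<psi> ^ 2) = card ?A" by simp
    finally have sum: "p ^ 2 * p = (\<Sum>\<psi>\<in>?B - ?A. degree \<psi> ^ 2) + card ?A" unfolding iK .
    \<comment> \<open>Modulo p^2 the degree equation of the kernel counts only linear characters.
      Their number is a positive multiple of p^2, so all p^2 linear characters of G are trivial on
      \<open>?K\<close>.\<close>
    have "p ^ 2 dvd (\<Sum>\<psi>\<in>?B - ?A. degree \<psi> ^ 2)"
    proof (rule dvd_sum)
      fix \<psi> assume "\<psi> \<in> ?B - ?A"
      then have "p dvd degree \<psi>" using nonlinear_degree_dvd by blast
      then show "p ^ 2 dvd degree \<psi> ^ 2" by (rule dvd_power_same)
    qed
    then have "p ^ 2 dvd card ?A"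
      using dvd_triv_left[of "p ^ 2" p] unfolding sum by (simp only: dvd_add_right_iff)
    moreover have "card ?A > 0"
    proof -
      obtain \<pi> where "\<pi> \<in> Irr G" "character_kernel G \<pi> = carrier G" "degree \<pi> = 1" using principal_character by blast
      then have "\<pi> \<in> ?A" using subgroup.subset[OF Ks] by simp
      moreover have "finite ?A" using finite_Irr by simp
      ultimately show ?thesis by (auto simp: card_gt_0_iff)
    qed
    ultimately have "p ^ 2 \<le> card ?A" by (rule dvd_imp_le)
    moreover have "card {\<psi> \<in> Irr G. degree \<psi> = 1} = p ^ 2" using card_degree_one index_D_eq a by (simp add: numeral_2_eq_2)
    ultimately have all: "?A = {\<psi> \<in> Irr G. degree \<psi> = 1}"
      using finite_Irr by (intro card_seteq) auto
    \<comment> \<open>All linear characters are trivial on \<open>?K <#> D\<close>, and counting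
      them gives |G : D| <= |G : K D|.\<close>
    have KD: "?K \<subseteq> D"
    proof -
      let ?M = "?K <#> D"
      have M: "?M \<lhd> G" by (rule normal_subgroup_set_mult_closed[OF kernel_normal[OF \<chi>] normal_derived])
      have DM: "D \<subseteq> ?M"
      proof
        fix d assume "d \<in> D"
        then have "d = \<one> \<otimes> d" using subgroup.subset[OF Ds] by auto
        then show "d \<in> ?M" using \<open>d \<in> D\<close> subgroup.one_closed[OF Ks] unfolding set_mult_def by blast
      qed
      have "{\<psi> \<in> Irr G. degree \<psi> = 1} \<subseteq> {\<psi> \<in> Irr G. ?M \<subseteq> character_kernel G \<psi>}"
      proof
        fix \<psi> assume \<psi>: "\<psi> \<in> {\<psi> \<in> Irr G. degree \<psi> = 1}"
        then have I: "\<psi> \<in> Irr G" by simp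
        have "?K \<subseteq> character_kernel G \<psi>" "D \<subseteq> character_kernel G \<psi>"
          using \<psi> all linear_iff_derived_le_kernel by blast+
        then have "?M \<subseteq> character_kernel G \<psi>"
          using subgroup.m_closed[OF kernel_subgroup[OF I]] unfolding set_mult_def by blast
        then show "\<psi> \<in> {\<psi> \<in> Irr G. ?M \<subseteq> character_kernel G \<psi>}" using I by simp
      qed
      then have "index D \<le> index ?M"
        unfolding card_degree_one[symmetric] card_linear_characters[OF M DM, symmetric]
        using finite_Irr by (intro card_mono) auto
      then have DeqM: "D = ?M" using index_eqD[OF Ds normal_imp_subgroup[OF M] DM] by simp
      show ?thesis
      proof
        fix u assume u: "u \<in> ?K"
        then have "u = u \<otimes> \<one>" using subgroup.subset[OF Ks] by auto
        then have "u \<in> ?M" using u subgroup.one_closed[OF Ds] unfolding set_mult_def by blast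
        then show "u \<in> D" using DeqM by blast
      qed
    qed
    have "p ^ 2 * card D = p ^ 2 * (p * card ?K)"
      using index_mult_card[OF Ks] index_mult_card[OF Ds] iK index_D_eq a by (simp add: numeral_2_eq_2)
    then have cDK: "card D = p * card ?K" using p_gt_1 by simp
    have "N = ?K"
      by (rule derived_index_p_unique[OF prime k x yG _ yp N kernel_normal[OF \<chi>] KD cDK]) (rule gen)
    then show ?thesis using deg by simp
  qed
  have "index N * card N = p ^ 2 * p * card N"
    using index_mult_card[OF Ns] index_mult_card[OF Ds] N(3) index_D_eq a by (simp add: numeral_2_eq_2)
  then have iN: "index N = p ^ 2 * p" using card_subgroup_pos[OF Ns] by simp
  have "card ?T = p ^ 3 - p ^ 2"
  proof -
    have sub: "up_to 1 \<subseteq> up_to 2"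
    proof
      fix \<chi> assume "\<chi> \<in> up_to 1"
      then obtain i where "\<chi> \<in> Irr G" "i \<le> 1" "index (character_kernel G \<chi>) = p ^ i * degree \<chi>"
        unfolding up_to_def by blast
      moreover from this have "i \<le> 2" by simp
      ultimately show "\<chi> \<in> up_to 2" unfolding up_to_def by blast
    qed
    have "card (up_to 1) = p ^ 2" "card (up_to 2) = p ^ 3"
      using card_up_to[of 1] card_up_to[of 2] a n by (simp_all add: numeral_2_eq_2 numeral_3_eq_3)
    then show ?thesis using card_Diff_subset[OF finite_up_to sub] by simp
  qed
  then have "(p ^ 3 - p ^ 2) * p ^ 2 = (\<Sum>\<chi>\<in>?T. degree \<chi> ^ 2)" using T by simp
  also have "\<dots> \<le> (\<Sum>\<chi> | \<chi> \<in> Irr G \<and> N \<subseteq> character_kernel G \<chi>. degree \<chi> ^ 2)"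
    using finite_Irr T by (intro sum_mono2) (auto simp: up_to_def)
  also have "\<dots> = p ^ 2 * p" using index_eq_sum_degree_squares[OF N(1)] iN by simp
  finally have le: "(p ^ 3 - p ^ 2) * p ^ 2 \<le> p ^ 2 * p" .
  \<comment> \<open>p^4 (p - 1) <= p^3 would give p (p - 1) <= 1.\<close>
  have "p ^ 3 = p ^ 2 * p" by (simp add: power3_eq_cube power2_eq_square)
  then have "p ^ 3 - p ^ 2 = p ^ 2 * (p - 1)" by (simp add: diff_mult_distrib2)
  then have "p ^ 2 * (p ^ 2 * (p - 1)) \<le> p ^ 2 * p" using le by (simp only: mult.commute)
  then have "p ^ 2 * (p - 1) \<le> p" using p_gt_1 by (subst (asm) mult_le_cancel1) simp
  then have "p * (p * (p - 1)) \<le> p * 1" by (simp only: power2_eq_square mult.assoc mult_1_right)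
  then have "p * (p - 1) \<le> 1" using p_gt_1 by simp
  moreover have "p * (p - 1) \<ge> 2 * 1" using p_gt_1 by (intro mult_le_mono) auto
  ultimately show False by simp
qed

lemma a_eq_n: "a = n"
proof (rule ccontr)
  assume "a \<noteq> n"
  then have an: "a < n" using a_le by simp
  then have a1: "a \<noteq> 1" using not_small_abelianization by blast
  obtain k where k: "card (carrier G) = p ^ k" using p_group by blast
  obtain x y R where gens: "x \<in> carrier G" "y \<in> R" "y \<notin> D" "R \<lhd> G" "D \<subseteq> R" "card R = p * card D"
    "x [^] (p ^ (a - 1)) \<notin> R" "x [^] (p ^ a) \<in> R" "y [^] p \<in> D"
    "\<forall>g\<in>carrier G. \<exists>i j. \<exists>d\<in>D. g = x [^] (i :: nat) \<otimes> (y [^] (j :: nat) \<otimes> d)"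
    by (rule generators)
  note x = gens(1) and y = gens(2) and R = gens(4,5) and xR = gens(7) and yp = gens(9) and gen = bspec[OF gens(10)]
  note Rs = normal_imp_subgroup[OF R(1)] and Ds = normal_imp_subgroup[OF normal_derived]
  have yG: "y \<in> carrier G" using y subgroup.subset[OF Rs] by blast
  have Dn: "D \<noteq> {\<one>}" using a_eq_n_if_D_trivial an by blast
  \<comment> \<open>Here a >= 2 enters: x^(p^(a-1)) is a power of x^p.\<close>
  have xp: "x [^] p \<notin> D"
  proof
    assume "x [^] p \<in> D"
    then have "x [^] p \<in> R" using R(2) by blast
    then have "(x [^] p) [^] (p ^ (a - 2)) \<in> R" by (rule subgroup_nat_pow_closed[OF Rs])
    moreover have "a - 1 = Suc (a - 2)" using a_pos a1 by simp
    then have "p * p ^ (a - 2) = p ^ (a - 1)" by simp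
    ultimately show False using xR x by (simp add: nat_pow_pow)
  qed
  have cD: "card D = p"
  proof (rule derived_prime_order[OF prime k x yG _ yp xp Dn])
    fix g assume "g \<in> carrier G"
    then show "\<exists>i j. \<exists>d\<in>D. g = x [^] (i :: nat) \<otimes> (y [^] (j :: nat) \<otimes> d)" by (rule gen)
  next
    fix N L assume "N \<lhd> G" "N \<subseteq> D" "card D = p * card N" "L \<lhd> G" "N \<subset> L"
    then show "D \<subseteq> L" by (rule normal_above_maximal)
  qed
  have cG: "card (carrier G) = p ^ Suc (Suc a)" using index_mult_card[OF Ds] cD index_D_eq by (simp add: mult_ac)
  \<comment> \<open>p^(a+2) <= p^(n+1), as a < n. The degree equation then forces every degree to be
    1.\<close>
  have le: "card (carrier G) \<le> card (Irr G)"
    unfolding cG card_Irr using an p_gt_1 by (intro power_increasing) auto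
  have "{\<chi> \<in> Irr G. degree \<chi> = 1} = Irr G"
  proof (rule ccontr)
    assume "\<not> ?thesis"
    then obtain \<chi> where \<chi>: "\<chi> \<in> Irr G" "degree \<chi> \<noteq> 1" by blast
    then have "1 < degree \<chi> ^ 2" using degree_pos[OF \<chi>(1)] by (intro one_less_power) auto
    then have "\<exists>\<psi>\<in>Irr G. 1 < degree \<psi> ^ 2" using \<chi>(1) by blast
    moreover have "\<forall>\<psi>\<in>Irr G. 1 \<le> degree \<psi> ^ 2" using degree_pos by (simp add: Suc_le_eq)
    ultimately have "(\<Sum>\<psi>\<in>Irr G. 1) < (\<Sum>\<psi>\<in>Irr G. degree \<psi> ^ 2)"
      by (intro sum_strict_mono_ex1 finite_Irr)
    then show False using le card_eq_sum_degree_squares by simp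
  qed
  from arg_cong[OF this, of card] have "p ^ Suc a = p ^ Suc n"
    unfolding card_degree_one index_D_eq card_Irr .
  then have "Suc a = Suc n" by (rule iffD1[OF power_inject_exp[OF p_gt_1]])
  then show False using an by simp
qed

text \<open>With a = n the linear characters are all of \<open>Irr G\<close>, and |G| = |Irr G| = |G
  : D|.\<close>

lemma D_trivial: "D = {\<one>}"
proof -
  have "card {\<chi> \<in> Irr G. degree \<chi> = 1} = card (Irr G)"
    unfolding card_degree_one index_D_eq card_Irr a_eq_n ..
  then have all: "{\<chi> \<in> Irr G. degree \<chi> = 1} = Irr G" by (intro card_subset_eq[OF finite_Irr]) blast+
  have "degree \<chi> ^ 2 = 1" if "\<chi> \<in> Irr G" for \<chi>
  proof -
    have "degree \<chi> = 1" using that all by blast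
    then show ?thesis by simp
  qed
  then have "card (carrier G) = card (Irr G)" unfolding card_eq_sum_degree_squares by simp
  then have "card (carrier G) = index D" unfolding card_Irr index_D_eq a_eq_n .
  then have "card D = 1"
    using index_mult_card[OF normal_imp_subgroup[OF normal_derived]] card_carrier_pos by simp
  then obtain u where "D = {u}" by (auto simp: card_1_singleton_iff)
  then show ?thesis using subgroup.one_closed[OF normal_imp_subgroup[OF normal_derived]] by simp
qed

end

section \<open>The isomorphism with the product of cyclic groups\<close>

lemma (in monoid) pow_mod:
  assumes "x \<in> carrier G" "x [^] (m :: nat) = \<one>"
  shows "x [^] (k mod m) = x [^] (k :: nat)"
proof -
  have "x [^] k = x [^] (m * (k div m) + k mod m)" by simp
  also have "\<dots> = (x [^] m) [^] (k div m) \<otimes> x [^] (k mod m)"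
    using assms(1) by (simp only: nat_pow_mult nat_pow_pow nat_pow_closed)
  finally show ?thesis using assms by simp
qed

text \<open>Shaped after the addition of \<open>integer_mod_group\<close>, whose elements are the
  integers from 0 to m - 1.\<close>

lemma (in monoid) pow_nat_mod_add:
  assumes "x \<in> carrier G" "x [^] (m :: nat) = \<one>" "0 \<le> i" "0 \<le> j"
  shows "x [^] nat ((i + j) mod int m) = x [^] nat i \<otimes> x [^] nat j"
proof -
  have "nat ((i + j) mod int m) = (nat i + nat j) mod m"
    using assms(3,4) by (simp add: nat_mod_distrib nat_add_distrib)
  then show ?thesis
    by (simp only: pow_mod[OF assms(1,2)] nat_pow_mult[OF assms(1)])
qed

lemma pow_DirProd: "(u, v) [^]\<^bsub>G \<times>\<times> H\<^esub> (k :: nat) = (u [^]\<^bsub>G\<^esub> k, v [^]\<^bsub>H\<^esub> k)"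
  by (induction k) (simp_all add: nat_pow_def)

context codegree_like_rank_two_abelianization
begin

lemma card_carrier_eq: "card (carrier G) = p ^ Suc n"
  using index_mult_card[OF normal_imp_subgroup[OF normal_derived]] index_D_eq a_eq_n D_trivial by simp

lemma commutative: "g \<in> carrier G \<Longrightarrow> h \<in> carrier G \<Longrightarrow> g \<otimes> h = h \<otimes> g"
  using ex_commutator[of g h] D_trivial by auto

theorem iso_product_abelianization: "integer_mod_group (p ^ n) \<times>\<times> integer_mod_group p \<cong> G"
proof -
  obtain x y R where gens: "x \<in> carrier G" "y \<in> R" "y \<notin> D" "R \<lhd> G" "D \<subseteq> R" "card R = p * card D"
    "x [^] (p ^ (a - 1)) \<notin> R" "x [^] (p ^ a) \<in> R" "y [^] p \<in> D"
    "\<forall>g\<in>carrier G. \<exists>i j. \<exists>d\<in>D. g = x [^] (i :: nat) \<otimes> (y [^] (j :: nat) \<otimes> d)"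
    by (rule generators)
  note x = gens(1) and Rs = normal_imp_subgroup[OF gens(4)]
  have y: "y \<in> carrier G" using gens(2) subgroup.subset[OF Rs] by blast
  have cR: "card R = p" using gens(6) D_trivial by simp
  have yp: "y [^] p = \<one>" using gens(9) D_trivial by simp
  have gen: "\<exists>i j. g = x [^] (i :: nat) \<otimes> y [^] (j :: nat)" if g: "g \<in> carrier G" for g
  proof -
    obtain i j :: nat and d where "d \<in> D" "g = x [^] i \<otimes> (y [^] j \<otimes> d)" using bspec[OF gens(10) g] by blast
    then have "g = x [^] i \<otimes> y [^] j" using D_trivial y by simp
    then show ?thesis by blast
  qed
  define w where "w = x [^] (p ^ n)"
  have w: "w \<in> R" "w \<in> carrier G" unfolding w_def using gens(8) a_eq_n x by simp_all
  \<comment> \<open>Otherwise w generates R, which has prime order and contains y; then G consists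
    of powers of x, contrary to the noncyclic abelianization.\<close>
  have w1: "w = \<one>"
  proof (rule ccontr)
    assume "w \<noteq> \<one>"
    let ?W = "generate G {w}"
    have W: "subgroup ?W G" using w by (intro generate_is_subgroup) simp
    have WR: "?W \<subseteq> R" using w by (intro generate_subgroup_incl[OF _ Rs]) simp
    have "card ?W dvd p" using card_subgroup_dvd[OF W Rs WR] cR by simp
    moreover have "card ?W \<noteq> 1"
      using generate_pow_card[OF w(2)] ord_eq_1[OF w(2)] \<open>w \<noteq> \<one>\<close> by simp
    ultimately have "card ?W = p" using prime by (metis prime_nat_iff)
    then have "?W = R" using WR cR card_subset_eq[OF finite_subgroup[OF Rs]] by metis
    then obtain l :: nat where l: "y = w [^] l" using gens(2) generate_eq_powers[OF w(2)] by blast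
    have "\<exists>k. inv (x [^] (k :: nat)) \<otimes> g \<in> D" if g: "g \<in> carrier G" for g
    proof -
      obtain i j :: nat where ij: "g = x [^] i \<otimes> y [^] j" using gen[OF g] by blast
      have "g = x [^] (i + p ^ n * l * j)"
        unfolding ij l w_def using x by (simp add: nat_pow_pow nat_pow_mult)
      then have "inv (x [^] (i + p ^ n * l * j)) \<otimes> g = \<one>" using x by simp
      then show ?thesis using D_trivial by blast
    qed
    then show False using not_cyclic_abelianization[OF x] by blast
  qed
  define f where "f = (\<lambda>(i, j). x [^] nat i \<otimes> y [^] nat j)"
  let ?B = "integer_mod_group (p ^ n) \<times>\<times> integer_mod_group p"
  have pn: "p ^ n > 0" and p0: "p > 0" using p_gt_1 by auto
  have cB: "carrier ?B = {0..<int (p ^ n)} \<times> {0..<int p}"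
    using pn p0 by (simp add: carrier_integer_mod_group)
  have hom: "f \<in> hom ?B G"
  proof (rule homI)
    show "f b \<in> carrier G" if "b \<in> carrier ?B" for b using x y by (cases b) (simp add: f_def)
    fix b c assume b: "b \<in> carrier ?B" and c: "c \<in> carrier ?B"
    obtain i j k l where ij: "b = (i, j)" "c = (k, l)" by (metis surj_pair)
    have nn: "0 \<le> i" "0 \<le> j" "0 \<le> k" "0 \<le> l" using b c unfolding cB ij by auto
    have "f (b \<otimes>\<^bsub>?B\<^esub> c) = x [^] nat i \<otimes> x [^] nat k \<otimes> (y [^] nat j \<otimes> y [^] nat l)"
      using pow_nat_mod_add[OF x w1[unfolded w_def] nn(1,3)] pow_nat_mod_add[OF y yp nn(2,4)]
      unfolding ij f_def by simp
    also have "\<dots> = x [^] nat i \<otimes> (x [^] nat k \<otimes> y [^] nat j) \<otimes> y [^] nat l"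
      using x y by (simp add: m_assoc)
    also have "x [^] nat k \<otimes> y [^] nat j = y [^] nat j \<otimes> x [^] nat k"
      using x y by (intro commutative) simp_all
    also have "x [^] nat i \<otimes> (y [^] nat j \<otimes> x [^] nat k) \<otimes> y [^] nat l = f b \<otimes> f c"
      unfolding ij f_def using x y by (simp add: m_assoc)
    finally show "f (b \<otimes>\<^bsub>?B\<^esub> c) = f b \<otimes> f c" .
  qed
  have surj: "f ` carrier ?B = carrier G"
  proof
    show "f ` carrier ?B \<subseteq> carrier G" using hom by (auto simp: hom_def)
    show "carrier G \<subseteq> f ` carrier ?B"
    proof
      fix g assume "g \<in> carrier G"
      then obtain i j :: nat where ij: "g = x [^] i \<otimes> y [^] j" using gen by blast
      have "f (int (i mod p ^ n), int (j mod p)) = g"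
        unfolding ij f_def using pow_mod[OF x w1[unfolded w_def]] pow_mod[OF y yp] by simp
      moreover have "(int (i mod p ^ n), int (j mod p)) \<in> carrier ?B"
        unfolding cB using pn p0 by (simp del: of_nat_power)
      ultimately show "g \<in> f ` carrier ?B" by blast
    qed
  qed
  have "card (carrier ?B) = p ^ Suc n" unfolding cB by (simp add: card_cartesian_product del: of_nat_power)
  \<comment> \<open>A surjection between sets of the same size p^(n+1) is injective.\<close>
  then have "card (f ` carrier ?B) = card (carrier ?B)" unfolding surj by (simp only: card_carrier_eq)
  moreover have "finite (carrier ?B)" unfolding cB by simp
  ultimately have "inj_on f (carrier ?B)" by (intro eq_card_imp_inj_on)
  then have "f \<in> iso ?B G" using hom surj by (simp add: iso_def bij_betw_def)
  then show ?thesis by (rule is_isoI)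
qed

end

context codegree_like_rank_two
begin

theorem iso_product: "integer_mod_group (p ^ n) \<times>\<times> integer_mod_group p \<cong> G"
proof -
  obtain a where a: "1 \<le> a" "a \<le> n" "index D = p ^ Suc a" using index_D by blast
  interpret codegree_like_rank_two_abelianization G p n a by unfold_locales (use a in auto)
  show ?thesis by (rule iso_product_abelianization)
qed

end

section \<open>Codegrees of the abelian group\<close>

context finite_group
begin

text \<open>The codegree of a linear character is its order, so codegree at most p^j means being
  trivial on the subgroup P of p^j-th powers, and there are |G : P| = p^(j+1) such
  characters.\<close>

lemma abelian_codegrees:
  assumes comm: "comm_group G" and p: "prime p" and n: "n > 0" and card: "card (carrier G) = p ^ Suc n"
    and exponent: "\<And>g. g \<in> carrier G \<Longrightarrow> g [^] (p ^ n) = \<one>"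
    and powers: "\<And>j. 1 \<le> j \<Longrightarrow> j \<le> n \<Longrightarrow> card ((\<lambda>g. g [^] (p ^ j)) ` carrier G) = p ^ (n - j)"
  shows "codegree_like_rank_two G p n"
proof -
  interpret comm_group G by (rule comm)
  have p1: "p > 1" by (rule prime_gt_1_nat[OF p])
  have D: "derived G (carrier G) = {\<one>}" by (rule derived_eq_singleton[OF subset_refl])
  have linear: "degree \<chi> = 1" if "\<chi> \<in> Irr G" for \<chi>
    using linear_iff_derived_le_kernel[OF that] subgroup.one_closed[OF kernel_subgroup[OF that]] D by simp
  have index: "\<exists>i. index (character_kernel G \<chi>) = p ^ i" if "\<chi> \<in> Irr G" for \<chi>
    using index_mult_card[OF kernel_subgroup[OF that]] card divides_primepow_nat[OF p] by (metis dvd_triv_left)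
  have bound: "i \<le> j" if "\<chi> \<in> Irr G" "index (character_kernel G \<chi>) = p ^ i"
      "\<And>g. g \<in> carrier G \<Longrightarrow> \<chi> g ^ (p ^ j) = 1" for \<chi> i j
  proof -
    have "p ^ i \<le> p ^ j"
      unfolding that(2)[symmetric] using p1 by (intro linear_index_le[OF that(1) linear[OF that(1)] _ that(3)]) auto
    then show ?thesis using power_le_imp_le_exp[OF p1] by blast
  qed
  show ?thesis
  proof
    fix \<chi> assume \<chi>: "\<chi> \<in> Irr G"
    obtain i where i: "index (character_kernel G \<chi>) = p ^ i" using index[OF \<chi>] by blast
    have "\<chi> g ^ (p ^ n) = 1" if "g \<in> carrier G" for g
      using linear_character_pow[OF \<chi> linear[OF \<chi>] that, of "p ^ n"] exponent[OF that]
        linear_character_one[OF \<chi> linear[OF \<chi>]] by simp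
    then have "i \<le> n" by (rule bound[OF \<chi> i])
    then show "\<exists>j\<le>n. index (character_kernel G \<chi>) = p ^ j * degree \<chi>" using i linear[OF \<chi>] by auto
  next
    fix j assume j: "1 \<le> j" "j \<le> n"
    define P where "P = (\<lambda>g. g [^] (p ^ j)) ` carrier G"
    have "(\<lambda>g. g [^] (p ^ j)) \<in> hom G G" by (intro homI) (simp_all add: nat_pow_distrib)
    then interpret h: group_hom G G "\<lambda>g. g [^] (p ^ j)" by unfold_locales
    have "subgroup P G" unfolding P_def by (rule h.subgroup_img_is_subgroup[OF subgroup_self])
    then have P: "P \<lhd> G" by (rule subgroup_imp_normal)
    have "{\<chi> \<in> Irr G. \<exists>i\<le>j. index (character_kernel G \<chi>) = p ^ i * degree \<chi>} = {\<chi> \<in> Irr G. P \<subseteq> character_kernel G \<chi>}"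
    proof (intro Collect_cong conj_cong refl)
      fix \<chi> assume \<chi>: "\<chi> \<in> Irr G"
      note d = linear[OF \<chi>]
      have P_iff: "P \<subseteq> character_kernel G \<chi> \<longleftrightarrow> (\<forall>g\<in>carrier G. \<chi> g ^ (p ^ j) = 1)"
        unfolding P_def using linear_kernel_iff[OF \<chi> d] linear_character_pow[OF \<chi> d] by (simp add: image_subset_iff)
      show "(\<exists>i\<le>j. index (character_kernel G \<chi>) = p ^ i * degree \<chi>) \<longleftrightarrow> P \<subseteq> character_kernel G \<chi>"
      proof
        assume "\<exists>i\<le>j. index (character_kernel G \<chi>) = p ^ i * degree \<chi>"
        then obtain i where i: "i \<le> j" "index (character_kernel G \<chi>) = p ^ i" using d by auto
        have "p ^ j = p ^ i * p ^ (j - i)" using i(1) by (simp add: power_add[symmetric])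
        then have "\<chi> g ^ (p ^ j) = 1" if "g \<in> carrier G" for g
          using linear_pow_index[OF \<chi> d that] i(2) by (simp add: power_mult)
        then show "P \<subseteq> character_kernel G \<chi>" unfolding P_iff by blast
      next
        assume "P \<subseteq> character_kernel G \<chi>"
        then have v: "\<chi> g ^ (p ^ j) = 1" if "g \<in> carrier G" for g using that unfolding P_iff by blast
        obtain i where i: "index (character_kernel G \<chi>) = p ^ i" using index[OF \<chi>] by blast
        show "\<exists>i\<le>j. index (character_kernel G \<chi>) = p ^ i * degree \<chi>"
          using bound[OF \<chi> i v] i d by auto
      qed
    qed
    then have "card {\<chi> \<in> Irr G. \<exists>i\<le>j. index (character_kernel G \<chi>) = p ^ i * degree \<chi>} = local.index P"
      using card_linear_characters[OF P] D subgroup.one_closed[OF \<open>subgroup P G\<close>] by simp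
    also have "\<dots> = p ^ Suc j"
    proof -
      have "Suc n = Suc j + (n - j)" using j by simp
      then have "p ^ Suc n = p ^ Suc j * p ^ (n - j)" by (metis power_add)
      then have "local.index P * p ^ (n - j) = p ^ Suc j * p ^ (n - j)"
        using index_mult_card[OF \<open>subgroup P G\<close>] powers[OF j] card unfolding P_def by simp
      then show ?thesis using p1 by simp
    qed
    finally show "card {\<chi> \<in> Irr G. \<exists>i\<le>j. index (character_kernel G \<chi>) = p ^ i * degree \<chi>} = p ^ Suc j" .
  qed (use p n in auto)
qed

text \<open>Rewrites the cumulative count in terms of multiplicities, the data that a pseudo-algebra
  records. Distinct i give distinct codegrees because p > 1.\<close>

lemma card_codegree_le:
  assumes "p > 1"
  shows "card {\<chi> \<in> Irr G. \<exists>i\<le>j. index (character_kernel G \<chi>) = p ^ i * degree \<chi>} =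
    (\<Sum>i\<le>j. codegree_multiplicity G (of_nat (p ^ i)))"
proof -
  have "{\<chi> \<in> Irr G. \<exists>i\<le>j. index (character_kernel G \<chi>) = p ^ i * degree \<chi>} =
      (\<Union>i\<in>{..j}. {\<chi> \<in> Irr G. codegree G \<chi> = of_nat (p ^ i)})"
    using codegree_eq_iff by blast
  moreover have "card (\<Union>i\<in>{..j}. {\<chi> \<in> Irr G. codegree G \<chi> = of_nat (p ^ i)}) =
      (\<Sum>i\<le>j. card {\<chi> \<in> Irr G. codegree G \<chi> = of_nat (p ^ i)})"
  proof (rule card_UN_disjoint)
    show "\<forall>i\<in>{..j}. \<forall>l\<in>{..j}. i \<noteq> l \<longrightarrow>
        {\<chi> \<in> Irr G. codegree G \<chi> = of_nat (p ^ i)} \<inter> {\<chi> \<in> Irr G. codegree G \<chi> = of_nat (p ^ l)} = {}"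
    proof (intro ballI impI)
      fix i l :: nat assume "i \<noteq> l"
      then have "p ^ i \<noteq> p ^ l" using power_inject_exp[OF assms] by simp
      then have "(of_nat (p ^ i) :: complex) \<noteq> of_nat (p ^ l)" by (simp only: of_nat_eq_iff not_False_eq_True)
      then show "{\<chi> \<in> Irr G. codegree G \<chi> = of_nat (p ^ i)} \<inter> {\<chi> \<in> Irr G. codegree G \<chi> = of_nat (p ^ l)} = {}"
        by auto
    qed
  qed (use finite_Irr in auto)
  ultimately show ?thesis by (simp add: codegree_multiplicity_def)
qed

end

section \<open>Transfer between groups with equal pseudo-algebras\<close>

lemma Cod_eq_fst_image: "Cod G = fst ` group_pseudo_algebra G"
proof -
  have "group_pseudo_algebra G = (\<lambda>d. (d, codegree_multiplicity G d)) ` Cod G"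
    unfolding group_pseudo_algebra_def by blast
  then show ?thesis by (simp add: image_image)
qed

text \<open>A pseudo-algebra lists only the codegrees that occur; elsewhere both multiplicities are
  0, so the equality extends to every d.\<close>

lemma group_pseudo_algebra_eqD:
  assumes "group_pseudo_algebra G = group_pseudo_algebra A"
  shows "Cod G = Cod A" "codegree_multiplicity G d = codegree_multiplicity A d"
proof -
  show CA: "Cod G = Cod A" unfolding Cod_eq_fst_image assms ..
  show "codegree_multiplicity G d = codegree_multiplicity A d"
  proof (cases "d \<in> Cod G")
    case True
    then have "(d, codegree_multiplicity G d) \<in> group_pseudo_algebra A"
      unfolding assms[symmetric] unfolding group_pseudo_algebra_def by simp
    then show ?thesis unfolding group_pseudo_algebra_def by simp
  next
    case False
    moreover from this have "d \<notin> Cod A" by (simp only: CA not_False_eq_True)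
    ultimately have "{\<chi> \<in> Irr G. codegree G \<chi> = d} = {}" "{\<chi> \<in> Irr A. codegree A \<chi> = d} = {}"
      unfolding Cod_def by auto
    then show ?thesis unfolding codegree_multiplicity_def by (simp only: card.empty)
  qed
qed

lemma codegree_like_rank_two_transfer:
  assumes "finite_group G" and "codegree_like_rank_two A p n"
    and eq: "group_pseudo_algebra G = group_pseudo_algebra A"
  shows "codegree_like_rank_two G p n"
proof -
  interpret G: finite_group G by fact
  interpret A: codegree_like_rank_two A p n by fact
  show ?thesis
  proof
    fix \<chi> assume \<chi>: "\<chi> \<in> Irr G"
    have "codegree G \<chi> \<in> Cod A" using \<chi> group_pseudo_algebra_eqD(1)[OF eq] unfolding Cod_def by blast
    then obtain \<psi> where \<psi>: "\<psi> \<in> Irr A" "codegree G \<chi> = codegree A \<psi>" unfolding Cod_def by blast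
    obtain j where "j \<le> n" "A.index (character_kernel A \<psi>) = p ^ j * A.degree \<psi>" using A.codegrees[OF \<psi>(1)] by blast
    then show "\<exists>j\<le>n. G.index (character_kernel G \<chi>) = p ^ j * G.degree \<chi>"
      using A.codegree_eq_iff[OF \<psi>(1)] G.codegree_eq_iff[OF \<chi>] \<psi>(2) by metis
  next
    fix j assume j: "1 \<le> j" "j \<le> n"
    show "card {\<chi> \<in> Irr G. \<exists>i\<le>j. G.index (character_kernel G \<chi>) = p ^ i * G.degree \<chi>} = p ^ Suc j"
      unfolding G.card_codegree_le[OF A.p_gt_1] group_pseudo_algebra_eqD(2)[OF eq]
        A.card_codegree_le[OF A.p_gt_1, symmetric] by (rule A.codegree_count[OF j])
  qed (use A.prime A.n_pos in auto)
qed

lemma codegree_like_rank_two_product: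
  assumes "group A" and p: "prime p" and n: "n > 0"
    and iso: "A \<cong> integer_mod_group (p ^ n) \<times>\<times> integer_mod_group p"
  shows "codegree_like_rank_two A p n"
proof -
  interpret A: group A by fact
  let ?B = "integer_mod_group (p ^ n) \<times>\<times> integer_mod_group p"
  have p1: "p > 1" by (rule prime_gt_1_nat[OF p])
  have pn: "p ^ n > 0" using p1 by simp
  interpret B: group ?B by (intro DirProd_group) simp_all
  have B_comm: "b \<otimes>\<^bsub>?B\<^esub> c = c \<otimes>\<^bsub>?B\<^esub> b" for b c
    by (cases b, cases c) (simp add: add.commute)
  have cB: "carrier ?B = {0..<int (p ^ n)} \<times> {0..<int p}"
    using pn p1 by (simp add: carrier_integer_mod_group)
  obtain \<phi> where \<phi>: "\<phi> \<in> iso A ?B" using iso by (auto simp: is_iso_def)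
  have bij: "bij_betw \<phi> (carrier A) (carrier ?B)" using \<phi> by (simp add: iso_def)
  then have inj: "inj_on \<phi> (carrier A)" and img: "\<phi> ` carrier A = carrier ?B" by (auto simp: bij_betw_def)
  interpret \<phi>: group_hom A ?B \<phi> using \<phi> by unfold_locales (simp add: iso_def)
  have fin: "finite (carrier A)" using bij_betw_finite[OF bij] unfolding cB by simp
  interpret A: finite_group A by unfold_locales (rule fin)
  have pow: "(u, v) [^]\<^bsub>?B\<^esub> k = ((int k * u) mod int (p ^ n), (int k * v) mod int p)" for u v and k :: nat
    unfolding pow_DirProd by simp
  have phi_pow: "\<phi> (g [^]\<^bsub>A\<^esub> k) = \<phi> g [^]\<^bsub>?B\<^esub> k" if "g \<in> carrier A" for g and k :: nat
    using that by (rule \<phi>.hom_nat_pow)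
  show ?thesis
  proof (rule A.abelian_codegrees[OF _ p n])
    show "comm_group A"
    proof (rule A.group_comm_groupI)
      fix g h assume g: "g \<in> carrier A" and h: "h \<in> carrier A"
      have "\<phi> (g \<otimes>\<^bsub>A\<^esub> h) = \<phi> (h \<otimes>\<^bsub>A\<^esub> g)"
        unfolding \<phi>.hom_mult[OF g h] \<phi>.hom_mult[OF h g] by (rule B_comm)
      then show "g \<otimes>\<^bsub>A\<^esub> h = h \<otimes>\<^bsub>A\<^esub> g" by (rule inj_onD[OF inj]) (use g h in simp_all)
    qed
    have "card (carrier ?B) = p ^ Suc n" unfolding cB by (simp add: card_cartesian_product del: of_nat_power)
    then show "card (carrier A) = p ^ Suc n" using bij_betw_same_card[OF bij] by simp
  next
    fix g assume g: "g \<in> carrier A"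
    obtain u v where uv: "\<phi> g = (u, v)" by (cases "\<phi> g")
    have "p dvd p ^ n" using n by (simp add: dvd_power)
    then have "int p dvd int (p ^ n)" by (simp only: int_dvd_int_iff)
    then have "\<phi> (g [^]\<^bsub>A\<^esub> (p ^ n)) = \<one>\<^bsub>?B\<^esub>"
      unfolding phi_pow[OF g] uv pow by simp
    also have "\<dots> = \<phi> \<one>\<^bsub>A\<^esub>" by simp
    finally show "g [^]\<^bsub>A\<^esub> (p ^ n) = \<one>\<^bsub>A\<^esub>" by (rule inj_onD[OF inj]) (use g in simp_all)
  next
    fix j assume j: "1 \<le> j" "j \<le> n"
    let ?P = "(\<lambda>g. g [^]\<^bsub>A\<^esub> (p ^ j)) ` carrier A"
    have pnj: "int (p ^ n) = int (p ^ j) * int (p ^ (n - j))" using j by (simp add: power_add[symmetric])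
    have "int p dvd int (p ^ j)" using j by (simp only: int_dvd_int_iff) (simp add: dvd_power)
    \<comment> \<open>p^j u modulo p^n is p^j times the residue of u modulo p^(n-j); the second
      coordinate vanishes because j >= 1.\<close>
    then have powB: "(u, v) [^]\<^bsub>?B\<^esub> (p ^ j) = (int (p ^ j) * (u mod int (p ^ (n - j))), 0)" for u v
      unfolding pow pnj mod_mult_mult1 by simp
    have "\<phi> ` ?P = (\<lambda>b. b [^]\<^bsub>?B\<^esub> (p ^ j)) ` carrier ?B"
      unfolding img[symmetric] image_image by (intro image_cong refl phi_pow)
    also have "\<dots> = (\<lambda>t. (int (p ^ j) * t, 0)) ` {0..<int (p ^ (n - j))}"
    proof
      show "(\<lambda>b. b [^]\<^bsub>?B\<^esub> (p ^ j)) ` carrier ?B \<subseteq> (\<lambda>t. (int (p ^ j) * t, 0)) ` {0..<int (p ^ (n - j))}"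
      proof
        fix c assume "c \<in> (\<lambda>b. b [^]\<^bsub>?B\<^esub> (p ^ j)) ` carrier ?B"
        then obtain u v where "c = (u, v) [^]\<^bsub>?B\<^esub> (p ^ j)" by auto
        then have "c = (int (p ^ j) * (u mod int (p ^ (n - j))), 0)" by (simp only: powB)
        moreover have "u mod int (p ^ (n - j)) \<in> {0..<int (p ^ (n - j))}"
          using p1 by (simp del: of_nat_power)
        ultimately show "c \<in> (\<lambda>t. (int (p ^ j) * t, 0)) ` {0..<int (p ^ (n - j))}" by (rule image_eqI)
      qed
      show "(\<lambda>t. (int (p ^ j) * t, 0)) ` {0..<int (p ^ (n - j))} \<subseteq> (\<lambda>b. b [^]\<^bsub>?B\<^esub> (p ^ j)) ` carrier ?B"
      proof
        fix c assume "c \<in> (\<lambda>t. (int (p ^ j) * t, 0 :: int)) ` {0..<int (p ^ (n - j))}"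
        then obtain t where t: "t \<in> {0..<int (p ^ (n - j))}" "c = (int (p ^ j) * t, 0)" by blast
        have "p ^ (n - j) \<le> p ^ n" using p1 by (intro power_increasing) auto
        then have "int (p ^ (n - j)) \<le> int (p ^ n)" by (simp only: of_nat_le_iff)
        moreover have "t < int (p ^ (n - j))" using t(1) by (simp del: of_nat_power)
        ultimately have "t < int (p ^ n)" by (rule less_le_trans[rotated])
        then have "(t, 0) \<in> carrier ?B" unfolding cB using t(1) p1 by (simp del: of_nat_power)
        moreover have "c = (t, 0) [^]\<^bsub>?B\<^esub> (p ^ j)"
          unfolding powB t(2) using t(1) by (simp del: of_nat_power)
        ultimately show "c \<in> (\<lambda>b. b [^]\<^bsub>?B\<^esub> (p ^ j)) ` carrier ?B" by (rule rev_image_eqI)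
      qed
    qed
    finally have img_P: "\<phi> ` ?P = (\<lambda>t. (int (p ^ j) * t, 0)) ` {0..<int (p ^ (n - j))}" .
    have "inj_on \<phi> ?P" by (rule inj_on_subset[OF inj]) auto
    then have "card ?P = card (\<phi> ` ?P)" by (rule card_image[symmetric])
    also have "\<dots> = card {0..<int (p ^ (n - j))}"
      unfolding img_P using p1 by (intro card_image inj_onI) simp
    finally show "card ?P = p ^ (n - j)" by (simp del: of_nat_power)
  qed
qed

theorem theorem1p3:
  fixes p n :: nat
    and A :: "('a, 'c) monoid_scheme"
    and G :: "('b, 'd) monoid_scheme"
  assumes "prime p"
    and "n > 0"
    and "group A"
    and "A \<cong> integer_mod_group (p ^ n) \<times>\<times> integer_mod_group p"
    and "group G"
    and "finite (carrier G)"
    and "group_pseudo_algebra G = group_pseudo_algebra A"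
    and "(\<exists>M. maximal_subgroup M G \<and> metacyclic (G\<lparr>carrier := M\<rparr>)) \<or>
         (\<exists>x\<in>derived G (carrier G). \<exists>y\<in>derived G (carrier G).
             derived G (carrier G) = generate G {x, y}) \<or>
         comm_group (G\<lparr>carrier := derived G (carrier G)\<rparr>)"
  shows "G \<cong> A"
proof -
  interpret G: group G by fact
  have fG: "finite_group G" using assms(6) by unfold_locales
  have "codegree_like_rank_two A p n" by (rule codegree_like_rank_two_product[OF assms(3,1,2,4)])
  then have "codegree_like_rank_two G p n" by (rule codegree_like_rank_two_transfer[OF fG _ assms(7)])
  then have B: "integer_mod_group (p ^ n) \<times>\<times> integer_mod_group p \<cong> G"
    by (rule codegree_like_rank_two.iso_product)
  have "group (integer_mod_group (p ^ n) \<times>\<times> integer_mod_group p)" by (intro DirProd_group) simp_all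
  then have "G \<cong> integer_mod_group (p ^ n) \<times>\<times> integer_mod_group p" using B by (rule group.iso_sym)
  moreover have "integer_mod_group (p ^ n) \<times>\<times> integer_mod_group p \<cong> A" by (rule group.iso_sym[OF assms(3,4)])
  ultimately show ?thesis by (rule iso_trans)
qed

end
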